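(* Let $G$ be a finitely generated group equipped with the word-length metric. The canonical map $$\alpha_0^G \colon H_0\bigl(G; \ell^{\infty}(G,\mathbb{R})\bigr) \longrightarrow K_0\bigl(\ell^{\infty}(G) \rtimes_r G\bigr)$$ is split-injective (that is, it admits a left inverse group homomorphism).
   Context: $G$ acts by translation on $\ell^\infty(G)$ and $\ell^\infty(G,\mathbb{R})$ (bounded complex- and real-valued functions on $G$). $H_0(G;\ell^\infty(G,\mathbb{R}))$ is the $0$th group homology of $G$ with coefficients in $\ell^\infty(G,\mathbb{R})$, i.e. the group of coinvariants. $\ell^\infty(G)\rtimes_r G$ is the reduced crossed product; it is canonically isomorphic to the uniform Roe algebra $C^*_u(G)$, the norm closure in $\mathcal{B}(\ell^2(G))$ of the $*$-algebra of bounded operators $T$ with $\sup\{d(x,y) : \langle T\delta_x,\delta_y\rangle\neq 0\}<\infty$, where $d$ is the word-length metric. The $0$th uniformly finite homology group $H_0^{\mathrm{uf}}(G;\mathbb{Z})$ is the quotient of the group $\ell^\infty(G,\mathbb{Z})$ of bounded functions $G\to\mathbb{Z}$ by the image of the boundary map $\partial_1(f)(x)=\sum_{y\in G} f(y,x)-\sum_{y\in G} f(x,y)$, where $f$ ranges over bounded functions $G\times G\to\mathbb{Z}$ for which there is $R\ge 0$ with $f(x,y)=0$ whenever $d(x,y)>R$. The inclusion $\ell^\infty(G)\hookrightarrow C^*_u(G)$ induces a homomorphism $\ell^\infty(G,\mathbb{Z})=K_0(\ell^\infty(G))\to K_0(C^*_u(G))$, which descends to a homomorphism $\alpha_0\colon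 H_0^{\mathrm{uf}}(G;\mathbb{Z})\to K_0(C^*_u(G))$, called the $0$th comparison map. The canonical map $\alpha_0^G$ is this comparison map, with its source $H_0^{\mathrm{uf}}(G;\mathbb{Z})$ regarded as canonically identified with $H_0(G;\ell^\infty(G,\mathbb{R}))$ and its target $K_0(C^*_u(G))$ identified with $K_0(\ell^\infty(G)\rtimes_r G)$.
   Formalization: For finite G the source is ℝ and the target K_0 is ℤ, so the claim fails as displayed; it is stated with source H_0(G; ℓ^∞(G,ℝ)) for infinite G only, and with source H_0^uf(G;ℤ) for every finitely generated G. *)

theory Defs
  imports "HOL-Analysis.Analysis" "HOL-Algebra.Generated_Groups" "Jordan_Normal_Form.Matrix"
begin

section \<open>The Hilbert space of square-summable functions\<close>

typedef 'i ell2 = "{f :: 'i \<Rightarrow> complex. (\<lambda>i. (cmod (f i))\<^sup>2) summable_on UNIV}"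
  morphisms ell2_apply Abs_ell2
  by (rule exI[of _ "\<lambda>_. 0"]) simp

setup_lifting type_definition_ell2

lemma ell2_eqI: "(\<And>i. ell2_apply x i = ell2_apply y i) \<Longrightarrow> x = y"
  by (metis ell2_apply_inject ext)

lemma summable_ell2: "(\<lambda>i. (cmod (ell2_apply x i))\<^sup>2) summable_on UNIV"
  using ell2_apply[of x] by simp

lemma ell2_comparison:
  fixes f :: "'i \<Rightarrow> real"
  assumes "g summable_on UNIV" "\<And>i. 0 \<le> f i" "\<And>i. f i \<le> g i"
  shows "f summable_on UNIV"
  by (rule summable_on_comparison_test[OF assms(1)]) (use assms in auto)

lemma ell2_product_bound: "2 * (cmod z * cmod w) \<le> (cmod z)\<^sup>2 + (cmod w)\<^sup>2"
  using sum_squares_bound[of "cmod z" "cmod w"] by simp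

lemma abs_summable_ell2_mult:
  "(\<lambda>i. norm (ell2_apply x i * cnj (ell2_apply y i))) summable_on UNIV"
proof (rule ell2_comparison)
  show "(\<lambda>i. (cmod (ell2_apply x i))\<^sup>2 + (cmod (ell2_apply y i))\<^sup>2) summable_on UNIV"
    by (intro summable_on_add summable_ell2)
  fix i
  show "0 \<le> norm (ell2_apply x i * cnj (ell2_apply y i))" by simp
  show "norm (ell2_apply x i * cnj (ell2_apply y i))
          \<le> (cmod (ell2_apply x i))\<^sup>2 + (cmod (ell2_apply y i))\<^sup>2"
    using ell2_product_bound[of "ell2_apply x i" "ell2_apply y i"]
    by (simp add: norm_mult) (smt (verit) mult_nonneg_nonneg norm_ge_zero)
qed

lemma summable_ell2_inner: "(\<lambda>i. inner (ell2_apply x i) (ell2_apply y i)) summable_on UNIV"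
proof (rule abs_summable_summable, rule ell2_comparison)
  show "(\<lambda>i. norm (ell2_apply x i * cnj (ell2_apply y i))) summable_on UNIV"
    by (rule abs_summable_ell2_mult)
  fix i
  show "0 \<le> norm (inner (ell2_apply x i) (ell2_apply y i))" by simp
  show "norm (inner (ell2_apply x i) (ell2_apply y i))
          \<le> norm (ell2_apply x i * cnj (ell2_apply y i))"
    using Cauchy_Schwarz_ineq2[of "ell2_apply x i" "ell2_apply y i"] by (simp add: norm_mult)
qed

lemma summable_ell2_plus:
  assumes f: "(\<lambda>i. (cmod (f i))\<^sup>2) summable_on UNIV"
    and g: "(\<lambda>i. (cmod (g i))\<^sup>2) summable_on UNIV"
  shows "(\<lambda>i. (cmod (f i + g i))\<^sup>2) summable_on UNIV"
proof (rule ell2_comparison)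
  show "(\<lambda>i. 2 * (cmod (f i))\<^sup>2 + 2 * (cmod (g i))\<^sup>2) summable_on UNIV"
    using f g by (intro summable_on_add summable_on_cmult_right) auto
  fix i
  have "(cmod (f i + g i))\<^sup>2 \<le> (cmod (f i) + cmod (g i))\<^sup>2"
    by (intro power_mono norm_triangle_ineq) auto
  also have "\<dots> \<le> 2 * (cmod (f i))\<^sup>2 + 2 * (cmod (g i))\<^sup>2"
    using ell2_product_bound[of "f i" "g i"] by (simp add: power2_sum)
  finally show "(cmod (f i + g i))\<^sup>2 \<le> 2 * (cmod (f i))\<^sup>2 + 2 * (cmod (g i))\<^sup>2" .
qed simp

instantiation ell2 :: (type) real_inner
begin

lift_definition zero_ell2 :: "'a ell2" is "\<lambda>_. 0" by simp

lift_definition plus_ell2 :: "'a ell2 \<Rightarrow> 'a ell2 \<Rightarrow> 'a ell2" is "\<lambda>f g i. f i + g i"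
  by (simp add: summable_ell2_plus)

lift_definition uminus_ell2 :: "'a ell2 \<Rightarrow> 'a ell2" is "\<lambda>f i. - f i" by simp

definition minus_ell2 :: "'a ell2 \<Rightarrow> 'a ell2 \<Rightarrow> 'a ell2" where "minus_ell2 x y = x + - y"

lift_definition scaleR_ell2 :: "real \<Rightarrow> 'a ell2 \<Rightarrow> 'a ell2" is "\<lambda>r f i. r *\<^sub>R f i"
  by (auto simp: power_mult_distrib intro!: summable_on_cmult_right)

definition inner_ell2 :: "'a ell2 \<Rightarrow> 'a ell2 \<Rightarrow> real" where
  "inner_ell2 x y = (\<Sum>\<^sub>\<infinity>i. inner (ell2_apply x i) (ell2_apply y i))"

definition norm_ell2 :: "'a ell2 \<Rightarrow> real" where "norm_ell2 x = sqrt (inner x x)"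
definition dist_ell2 :: "'a ell2 \<Rightarrow> 'a ell2 \<Rightarrow> real" where "dist_ell2 x y = norm (x - y)"
definition sgn_ell2 :: "'a ell2 \<Rightarrow> 'a ell2" where "sgn_ell2 x = inverse (norm x) *\<^sub>R x"
definition uniformity_ell2 :: "('a ell2 \<times> 'a ell2) filter" where
  "uniformity_ell2 = (INF e\<in>{0 <..}. principal {(x, y). dist x y < e})"
definition open_ell2 :: "'a ell2 set \<Rightarrow> bool" where
  "open_ell2 U = (\<forall>x\<in>U. \<forall>\<^sub>F (x', y) in uniformity. x' = x \<longrightarrow> y \<in> U)"

instance
proof
  fix x y z :: "'a ell2" and r s :: real
  show "x + y + z = x + (y + z)" "x + y = y + x" "0 + x = x" "- x + x = 0"
    by (transfer; simp add: algebra_simps)+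
  show "x - y = x + - y" by (simp add: minus_ell2_def)
  show "r *\<^sub>R (x + y) = r *\<^sub>R x + r *\<^sub>R y" "(r + s) *\<^sub>R x = r *\<^sub>R x + s *\<^sub>R x"
    "r *\<^sub>R s *\<^sub>R x = (r * s) *\<^sub>R x" "1 *\<^sub>R x = x"
    by (transfer; simp add: algebra_simps)+
  show "dist x y = norm (x - y)" by (simp add: dist_ell2_def)
  show "sgn x = inverse (norm x) *\<^sub>R x" by (simp add: sgn_ell2_def)
  show "inner x y = inner y x" by (simp add: inner_ell2_def inner_commute)
  show "inner (x + y) z = inner x z + inner y z"
    unfolding inner_ell2_def
    by (subst infsum_add[symmetric]) (auto simp: summable_ell2_inner plus_ell2.rep_eq inner_add_left)
  show "inner (r *\<^sub>R x) y = r * inner x y"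
    unfolding inner_ell2_def
    by (subst infsum_cmult_right[symmetric])
       (auto simp: summable_ell2_inner scaleR_ell2.rep_eq simp flip: scaleR_conv_of_real)
  show "0 \<le> inner x x" unfolding inner_ell2_def by (rule infsum_nonneg) simp
  show "inner x x = 0 \<longleftrightarrow> x = 0"
  proof
    assume "inner x x = 0"
    then have "\<And>i. inner (ell2_apply x i) (ell2_apply x i) = 0"
      unfolding inner_ell2_def
      by (intro nonneg_infsum_le_0D[where A = UNIV]) (auto simp: summable_ell2_inner)
    then show "x = 0" by (intro ell2_eqI) (simp add: zero_ell2.rep_eq)
  qed (simp add: inner_ell2_def zero_ell2.rep_eq)
  show "norm x = sqrt (inner x x)" by (simp add: norm_ell2_def)
  show "(uniformity :: ('a ell2 \<times> 'a ell2) filter)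
          = (INF e\<in>{0 <..}. principal {(x, y). dist x y < e})"
    by (simp add: uniformity_ell2_def)
  show "open U = (\<forall>x\<in>U. \<forall>\<^sub>F (x', y) in uniformity. x' = x \<longrightarrow> y \<in> U)" for U :: "'a ell2 set"
    by (simp add: open_ell2_def)
qed

end

lemma norm_ell2_sq: "(norm x)\<^sup>2 = (\<Sum>\<^sub>\<infinity>i. (cmod (ell2_apply x i))\<^sup>2)"
  unfolding power2_norm_eq_inner inner_ell2_def
  by (intro infsum_cong) (simp add: power2_norm_eq_inner)

lift_definition scaleC_ell2 :: "complex \<Rightarrow> 'i ell2 \<Rightarrow> 'i ell2" is "\<lambda>c f i. c * f i"
  by (auto simp: norm_mult power_mult_distrib intro!: summable_on_cmult_right)

definition cinner :: "'i ell2 \<Rightarrow> 'i ell2 \<Rightarrow> complex" where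
  "cinner x y = (\<Sum>\<^sub>\<infinity>i. ell2_apply x i * cnj (ell2_apply y i))"

lemma summable_ell2_delta: "(\<lambda>j. (cmod (if j = i then 1 else 0))\<^sup>2) summable_on UNIV"
proof -
  have "(\<lambda>j. (cmod (if j = i then 1 else 0))\<^sup>2) summable_on UNIV \<longleftrightarrow>
        (\<lambda>j. (cmod (if j = i then 1 else 0))\<^sup>2) summable_on {i}"
    by (rule summable_on_cong_neutral) auto
  then show ?thesis by simp
qed

lift_definition delta :: "'i \<Rightarrow> 'i ell2" is "\<lambda>i j. if j = i then 1 else 0"
  by (simp add: summable_ell2_delta)

lemma scaleC_ell2_add: "scaleC_ell2 c (x + y) = scaleC_ell2 c x + scaleC_ell2 c y"
  by transfer (simp add: algebra_simps)

lemma scaleC_ell2_minus: "scaleC_ell2 c (- x) = - scaleC_ell2 c x"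
  by transfer simp

lemma scaleC_ell2_scaleR: "scaleC_ell2 c (r *\<^sub>R x) = r *\<^sub>R scaleC_ell2 c x"
  by transfer simp

lemma scaleC_ell2_zero: "scaleC_ell2 c 0 = 0"
  by transfer simp

lemma scaleC_ell2_of_real: "scaleC_ell2 (of_real r) x = r *\<^sub>R x"
  by transfer (simp add: scaleR_conv_of_real)

lemma bij_betw_fibres:
  "bij_betw (\<lambda>(x, y). (- y + x, x)) UNIV (UNIV :: ('g::group_add \<times> 'g) set)"
  by (rule bij_betw_byWitness[where f' = "\<lambda>(s, x). (x, x - s)"])
     (auto simp: minus_diff_eq diff_conv_add_uminus minus_add add.assoc simp del: add_uminus_conv_diff)

lemma summable_ell2_fibres:
  fixes x :: "'g::group_add"
  assumes "(\<lambda>p. (cmod (f p))\<^sup>2) summable_on UNIV"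
  shows "(\<lambda>(x, y). (cmod (f (- y + x, x)))\<^sup>2) summable_on UNIV"
    and "(\<lambda>y. (cmod (f (- y + x, x)))\<^sup>2) summable_on UNIV"
proof -
  have "(\<lambda>p. (cmod (f (case p of (x, y) \<Rightarrow> (- y + x, x))))\<^sup>2) summable_on UNIV"
    using assms by (subst summable_on_reindex_bij_betw[OF bij_betw_fibres])
  then show *: "(\<lambda>(x, y). (cmod (f (- y + x, x)))\<^sup>2) summable_on UNIV"
    by (simp add: case_prod_unfold)
  then have "(\<lambda>(x, y). (cmod (f (- y + x, x)))\<^sup>2) summable_on Pair x ` UNIV"
    by (rule summable_on_subset_banach) simp
  then show "(\<lambda>y. (cmod (f (- y + x, x)))\<^sup>2) summable_on UNIV"
    by (subst (asm) summable_on_reindex) (auto simp: inj_on_def o_def)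
qed

text \<open>
  For each \<open>x\<close>, the subspace of functions on \<open>G \<times> {x}\<close> is a copy of \<open>\<ell>\<^sup>2(G)\<close> through
  \<open>s \<mapsto> x s\<inverse>\<close>; \<open>fibre x\<close> is the corresponding coordinate projection.
\<close>

lift_definition fibre :: "'g::group_add \<Rightarrow> ('g \<times> 'g) ell2 \<Rightarrow> 'g ell2"
  is "\<lambda>x f y. f (- y + x, x)"
  by (rule summable_ell2_fibres(2)) simp

lemma fibre_add: "fibre x (v + w) = fibre x v + fibre x w"
  by transfer simp

lemma fibre_scaleC: "fibre x (scaleC_ell2 c v) = scaleC_ell2 c (fibre x v)"
  by transfer simp

lemma has_sum_ell2: "((\<lambda>i. (cmod (ell2_apply v i))\<^sup>2) has_sum (norm v)\<^sup>2) UNIV"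
  unfolding norm_ell2_sq by (rule has_sum_infsum[OF summable_ell2])

lemma has_sum_fibres: "((\<lambda>x. (norm (fibre x v))\<^sup>2) has_sum (norm v)\<^sup>2) UNIV"
proof -
  have "((\<lambda>p. (cmod (ell2_apply v (case p of (x, y) \<Rightarrow> (- y + x, x))))\<^sup>2) has_sum (norm v)\<^sup>2) UNIV"
    using has_sum_ell2[of v] by (subst has_sum_reindex_bij_betw[OF bij_betw_fibres])
  then have "((\<lambda>(x, y). (cmod (ell2_apply v (- y + x, x)))\<^sup>2) has_sum (norm v)\<^sup>2) (Sigma UNIV (\<lambda>_. UNIV))"
    by (simp add: case_prod_unfold)
  then show ?thesis
    by (rule has_sum_SigmaD) (use has_sum_ell2[of "fibre _ v"] in \<open>simp add: fibre.rep_eq\<close>)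
qed

lifting_forget ell2.lifting


section \<open>Bounded operators on it\<close>

typedef 'i bop = "{T :: 'i ell2 \<Rightarrow>\<^sub>L 'i ell2.
    \<forall>c x. blinfun_apply T (scaleC_ell2 c x) = scaleC_ell2 c (blinfun_apply T x)}"
  morphisms blinfun_of_bop Abs_bop
  by (rule exI[of _ 0]) (auto intro!: ell2_eqI simp: scaleC_ell2.rep_eq zero_ell2.rep_eq)

setup_lifting type_definition_bop

lift_definition bop_apply :: "'i bop \<Rightarrow> 'i ell2 \<Rightarrow> 'i ell2" is blinfun_apply .

lemma bop_eqI: "(\<And>x. bop_apply S x = bop_apply T x) \<Longrightarrow> S = T"
  by transfer (rule blinfun_eqI)

instantiation bop :: (type) ring_1
begin

lift_definition zero_bop :: "'a bop" is 0 by (simp add: scaleC_ell2_zero)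
lift_definition one_bop :: "'a bop" is id_blinfun by simp
lift_definition plus_bop :: "'a bop \<Rightarrow> 'a bop \<Rightarrow> 'a bop" is "(+)"
  by (simp add: plus_blinfun.rep_eq scaleC_ell2_add)
lift_definition uminus_bop :: "'a bop \<Rightarrow> 'a bop" is uminus
  by (simp add: uminus_blinfun.rep_eq scaleC_ell2_minus)
lift_definition times_bop :: "'a bop \<Rightarrow> 'a bop \<Rightarrow> 'a bop" is "(o\<^sub>L)" by simp
definition minus_bop :: "'a bop \<Rightarrow> 'a bop \<Rightarrow> 'a bop" where "minus_bop S T = S + - T"

instance
proof
  fix S T U :: "'a bop"
  show "S + T + U = S + (T + U)" "S + T = T + S" "0 + S = S" "- S + S = 0"
    by (transfer; simp)+
  show "S - T = S + - T" by (simp add: minus_bop_def)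
  show "S * T * U = S * (T * U)" by transfer (auto intro!: blinfun_eqI)
  show "1 * S = S" "S * 1 = S" by (transfer; auto intro!: blinfun_eqI)+
  show "(S + T) * U = S * U + T * U" "S * (T + U) = S * T + S * U"
    by (transfer; auto intro!: blinfun_eqI simp: blinfun.bilinear_simps)+
  have "bop_apply (1 :: 'a bop) (delta i) \<noteq> bop_apply 0 (delta i)" for i :: 'a
  proof
    assume "bop_apply (1 :: 'a bop) (delta i) = bop_apply 0 (delta i)"
    then have "delta i = 0" by transfer simp
    then have "ell2_apply (delta i) i = ell2_apply 0 i" by simp
    then show False by (simp add: delta.rep_eq zero_ell2.rep_eq)
  qed
  then show "(0 :: 'a bop) \<noteq> 1" by metis
qed

end

instantiation bop :: (type) real_normed_vector
begin

lift_definition scaleR_bop :: "real \<Rightarrow> 'a bop \<Rightarrow> 'a bop" is "(*\<^sub>R)"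
  by (simp add: scaleR_blinfun.rep_eq scaleC_ell2_scaleR)
lift_definition norm_bop :: "'a bop \<Rightarrow> real" is norm .
definition dist_bop :: "'a bop \<Rightarrow> 'a bop \<Rightarrow> real" where "dist_bop S T = norm (S - T)"
definition sgn_bop :: "'a bop \<Rightarrow> 'a bop" where "sgn_bop S = inverse (norm S) *\<^sub>R S"
definition uniformity_bop :: "('a bop \<times> 'a bop) filter" where
  "uniformity_bop = (INF e\<in>{0 <..}. principal {(x, y). dist x y < e})"
definition open_bop :: "'a bop set \<Rightarrow> bool" where
  "open_bop U = (\<forall>x\<in>U. \<forall>\<^sub>F (x', y) in uniformity. x' = x \<longrightarrow> y \<in> U)"

instance
proof
  fix S T :: "'a bop" and r s :: real
  show "r *\<^sub>R (S + T) = r *\<^sub>R S + r *\<^sub>R T" "(r + s) *\<^sub>R S = r *\<^sub>R S + s *\<^sub>R S"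
    "r *\<^sub>R s *\<^sub>R S = (r * s) *\<^sub>R S" "1 *\<^sub>R S = S"
    by (transfer; simp add: algebra_simps)+
  show "dist S T = norm (S - T)" by (simp add: dist_bop_def)
  show "sgn S = inverse (norm S) *\<^sub>R S" by (simp add: sgn_bop_def)
  show "(norm S = 0) = (S = 0)" by transfer simp
  show "norm (S + T) \<le> norm S + norm T" by transfer (rule norm_triangle_ineq)
  show "norm (r *\<^sub>R S) = \<bar>r\<bar> * norm S" by transfer simp
  show "(uniformity :: ('a bop \<times> 'a bop) filter)
          = (INF e\<in>{0 <..}. principal {(x, y). dist x y < e})"
    by (simp add: uniformity_bop_def)
  show "open U = (\<forall>x\<in>U. \<forall>\<^sub>F (x', y) in uniformity. x' = x \<longrightarrow> y \<in> U)" for U :: "'a bop set"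
    by (simp add: open_bop_def)
qed

end

definition is_adjoint :: "'i bop \<Rightarrow> 'i bop \<Rightarrow> bool" where
  "is_adjoint S T \<longleftrightarrow> (\<forall>x y. cinner (bop_apply S x) y = cinner x (bop_apply T y))"

lemma bop_of_function:
  assumes add: "\<And>x y. F (x + y) = F x + F y"
    and scale: "\<And>c x. F (scaleC_ell2 c x) = scaleC_ell2 c (F x)"
    and bound: "\<And>x. norm (F x) \<le> norm x * K"
  shows "\<exists>T. bop_apply T = F"
proof -
  have "bounded_linear F"
    by (rule bounded_linear_intro[where K = K])
       (use add bound scale[of "of_real _"] in \<open>simp_all add: scaleC_ell2_of_real\<close>)
  then have F: "blinfun_apply (Blinfun F) = F" by (rule bounded_linear_Blinfun_apply)
  have "bop_apply (Abs_bop (Blinfun F)) = F"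
    unfolding bop_apply.rep_eq by (subst Abs_bop_inverse) (simp_all add: F scale)
  then show ?thesis by blast
qed


lemma norm_ell2_le:
  assumes "\<And>i. (cmod (ell2_apply v i))\<^sup>2 \<le> C\<^sup>2 * g i" "(g has_sum (norm w)\<^sup>2) UNIV" "0 \<le> C"
  shows "norm v \<le> norm w * C"
proof -
  have "(norm v)\<^sup>2 \<le> C\<^sup>2 * (norm w)\<^sup>2"
    by (rule has_sum_mono[OF has_sum_ell2 has_sum_cmult_right[OF assms(2)]]) (rule assms(1))
  then have "(norm v)\<^sup>2 \<le> (norm w * C)\<^sup>2"
    by (simp add: power_mult_distrib mult.commute)
  then show ?thesis
    by (rule power2_le_imp_le) (simp add: assms(3))
qed

definition mult_op :: "('i \<Rightarrow> complex) \<Rightarrow> 'i bop" where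
  "mult_op f = (THE T. \<forall>v i. ell2_apply (bop_apply T v) i = f i * ell2_apply v i)"

definition shift_op :: "('i \<Rightarrow> 'i) \<Rightarrow> 'i bop" where
  "shift_op \<sigma> = (THE T. \<forall>v i. ell2_apply (bop_apply T v) i = ell2_apply v (\<sigma> i))"

text \<open>
  \<open>amplify T\<close> acts as \<open>T\<close> on each of the copies of \<open>\<ell>\<^sup>2(G)\<close> in \<open>\<ell>\<^sup>2(G \<times> G)\<close> given by the fibres.
\<close>

definition amplify :: "'g::group_add bop \<Rightarrow> ('g \<times> 'g) bop" where
  "amplify T = (THE W. \<forall>v s x. ell2_apply (bop_apply W v) (s, x)
                               = ell2_apply (bop_apply T (fibre x v)) (x - s))"

lemma the_bop:
  assumes ex: "\<exists>T. bop_apply T = F"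
  shows "bop_apply (THE T. \<forall>v i. ell2_apply (bop_apply T v) i = ell2_apply (F v) i) = F"
proof -
  obtain T where T: "bop_apply T = F" using ex by blast
  have "(THE T. \<forall>v i. ell2_apply (bop_apply T v) i = ell2_apply (F v) i) = T"
    by (rule the_equality) (auto simp: T intro!: bop_eqI ell2_eqI)
  with T show ?thesis by simp
qed

lemma mult_op_apply:
  assumes "bounded (range f)"
  shows "ell2_apply (bop_apply (mult_op f) v) i = f i * ell2_apply v i"
proof -
  define F where "F = (\<lambda>v. Abs_ell2 (\<lambda>i. f i * ell2_apply v i))"
  obtain C where C: "\<And>i. cmod (f i) \<le> C" using assms by (auto simp: bounded_iff)
  have C0: "0 \<le> C" using C norm_ge_zero order_trans by blast
  have le: "(cmod (f i * ell2_apply v i))\<^sup>2 \<le> C\<^sup>2 * (cmod (ell2_apply v i))\<^sup>2" for v i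
    using C[of i] by (auto simp: norm_mult power_mult_distrib intro!: mult_right_mono power_mono)
  have F: "ell2_apply (F v) i = f i * ell2_apply v i" for v i
    unfolding F_def
    by (subst Abs_ell2_inverse)
       (auto intro!: ell2_comparison[OF summable_on_cmult_right[OF summable_ell2] _ le])
  have "\<exists>T. bop_apply T = F"
  proof (rule bop_of_function)
    show "norm (F v) \<le> norm v * C" for v
      by (rule norm_ell2_le[OF _ has_sum_ell2 C0]) (simp only: F le)
  qed (auto intro!: ell2_eqI simp: F plus_ell2.rep_eq scaleC_ell2.rep_eq algebra_simps)
  from the_bop[OF this] show ?thesis by (simp add: F mult_op_def)
qed

lemma shift_op_apply:
  assumes "bij \<sigma>"
  shows "ell2_apply (bop_apply (shift_op \<sigma>) v) i = ell2_apply v (\<sigma> i)"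
proof -
  define F where "F = (\<lambda>v. Abs_ell2 (\<lambda>i. ell2_apply v (\<sigma> i)))"
  have sum: "((\<lambda>i. (cmod (ell2_apply v (\<sigma> i)))\<^sup>2) has_sum (norm v)\<^sup>2) UNIV" for v
    using has_sum_ell2[of v] by (subst has_sum_reindex_bij_betw[OF assms])
  have F: "ell2_apply (F v) i = ell2_apply v (\<sigma> i)" for v i
    unfolding F_def by (subst Abs_ell2_inverse) (use sum in \<open>auto dest: has_sum_imp_summable\<close>)
  have "\<exists>T. bop_apply T = F"
  proof (rule bop_of_function)
    show "norm (F v) \<le> norm v * 1" for v
      by (rule norm_ell2_le[OF _ sum]) (simp_all add: F)
  qed (auto intro!: ell2_eqI simp: F plus_ell2.rep_eq scaleC_ell2.rep_eq)
  from the_bop[OF this] show ?thesis by (simp add: F shift_op_def)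
qed

lemma bop_apply_add: "bop_apply T (v + w) = bop_apply T v + bop_apply T w"
  by (simp add: bop_apply.rep_eq blinfun.add_right)

lemma bop_apply_scaleC: "bop_apply T (scaleC_ell2 c v) = scaleC_ell2 c (bop_apply T v)"
  using blinfun_of_bop[of T] by (simp add: bop_apply.rep_eq)

lemma norm_bop_apply: "norm (bop_apply T v) \<le> norm T * norm v"
  by (simp add: bop_apply.rep_eq norm_bop.rep_eq norm_blinfun)

lemma amplify_apply:
  "ell2_apply (bop_apply (amplify T) v) (s, x) = ell2_apply (bop_apply T (fibre x v)) (x - s)"
proof -
  define F where
    "F = (\<lambda>v. Abs_ell2 (\<lambda>(s, x). ell2_apply (bop_apply T (fibre x v)) (x - s)))"
  have le: "(norm (bop_apply T (fibre x v)))\<^sup>2 \<le> (norm T)\<^sup>2 * (norm (fibre x v))\<^sup>2" for x v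
    using power_mono[OF norm_bop_apply norm_ge_zero, of T "fibre x v" 2]
    by (simp add: power_mult_distrib)
  have sum: "((\<lambda>x. (norm T)\<^sup>2 * (norm (fibre x v))\<^sup>2) has_sum (norm T)\<^sup>2 * (norm v)\<^sup>2) UNIV" for v
    by (rule has_sum_cmult_right[OF has_sum_fibres])
  have sumT: "(\<lambda>x. (norm (bop_apply T (fibre x v)))\<^sup>2) summable_on UNIV" for v
    by (rule ell2_comparison[OF has_sum_imp_summable[OF sum] _ le]) simp
  have "(\<lambda>(x, y). (cmod (ell2_apply (bop_apply T (fibre x v)) y))\<^sup>2) summable_on
          Sigma UNIV (\<lambda>_. UNIV)" for v
    by (rule summable_on_SigmaI[OF _ sumT[of v]]) (auto intro: has_sum_ell2)
  then have "(\<lambda>p. case case p of (s, x) \<Rightarrow> (x, x - s) of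
          (x, y) \<Rightarrow> (cmod (ell2_apply (bop_apply T (fibre x v)) y))\<^sup>2) summable_on UNIV" for v
    by (subst summable_on_reindex_bij_betw[where B = UNIV])
       (auto intro!: bij_betw_byWitness[where f' = "\<lambda>(x, y). (- y + x, x)"]
             simp: diff_conv_add_uminus minus_add add.assoc simp del: add_uminus_conv_diff)
  then have "(\<lambda>p. (cmod (case p of (s, x) \<Rightarrow> ell2_apply (bop_apply T (fibre x v)) (x - s)))\<^sup>2)
          summable_on UNIV" for v
    by (simp add: case_prod_unfold)
  then have F: "ell2_apply (F v) (s, x) = ell2_apply (bop_apply T (fibre x v)) (x - s)" for v s x
    unfolding F_def by (subst Abs_ell2_inverse) auto
  have fib: "fibre x (F v) = bop_apply T (fibre x v)" for x v
    by (rule ell2_eqI) (simp add: fibre.rep_eq F diff_conv_add_uminus minus_add add.assoc del: add_uminus_conv_diff)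
  have "\<exists>W. bop_apply W = F"
  proof (rule bop_of_function)
    fix v :: "('a \<times> 'a) ell2"
    have "(norm (F v))\<^sup>2 \<le> (norm T)\<^sup>2 * (norm v)\<^sup>2"
      using has_sum_fibres[of "F v"] by (rule has_sum_mono[OF _ sum]) (simp only: fib le)
    then have "(norm (F v))\<^sup>2 \<le> (norm v * norm T)\<^sup>2"
      by (simp add: power_mult_distrib mult.commute)
    then show "norm (F v) \<le> norm v * norm T"
      by (rule power2_le_imp_le) simp
  next
    show "F (v + w) = F v + F w" for v w
      by (rule ell2_eqI) (auto simp: F plus_ell2.rep_eq fibre_add bop_apply_add)
    show "F (scaleC_ell2 c v) = scaleC_ell2 c (F v)" for c v
      by (rule ell2_eqI) (auto simp: F scaleC_ell2.rep_eq fibre_scaleC bop_apply_scaleC)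
  qed
  from the_bop[OF this] have "bop_apply (amplify T) = F"
    unfolding amplify_def by (simp only: split_paired_All F)
  then show ?thesis by (simp add: F)
qed


section \<open>K-theory in degree zero\<close>

definition grothendieck_rel :: "('a, 'b) monoid_scheme \<Rightarrow> (('a \<times> 'a) \<times> ('a \<times> 'a)) set" where
  "grothendieck_rel M = {((a, b), (c, d)). a \<in> carrier M \<and> b \<in> carrier M \<and> c \<in> carrier M \<and> d \<in> carrier M
     \<and> (\<exists>e\<in>carrier M. a \<otimes>\<^bsub>M\<^esub> d \<otimes>\<^bsub>M\<^esub> e = c \<otimes>\<^bsub>M\<^esub> b \<otimes>\<^bsub>M\<^esub> e)}"

definition grothendieck_group :: "('a, 'b) monoid_scheme \<Rightarrow> ('a \<times> 'a) set monoid" where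
  "grothendieck_group M =
    \<lparr>carrier = (carrier M \<times> carrier M) // grothendieck_rel M,
     mult = (\<lambda>X Y. \<Union>(a, b)\<in>X. \<Union>(c, d)\<in>Y. grothendieck_rel M `` {(a \<otimes>\<^bsub>M\<^esub> c, b \<otimes>\<^bsub>M\<^esub> d)}),
     one = grothendieck_rel M `` {(\<one>\<^bsub>M\<^esub>, \<one>\<^bsub>M\<^esub>)}\<rparr>"

definition mat_is_adjoint :: "'i bop mat \<Rightarrow> 'i bop mat \<Rightarrow> bool" where
  "mat_is_adjoint w v \<longleftrightarrow> dim_row w = dim_col v \<and> dim_col w = dim_row v \<and>
     (\<forall>i<dim_row v. \<forall>j<dim_col v. is_adjoint (w $$ (j, i)) (v $$ (i, j)))"

definition projections :: "'i bop set \<Rightarrow> 'i bop mat set" where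
  "projections A = {p. square_mat p \<and> elements_mat p \<subseteq> A \<and> p * p = p \<and> mat_is_adjoint p p}"

definition mvn_rel :: "'i bop set \<Rightarrow> ('i bop mat \<times> 'i bop mat) set" where
  "mvn_rel A = {(p, q). p \<in> projections A \<and> q \<in> projections A \<and>
     (\<exists>v\<in>carrier_mat (dim_row q) (dim_row p). \<exists>w. elements_mat v \<subseteq> A \<and> mat_is_adjoint w v \<and>
        p = w * v \<and> q = v * w)}"

definition direct_sum_mat :: "'a::zero mat \<Rightarrow> 'a mat \<Rightarrow> 'a mat" where
  "direct_sum_mat p q =
     four_block_mat p (0\<^sub>m (dim_row p) (dim_col q)) (0\<^sub>m (dim_row q) (dim_col p)) q"

definition projection_monoid :: "'i bop set \<Rightarrow> 'i bop mat set monoid" where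
  "projection_monoid A =
    \<lparr>carrier = projections A // mvn_rel A,
     mult = (\<lambda>X Y. \<Union>p\<in>X. \<Union>q\<in>Y. mvn_rel A `` {direct_sum_mat p q}),
     one = mvn_rel A `` {0\<^sub>m 0 0}\<rparr>"

text \<open>
  \<open>A\<close> is meant to be a unital C*-algebra of operators, so no unitization is needed.
\<close>

definition K0 :: "'i bop set \<Rightarrow> ('i bop mat set \<times> 'i bop mat set) set monoid" where
  "K0 A = grothendieck_group (projection_monoid A)"

definition K0_class :: "'i bop set \<Rightarrow> 'i bop mat \<Rightarrow> 'i bop mat \<Rightarrow> ('i bop mat set \<times> 'i bop mat set) set" where
  "K0_class A p q = grothendieck_rel (projection_monoid A) `` {(mvn_rel A `` {p}, mvn_rel A `` {q})}"

text \<open>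
  The homomorphism into \<open>K\<^sub>0(B)\<close> induced by a *-homomorphism \<open>\<phi>\<close>. Here and below, a map
  on a quotient takes the common value of the given map on all representatives.
\<close>

definition K0_map :: "'j bop set \<Rightarrow> ('i bop \<Rightarrow> 'j bop) \<Rightarrow> ('i bop mat set \<times> 'i bop mat set) set
    \<Rightarrow> ('j bop mat set \<times> 'j bop mat set) set" where
  "K0_map B \<phi> X =
     the_elem (\<Union>(a, b)\<in>X. {K0_class B (map_mat \<phi> p) (map_mat \<phi> q) | p q. p \<in> a \<and> q \<in> b})"


section \<open>Operator algebras of a finitely generated group\<close>

text \<open>
  The group \<open>G\<close> is a type of class \<open>group_add\<close>, so it is written additively but need not be
  commutative. The word metric is the left-invariant one, \<open>d(x, y) = |x\<inverse>y|\<close>; accordingly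
  \<open>G\<close> acts on functions by right translation, \<open>(t \<cdot> f)(x) = f(xt)\<close>. The map \<open>x \<mapsto> x\<inverse>\<close>
  carries this to the right-invariant metric and left translation.
\<close>

definition is_word :: "'g::group_add set \<Rightarrow> 'g list \<Rightarrow> bool" where
  "is_word S ts \<longleftrightarrow> set ts \<subseteq> S \<union> uminus ` S"

definition generates_group :: "'g::group_add set \<Rightarrow> bool" where
  "generates_group S \<longleftrightarrow> (\<forall>x. \<exists>ts. is_word S ts \<and> sum_list ts = x)"

definition word_length :: "'g::group_add set \<Rightarrow> 'g \<Rightarrow> nat" where
  "word_length S x = (LEAST n. \<exists>ts. is_word S ts \<and> sum_list ts = x \<and> length ts = n)"

definition word_dist :: "'g::group_add set \<Rightarrow> 'g \<Rightarrow> 'g \<Rightarrow> nat" where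
  "word_dist S x y = word_length S (- x + y)"

definition linf_algebra :: "'i bop set" where
  "linf_algebra = mult_op ` {f. bounded (range f)}"

definition uniform_Roe_algebra :: "'g::group_add set \<Rightarrow> 'g bop set" where
  "uniform_Roe_algebra S = closure
     {T. bdd_above {word_dist S x y | x y. cinner (bop_apply T (delta x)) (delta y) \<noteq> 0}}"

text \<open>
  The regular representation of \<open>\<ell>\<^sup>\<infinity>(G) \<rtimes> G\<close> on \<open>\<ell>\<^sup>2(G, \<ell>\<^sup>2(G))\<close>:
  \<open>(\<pi>(f) v)(s) = (s\<inverse> \<cdot> f) v(s)\<close> and \<open>(\<lambda>\<^sub>t v)(s) = v(t\<inverse>s)\<close>.
\<close>

definition regular_function :: "('g::group_add \<Rightarrow> complex) \<Rightarrow> ('g \<times> 'g) bop" where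
  "regular_function f = mult_op (\<lambda>(s, x). f (x - s))"

definition regular_unitary :: "'g::group_add \<Rightarrow> ('g \<times> 'g) bop" where
  "regular_unitary t = shift_op (\<lambda>(s, x). (- t + s, x))"

definition reduced_crossed_product :: "('g::group_add \<times> 'g) bop set" where
  "reduced_crossed_product =
     closure (span {regular_function f * regular_unitary t | f t. bounded (range f)})"

text \<open>
  \<open>amplify\<close> is the canonical isomorphism from the uniform Roe algebra to the reduced crossed
  product: it sends multiplication by \<open>f\<close> to \<open>\<pi>(f)\<close> and right translation by \<open>t\<close> to \<open>\<lambda>\<^sub>t\<close>.
\<close>

lemma amplify_mult_op:
  assumes "bounded (range f)"
  shows "amplify (mult_op f) = regular_function f"
proof (intro bop_eqI ell2_eqI)
  fix v and i :: "'a \<times> 'a"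
  have "bounded (range (\<lambda>(s, x). f (x - s)))"
    by (rule bounded_subset[OF assms]) auto
  then show "ell2_apply (bop_apply (amplify (mult_op f)) v) i
               = ell2_apply (bop_apply (regular_function f) v) i"
    by (cases i) (simp add: regular_function_def amplify_apply mult_op_apply assms fibre.rep_eq
      diff_conv_add_uminus minus_add add.assoc del: add_uminus_conv_diff)
qed

lemma amplify_shift_op:
  "amplify (shift_op (\<lambda>y. y + t)) = regular_unitary t"
proof (intro bop_eqI ell2_eqI)
  fix v and i :: "'a \<times> 'a"
  have "bij (\<lambda>y. y + t)"
    by (rule bij_betw_byWitness[where f' = "\<lambda>y. y - t"]) auto
  moreover have "bij (\<lambda>(s, x :: 'a). (- t + s, x))"
    by (rule bij_betw_byWitness[where f' = "\<lambda>(s, x). (t + s, x)"]) (auto simp: add.assoc[symmetric])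
  ultimately show "ell2_apply (bop_apply (amplify (shift_op (\<lambda>y. y + t))) v) i
               = ell2_apply (bop_apply (regular_unitary t) v) i"
    by (cases i) (simp add: regular_unitary_def amplify_apply shift_op_apply fibre.rep_eq
      diff_conv_add_uminus minus_add add.assoc del: add_uminus_conv_diff)
qed


section \<open>Homology and the comparison map\<close>

definition bounded_functions :: "('i \<Rightarrow> 'a::linordered_idom) monoid" where
  "bounded_functions =
     \<lparr>carrier = {f. \<exists>C. \<forall>x. \<bar>f x\<bar> \<le> C}, mult = (\<lambda>f g x. f x + g x), one = (\<lambda>_. 0)\<rparr>"

definition coinvariant_relations :: "('g::group_add \<Rightarrow> real) set" where
  "coinvariant_relations = generate bounded_functions
     {(\<lambda>x. f (x + t) - f x) | f t. f \<in> carrier bounded_functions}"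

definition H0_linf :: "('g::group_add \<Rightarrow> real) set monoid" where
  "H0_linf = bounded_functions Mod coinvariant_relations"

definition uf_chains :: "'g::group_add set \<Rightarrow> ('g \<times> 'g \<Rightarrow> int) set" where
  "uf_chains S = {f \<in> carrier bounded_functions. \<exists>R. \<forall>x y. word_dist S x y > R \<longrightarrow> f (x, y) = 0}"

definition uf_boundary :: "('g \<times> 'g \<Rightarrow> int) \<Rightarrow> 'g \<Rightarrow> int" where
  "uf_boundary f x = (\<Sum>y | f (y, x) \<noteq> 0. f (y, x)) - (\<Sum>y | f (x, y) \<noteq> 0. f (x, y))"

definition H0_uf :: "'g::group_add set \<Rightarrow> ('g \<Rightarrow> int) set monoid" where
  "H0_uf S = bounded_functions Mod (uf_boundary ` uf_chains S)"

text \<open>The map induced by the inclusion \<open>\<ell>\<^sup>\<infinity>(G, \<int>) \<subseteq> \<ell>\<^sup>\<infinity>(G, \<real>)\<close>.\<close>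

definition H0_uf_to_H0_linf :: "('g::group_add \<Rightarrow> int) set \<Rightarrow> ('g \<Rightarrow> real) set" where
  "H0_uf_to_H0_linf X =
     the_elem ((\<lambda>f. coinvariant_relations #>\<^bsub>bounded_functions\<^esub> (\<lambda>x. real_of_int (f x))) ` X)"

text \<open>
  The projection \<open>diag(1\<^bsub>f > 0\<^esub>, \<dots>, 1\<^bsub>f > n - 1\<^esub>)\<close> over \<open>\<ell>\<^sup>\<infinity>(G)\<close>, for \<open>f \<le> n\<close>: its rank
  at \<open>x\<close> is \<open>f(x)\<close> if \<open>f(x) \<ge> 0\<close>, and \<open>0\<close> otherwise. The identification of
  \<open>\<ell>\<^sup>\<infinity>(G, \<int>)\<close> with \<open>K\<^sub>0(\<ell>\<^sup>\<infinity>(G))\<close> is inverse to the pointwise rank.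
\<close>

definition rank_projection :: "('i \<Rightarrow> int) \<Rightarrow> 'i bop mat" where
  "rank_projection f = mat_diag (LEAST n. \<forall>x. f x \<le> int n)
     (\<lambda>k. mult_op (\<lambda>x. if int k < f x then 1 else 0))"

definition K0_linf_class :: "('i \<Rightarrow> int) \<Rightarrow> ('i bop mat set \<times> 'i bop mat set) set" where
  "K0_linf_class f = K0_class linf_algebra (rank_projection f) (rank_projection (\<lambda>x. - f x))"

definition comparison_map ::
    "'g::group_add set \<Rightarrow> ('g \<Rightarrow> int) set \<Rightarrow> ('g bop mat set \<times> 'g bop mat set) set" where
  "comparison_map S X =
     the_elem ((\<lambda>f. K0_map (uniform_Roe_algebra S) (\<lambda>T. T) (K0_linf_class f)) ` X)"

text \<open>
  The same map, with its target identified with the K-theory of the reduced crossed product.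
\<close>

definition comparison_map_crossed ::
    "'g::group_add set \<Rightarrow> ('g \<Rightarrow> int) set \<Rightarrow> (('g \<times> 'g) bop mat set \<times> ('g \<times> 'g) bop mat set) set"
  where
  "comparison_map_crossed S X = K0_map reduced_crossed_product amplify (comparison_map S X)"

text \<open>
  In addition, its source identified with \<open>H\<^sub>0(G; \<ell>\<^sup>\<infinity>(G, \<real>))\<close>. This is possible only for
  infinite \<open>G\<close>: if \<open>G\<close> is finite, then \<open>H0_uf S\<close> is \<open>\<int>\<close> and \<open>H0_linf\<close> is \<open>\<real>\<close>.
\<close>

definition canonical_map ::
    "'g::group_add set \<Rightarrow> ('g \<Rightarrow> real) set \<Rightarrow> (('g \<times> 'g) bop mat set \<times> ('g \<times> 'g) bop mat set) set"
  where
  "canonical_map S Y =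
     comparison_map_crossed S (inv_into (carrier (H0_uf S)) H0_uf_to_H0_linf Y)"

definition split_injective :: "('a, 'c) monoid_scheme \<Rightarrow> ('b, 'd) monoid_scheme \<Rightarrow> ('a \<Rightarrow> 'b) \<Rightarrow> bool" where
  "split_injective A B h \<longleftrightarrow>
     h \<in> hom A B \<and> (\<exists>r\<in>hom B A. \<forall>x\<in>carrier A. r (h x) = x)"

end

theory Submission
  imports Defs "Jordan_Normal_Form.Schur_Decomposition"
begin

text \<open>
  Let \<open>p\<close> and \<open>q\<close> be diagonal projections over \<open>\<ell>\<^sup>\<infinity>(G)\<close> with \<open>p = w v\<close> and \<open>q = v w\<close>, where \<open>v\<close> is a
  matrix over the uniform Roe algebra. If \<open>u\<close> has finite propagation \<open>R\<close> and is close to \<open>v\<close>, then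
  \<open>q u\<close> is injective on the range of \<open>p\<close> over any finite \<open>F \<subseteq> G\<close>, and maps it into the range of \<open>q\<close>
  over the \<open>R\<close>-neighbourhood of \<open>F\<close>; so the rank of \<open>p\<close> over \<open>F\<close> is at most the rank of \<open>q\<close> over that
  neighbourhood. By Hall's theorem for infinite families and the Schroeder-Bernstein argument, these
  inequalities and their mirror images give a bijection of bounded displacement between the basis
  vectors of \<open>p\<close> and those of \<open>q\<close>, so that the difference of the ranks is the boundary of an integral
  chain. A stabilising projection \<open>e\<close> is made diagonal by adding \<open>1 - e\<close>. Hence the comparison map is
  injective.

  If \<open>G\<close> is infinite, then \<open>H\<^sub>0\<^sup>u\<^sup>f(G; \<int>)\<close> is isomorphic to \<open>H\<^sub>0(G; \<ell>\<^sup>\<infinity>(G, \<real>))\<close>, because real functions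
  can be made integral by pushing fractional parts to infinity (a compactness argument). This group
  is divisible, so the injection splits. If \<open>G\<close> is finite, the trace gives a splitting.
\<close>

section \<open>Hall's theorem for infinite families\<close>

text \<open>An equality in \<open>K0\<close> only provides a partial isometry in a norm closure, so
  no displacement can be read off its entries. What survives norm approximation is a dimension
  count: a linear map that is injective on a finite-dimensional space stays injective under a small
  perturbation. The error allowed for \<open>u\<close> depends only on \<open>w\<close> and
  \<open>q\<close>, not on \<open>F\<close>, so one propagation radius serves all finite sets, which
  is the uniformity that Hall's condition asks for. Rank over a finite set makes sense here only for
  diagonal projections; hence the stabilising projection has to be absorbed.

  The splitting for infinite \<open>G\<close> is not given by a formula: it comes from Zorn's lemma.
  Divisibility is invisible on integral functions, hence the detour through real coefficients. The
  detour rests on a vanishing criterion (sums over finite sets are controlled by the boundary of the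
  set), whose proof reuses the matching argument. For finite \<open>G\<close> fractional parts have
  nowhere to go, but there \<open>H0_uf S\<close> is infinite cyclic and a trace recovers the
  coefficient of the generator.\<close>

text \<open>
  Rado's argument: shrink \<open>P\<close> to a minimal relation satisfying Hall's condition. By submodularity of the
  cardinality, no \<open>x\<close> is then related to two elements.
\<close>

theorem infinite_Hall:
  fixes P :: "('a \<times> 'b) set"
  assumes fin: "\<And>x. x \<in> E \<Longrightarrow> finite (P `` {x})"
    and hall: "\<And>A. finite A \<Longrightarrow> A \<subseteq> E \<Longrightarrow> card A \<le> card (P `` A)"
  shows "\<exists>f. inj_on f E \<and> (\<forall>x\<in>E. (x, f x) \<in> P)"
proof -
  define Hall where "Hall Q \<longleftrightarrow> (\<forall>A. finite A \<longrightarrow> A \<subseteq> E \<longrightarrow> card A \<le> card ((P - Q) `` A))" for Q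
  have finP: "finite (P `` A)" if "finite A" "A \<subseteq> E" for A
    using that fin by (subst Image_eq_UN) auto
  have "\<exists>M\<in>{Q. Hall Q}. \<forall>X\<in>{Q. Hall Q}. M \<subseteq> X \<longrightarrow> X = M"
  proof (rule subset_Zorn')
    fix C assume C: "subset.chain {Q. Hall Q} C"
    have "Hall (\<Union>C)"
      unfolding Hall_def
    proof (intro allI impI)
      fix A assume A: "finite A" "A \<subseteq> E"
      show "card A \<le> card ((P - \<Union>C) `` A)"
      proof (cases "C = {}")
        case True
        then show ?thesis using hall A by simp
      next
        case False
        \<comment> \<open>Hall's condition for \<open>A\<close> sees only the finitely many pairs of
          \<open>P\<close> over \<open>A\<close>, so a single member of the chain already contains
          all of these that the union removes.\<close>
        have "finite (Sigma A (\<lambda>x. P `` {x}) \<inter> \<Union>C)"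
          using A fin by (intro finite_Int disjI1 finite_SigmaI) auto
        then obtain Q where Q: "Q \<in> C" "Sigma A (\<lambda>x. P `` {x}) \<inter> \<Union>C \<subseteq> Q"
          using finite_subset_Union_chain[OF _ _ False C] by (metis inf_le2)
        then have "(P - \<Union>C) `` A = (P - Q) `` A" by auto
        moreover have "Hall Q" using C Q(1) by (auto simp: subset.chain_def)
        ultimately show ?thesis using A by (simp add: Hall_def)
      qed
    qed
    then show "\<Union>C \<in> {Q. Hall Q}" by simp
  qed
  then obtain M where M: "Hall M" and max: "\<And>X. Hall X \<Longrightarrow> M \<subseteq> X \<Longrightarrow> X = M" by blast
  define T where "T = P - M"
  have hallT: "card A \<le> card (T `` A)" if "finite A" "A \<subseteq> E" for A
    using M that by (simp add: Hall_def T_def)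
  have finT: "finite (T `` A)" if "finite A" "A \<subseteq> E" for A
    by (rule finite_subset[OF _ finP[OF that]]) (auto simp: T_def)
  have single: "y1 = y2" if x: "x \<in> E" and y: "(x, y1) \<in> T" "(x, y2) \<in> T" for x y1 y2
  proof (rule ccontr)
    assume ne: "y1 \<noteq> y2"
    \<comment> \<open>Minimality: deleting \<open>(x, z)\<close> as well breaks Hall's condition for
      some \<open>A\<close>, which must contain \<open>x\<close>. The set \<open>B\<close> is
      \<open>A\<close> without \<open>x\<close>, so the strict inequality turns into a weak
      one.\<close>
    have ex: "\<exists>B. finite B \<and> B \<subseteq> E \<and> x \<notin> B \<and> card (T `` B \<union> (T `` {x} - {z})) \<le> card B"
      if z: "(x, z) \<in> T" for z
    proof -
      have "\<not> Hall (insert (x, z) M)" using max[of "insert (x, z) M"] z by (auto simp: T_def)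
      then obtain A where A: "finite A" "A \<subseteq> E" "card ((P - insert (x, z) M) `` A) < card A"
        by (auto simp: Hall_def not_le)
      have xA: "x \<in> A"
      proof (rule ccontr)
        assume "x \<notin> A"
        then have "(P - insert (x, z) M) `` A = T `` A" by (auto simp: T_def)
        then show False using A hallT[of A] by simp
      qed
      have "(P - insert (x, z) M) `` A = T `` (A - {x}) \<union> (T `` {x} - {z})"
        using xA by (auto simp: T_def)
      with A xA show ?thesis
        by (intro exI[of _ "A - {x}"]) auto
    qed
    obtain B1 where B1: "finite B1" "B1 \<subseteq> E" "x \<notin> B1" "card (T `` B1 \<union> (T `` {x} - {y1})) \<le> card B1"
      using ex[OF y(1)] by blast
    obtain B2 where B2: "finite B2" "B2 \<subseteq> E" "x \<notin> B2" "card (T `` B2 \<union> (T `` {x} - {y2})) \<le> card B2"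
      using ex[OF y(2)] by blast
    define X1 where "X1 = T `` B1 \<union> (T `` {x} - {y1})"
    define X2 where "X2 = T `` B2 \<union> (T `` {x} - {y2})"
    have f: "finite X1" "finite X2"
      using finT[of B1] finT[of B2] finT[of "{x}"] B1 B2 x by (auto simp: X1_def X2_def)
    \<comment> \<open>Since \<open>y1\<close> and \<open>y2\<close> differ,
      \<open>X1 \<union> X2\<close> contains every neighbour of \<open>x\<close>. Hall's condition
      for \<open>B1 \<union> B2\<close> with \<open>x\<close> added and for
      \<open>B1 \<inter> B2\<close> then sums to
      \<open>card B1 + card B2 + 1 \<le> card X1 + card X2\<close>, against the choice of
      \<open>B1\<close> and \<open>B2\<close>.\<close>
    have "card (insert x (B1 \<union> B2)) \<le> card (T `` (insert x (B1 \<union> B2)))"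
      using B1 B2 x by (intro hallT) auto
    also have "\<dots> \<le> card (X1 \<union> X2)"
      using f ne by (intro card_mono) (auto simp: X1_def X2_def)
    finally have 1: "card (B1 \<union> B2) + 1 \<le> card (X1 \<union> X2)" using B1 B2 by simp
    have "card (B1 \<inter> B2) \<le> card (T `` (B1 \<inter> B2))"
      using B1 B2 by (intro hallT) auto
    also have "\<dots> \<le> card (X1 \<inter> X2)"
      using f by (intro card_mono) (auto simp: X1_def X2_def)
    finally have "card (B1 \<inter> B2) \<le> card (X1 \<inter> X2)" .
    with 1 have "card (B1 \<union> B2) + card (B1 \<inter> B2) + 1 \<le> card (X1 \<union> X2) + card (X1 \<inter> X2)" by simp
    then show False
      using card_Un_Int[OF f] card_Un_Int[OF B1(1) B2(1)] B1(4) B2(4) by (simp add: X1_def X2_def)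
  qed
  have "\<exists>y. (x, y) \<in> T" if "x \<in> E" for x
    using hallT[of "{x}"] that by (cases "T `` {x} = {}") auto
  then obtain f where f: "\<And>x. x \<in> E \<Longrightarrow> (x, f x) \<in> T" by metis
  have "inj_on f E"
  proof (rule inj_onI, rule ccontr)
    fix x x' assume x: "x \<in> E" "x' \<in> E" "f x = f x'" "x \<noteq> x'"
    have "T `` {x, x'} \<subseteq> {f x}" using single f x by auto
    then have "card (T `` {x, x'}) \<le> card {f x}" by (rule card_mono[rotated]) simp
    moreover have "card {x, x'} \<le> card (T `` {x, x'})" using x by (intro hallT) auto
    ultimately show False using x by simp
  qed
  then show ?thesis using f by (auto simp: T_def)
qed

text \<open>The Schroeder-Bernstein bijection takes at each point either the value of
  \<open>f\<close> or the preimage under \<open>g\<close>, so it stays inside any relation that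
  contains both graphs.\<close>

lemma Schroeder_Bernstein_relation:
  assumes f: "inj_on f A" "f ` A \<subseteq> B" "\<And>x. x \<in> A \<Longrightarrow> (x, f x) \<in> P"
    and g: "inj_on g B" "g ` B \<subseteq> A" "\<And>y. y \<in> B \<Longrightarrow> (g y, y) \<in> P"
  shows "\<exists>h. bij_betw h A B \<and> (\<forall>x\<in>A. (x, h x) \<in> P)"
proof -
  \<comment> \<open>The fixed point equation says that \<open>g\<close> maps the part of
    \<open>B\<close> missed by \<open>f\<close> on \<open>X\<close> exactly onto
    \<open>A - X\<close>, where the bijection will invert \<open>g\<close>.\<close>
  define X where "X = lfp (\<lambda>X. A - (g ` (B - (f ` X))))"
  have "mono (\<lambda>X. A - (g ` (B - (f ` X))))" by (intro monoI) blast
  then have X: "X = A - (g ` (B - (f ` X)))"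
    unfolding X_def by (rule lfp_unfold)
  then have AX: "A - X = g ` (B - f ` X)" and XA: "X \<subseteq> A" using g(2) by blast+
  define k where "k = the_inv_into (B - f ` X) g"
  have ginj: "inj_on g (B - f ` X)" using g(1) by (auto intro: inj_on_subset)
  have "bij_betw g (B - f ` X) (A - X)"
    using ginj AX by (simp add: bij_betw_def)
  then have k: "bij_betw k (A - X) (B - f ` X)"
    unfolding k_def by (rule bij_betw_the_inv_into)
  have gk: "g (k x) = x" if "x \<in> A - X" for x
    unfolding k_def using that AX by (intro f_the_inv_into_f[OF ginj]) auto
  have fX: "bij_betw f X (f ` X)" using f(1) XA by (auto simp: bij_betw_def intro: inj_on_subset)
  have "bij_betw (\<lambda>x. if x \<in> X then f x else k x) (X \<union> (A - X)) (f ` X \<union> (B - f ` X))"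
    by (rule bij_betw_disjoint_Un[OF fX k]) auto
  moreover have "X \<union> (A - X) = A" "f ` X \<union> (B - f ` X) = B" using XA f(2) by auto
  moreover have "(x, if x \<in> X then f x else k x) \<in> P" if "x \<in> A" for x
  proof (cases "x \<in> X")
    case True then show ?thesis using f(3) that by simp
  next
    case False
    then have "k x \<in> B" using k that by (auto simp: bij_betw_def)
    then show ?thesis using g(3)[of "k x"] gk[of x] that False by simp
  qed
  ultimately show ?thesis by (intro exI[of _ "\<lambda>x. if x \<in> X then f x else k x"]) simp
qed

lemma Hall_bijection:
  fixes P :: "('a \<times> 'b) set"
  assumes sub: "P \<subseteq> E \<times> E'"
    and fin: "\<And>x. x \<in> E \<Longrightarrow> finite (P `` {x})" "\<And>y. y \<in> E' \<Longrightarrow> finite (P\<inverse> `` {y})"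
    and hall: "\<And>A. finite A \<Longrightarrow> A \<subseteq> E \<Longrightarrow> card A \<le> card (P `` A)"
      "\<And>A. finite A \<Longrightarrow> A \<subseteq> E' \<Longrightarrow> card A \<le> card (P\<inverse> `` A)"
  shows "\<exists>h. bij_betw h E E' \<and> (\<forall>x\<in>E. (x, h x) \<in> P)"
proof -
  obtain f where f: "inj_on f E" "\<And>x. x \<in> E \<Longrightarrow> (x, f x) \<in> P"
    using infinite_Hall[of E P] fin(1) hall(1) by blast
  obtain g where g: "inj_on g E'" "\<And>x. x \<in> E' \<Longrightarrow> (x, g x) \<in> P\<inverse>"
    using infinite_Hall[of E' "P\<inverse>"] fin(2) hall(2) by blast
  show ?thesis
    by (rule Schroeder_Bernstein_relation[OF f(1) _ f(2) g(1)]) (use f g sub in auto)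
qed

section \<open>Bounded displacement and boundaries\<close>

locale finitely_generated_group =
  fixes S :: "'g::group_add set"
  assumes finite_generators: "finite S"
    and generates: "generates_group S"
begin

lemma word_length_le: "is_word S ts \<Longrightarrow> word_length S (sum_list ts) \<le> length ts"
  unfolding word_length_def by (rule Least_le, rule exI[of _ ts], simp)

lemma obtain_word:
  obtains ts where "is_word S ts" "sum_list ts = x" "length ts = word_length S x"
proof -
  have "\<exists>n ts. is_word S ts \<and> sum_list ts = x \<and> length ts = n"
    using generates unfolding generates_group_def by blast
  from LeastI_ex[OF this] that show thesis unfolding word_length_def by blast
qed

lemma word_length_0: "word_length S 0 = 0"
  using word_length_le[of "[]"] by (simp add: is_word_def)

lemma word_length_plus: "word_length S (x + y) \<le> word_length S x + word_length S y"
proof -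
  obtain ts where ts: "is_word S ts" "sum_list ts = x" "length ts = word_length S x" by (rule obtain_word)
  obtain us where us: "is_word S us" "sum_list us = y" "length us = word_length S y" by (rule obtain_word)
  have "word_length S (sum_list (ts @ us)) \<le> length (ts @ us)"
    using ts us by (intro word_length_le) (auto simp: is_word_def)
  with ts us show ?thesis by simp
qed

lemma word_length_uminus: "word_length S (- x) = word_length S x"
proof -
  have le: "word_length S (- x) \<le> word_length S x" for x
  proof -
    obtain ts where ts: "is_word S ts" "sum_list ts = x" "length ts = word_length S x" by (rule obtain_word)
    have "sum_list (rev (map uminus ts)) = - sum_list ts"
      by (induction ts) (auto simp: minus_add simp del: add_uminus_conv_diff)
    moreover have "is_word S (rev (map uminus ts))"
      using ts(1) by (auto simp: is_word_def)
    ultimately show ?thesis using word_length_le[of "rev (map uminus ts)"] ts by simp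
  qed
  from le[of x] le[of "- x"] show ?thesis by simp
qed

lemma word_dist_self: "word_dist S x x = 0"
  by (simp add: word_dist_def word_length_0)

lemma word_dist_commute: "word_dist S x y = word_dist S y x"
  using word_length_uminus[of "- x + y"] by (simp add: word_dist_def minus_add)

lemma word_dist_triangle: "word_dist S x z \<le> word_dist S x y + word_dist S y z"
  using word_length_plus[of "- x + y" "- y + z"] by (simp add: word_dist_def add.assoc)

lemma finite_word_length: "finite {x. word_length S x \<le> R}"
proof (rule finite_subset)
  show "{x. word_length S x \<le> R} \<subseteq> sum_list ` {ts. set ts \<subseteq> S \<union> uminus ` S \<and> length ts \<le> R}"
  proof
    fix x assume x: "x \<in> {x. word_length S x \<le> R}"
    obtain ts where "is_word S ts" "sum_list ts = x" "length ts = word_length S x" by (rule obtain_word)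
    with x show "x \<in> sum_list ` {ts. set ts \<subseteq> S \<union> uminus ` S \<and> length ts \<le> R}"
      by (intro image_eqI[of _ _ ts]) (auto simp: is_word_def)
  qed
  show "finite (sum_list ` {ts. set ts \<subseteq> S \<union> uminus ` S \<and> length ts \<le> R})"
    using finite_generators by (intro finite_imageI finite_lists_length_le) auto
qed

definition nbhd :: "nat \<Rightarrow> 'g set \<Rightarrow> 'g set" where
  "nbhd R F = {y. \<exists>x\<in>F. word_dist S x y \<le> R}"

lemma finite_nbhd: "finite F \<Longrightarrow> finite (nbhd R F)"
proof -
  assume F: "finite F"
  have "finite {y. word_dist S x y \<le> R}" for x
  proof (rule finite_subset)
    show "{y. word_dist S x y \<le> R} \<subseteq> (\<lambda>t. x + t) ` {t. word_length S t \<le> R}"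
    proof
      fix y assume "y \<in> {y. word_dist S x y \<le> R}"
      then show "y \<in> (\<lambda>t. x + t) ` {t. word_length S t \<le> R}"
        by (intro image_eqI[of _ _ "- x + y"]) (auto simp: word_dist_def add.assoc[symmetric])
    qed
  qed (intro finite_imageI finite_word_length)
  moreover have "nbhd R F = (\<Union>x\<in>F. {y. word_dist S x y \<le> R})" by (auto simp: nbhd_def)
  ultimately show ?thesis using F by simp
qed

lemma subset_nbhd: "F \<subseteq> nbhd R F"
  by (force simp: nbhd_def word_dist_self)

lemma nbhd_mono: "R \<le> R' \<Longrightarrow> nbhd R F \<subseteq> nbhd R' F"
  by (force simp: nbhd_def)

lemma uf_chain_bounds:
  assumes "f \<in> uf_chains S"
  shows "\<exists>R C. (\<forall>x y. f (x, y) \<noteq> 0 \<longrightarrow> word_dist S x y \<le> R) \<and> (\<forall>p. \<bar>f p\<bar> \<le> C)"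
proof -
  obtain R where "\<And>x y. word_dist S x y > R \<Longrightarrow> f (x, y) = 0"
    using assms by (auto simp: uf_chains_def)
  moreover obtain C where "\<And>p. \<bar>f p\<bar> \<le> C"
    using assms by (auto simp: uf_chains_def bounded_functions_def)
  ultimately show ?thesis by (meson leI)
qed

lemma uf_boundary_eq:
  assumes "\<And>x y. f (x, y) \<noteq> 0 \<Longrightarrow> word_dist S x y \<le> R"
  shows "uf_boundary f x = (\<Sum>y\<in>nbhd R {x}. f (y, x)) - (\<Sum>y\<in>nbhd R {x}. f (x, y))"
proof -
  have "(\<Sum>y | f (y, x) \<noteq> 0. f (y, x)) = (\<Sum>y\<in>nbhd R {x}. f (y, x))"
    using assms by (intro sum.mono_neutral_left finite_nbhd) (auto simp: nbhd_def word_dist_commute[of x])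
  moreover have "(\<Sum>y | f (x, y) \<noteq> 0. f (x, y)) = (\<Sum>y\<in>nbhd R {x}. f (x, y))"
    using assms by (intro sum.mono_neutral_left finite_nbhd) (auto simp: nbhd_def)
  ultimately show ?thesis by (simp add: uf_boundary_def)
qed

text \<open>Put \<open>h x\<close> points over each \<open>x\<close>, and likewise for
  \<open>h'\<close>. The inequalities are Hall's condition, in both directions, for the relation of
  lying at distance at most \<open>R\<close>. The resulting bijection has bounded displacement, and
  counting the points that it carries along each edge gives a chain, bounded because
  \<open>h\<close> is.\<close>

lemma uf_boundaryI:
  fixes h h' :: "'g \<Rightarrow> nat"
  assumes bounded: "\<And>x. h x \<le> C" "\<And>x. h' x \<le> C"
    and h: "\<And>F. finite F \<Longrightarrow> sum h F \<le> sum h' (nbhd R F)"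
    and h': "\<And>F. finite F \<Longrightarrow> sum h' F \<le> sum h (nbhd R F)"
  shows "(\<lambda>x. int (h x) - int (h' x)) \<in> uf_boundary ` uf_chains S"
proof -
  define E where "E h = (SIGMA x:UNIV. {..<h x})" for h :: "'g \<Rightarrow> nat"
  define P where "P h h' = {(e, e'). e \<in> E h \<and> e' \<in> E h' \<and> word_dist S (fst e) (fst e') \<le> R}" for h h'
  have conv: "(P h h')\<inverse> = P h' h" for h h'
    by (auto simp: P_def word_dist_commute)
  have P_Image: "P h h' `` A = Sigma (nbhd R (fst ` A)) (\<lambda>x. {..<h' x})" if "A \<subseteq> E h" for A h h'
    using that by (force simp: P_def E_def nbhd_def)
  have finP: "finite (P h h' `` {e})" if "e \<in> E h" for e h h'
    using that by (subst P_Image) (auto intro!: finite_nbhd)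
  have hallP: "card A \<le> card (P h h' `` A)"
    if le: "\<And>F. finite F \<Longrightarrow> sum h F \<le> sum h' (nbhd R F)" and A: "finite A" "A \<subseteq> E h" for h h' A
  proof -
    \<comment> \<open>Enlarging \<open>A\<close> to all points over its base points does not change
      its image, so only such full sets have to be tested.\<close>
    have "card A \<le> card (Sigma (fst ` A) (\<lambda>x. {..<h x}))"
      using A by (intro card_mono) (force simp: E_def)+
    also have "\<dots> = sum h (fst ` A)" using A by simp
    also have "\<dots> \<le> sum h' (nbhd R (fst ` A))" using A by (intro le) auto
    also have "\<dots> = card (P h h' `` A)" using A by (simp add: P_Image finite_nbhd)
    finally show ?thesis .
  qed
  have "\<exists>\<theta>. bij_betw \<theta> (E h) (E h') \<and> (\<forall>x\<in>E h. (x, \<theta> x) \<in> P h h')"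
  proof (rule Hall_bijection)
    show "P h h' \<subseteq> E h \<times> E h'" by (auto simp: P_def)
    show "finite (P h h' `` {e})" if "e \<in> E h" for e using that by (rule finP)
    show "finite ((P h h')\<inverse> `` {e})" if "e \<in> E h'" for e using that unfolding conv by (rule finP)
    show "card A \<le> card (P h h' `` A)" if "finite A" "A \<subseteq> E h" for A using h that by (rule hallP)
    show "card A \<le> card ((P h h')\<inverse> `` A)" if "finite A" "A \<subseteq> E h'" for A
      using h' that unfolding conv by (rule hallP)
  qed
  then obtain \<theta> where \<theta>: "bij_betw \<theta> (E h) (E h')"
    and dist: "\<And>x k. k < h x \<Longrightarrow> word_dist S x (fst (\<theta> (x, k))) \<le> R"
    by (force simp: P_def E_def)
  \<comment> \<open>The first argument is the target and the second the source. With this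
    orientation the incoming sum at \<open>x\<close> counts the points that start at
    \<open>x\<close>, and the boundary is \<open>h - h'\<close> rather than its negative.\<close>
  define c where "c = (\<lambda>(y, x). int (card {k. k < h x \<and> fst (\<theta> (x, k)) = y}))"
  have supp: "word_dist S y x \<le> R" if "c (y, x) \<noteq> 0" for y x
  proof -
    from that have "{k. k < h x \<and> fst (\<theta> (x, k)) = y} \<noteq> {}" by (auto simp: c_def)
    then show ?thesis using dist by (auto simp: word_dist_commute)
  qed
  have "\<bar>c p\<bar> \<le> int C" for p
  proof (cases p)
    case (Pair y x)
    have "card {k. k < h x \<and> fst (\<theta> (x, k)) = y} \<le> card {..<h x}" by (intro card_mono) auto
    then show ?thesis using bounded(1)[of x] Pair by (simp add: c_def)
  qed
  then have "c \<in> uf_chains S"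
    unfolding uf_chains_def bounded_functions_def using supp
    by (auto simp: not_le[symmetric] intro!: exI[of _ R])
  moreover have "uf_boundary c = (\<lambda>x. int (h x) - int (h' x))"
  proof
    fix x
    have fin: "finite (nbhd R {x})" by (simp add: finite_nbhd)
    have "h x = card (\<Union>y\<in>nbhd R {x}. {k. k < h x \<and> fst (\<theta> (x, k)) = y})"
    proof -
      have "(\<Union>y\<in>nbhd R {x}. {k. k < h x \<and> fst (\<theta> (x, k)) = y}) = {..<h x}"
        using dist by (auto simp: nbhd_def)
      then show ?thesis by simp
    qed
    also have "\<dots> = (\<Sum>y\<in>nbhd R {x}. card {k. k < h x \<and> fst (\<theta> (x, k)) = y})"
      using fin by (intro card_UN_disjoint) auto
    finally have "(\<Sum>y\<in>nbhd R {x}. c (y, x)) = int (h x)"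
      by (simp add: c_def flip: of_nat_sum)
    then have *: "uf_boundary c x = int (h x) - int (h' x)" if "(\<Sum>y\<in>nbhd R {x}. c (x, y)) = int (h' x)"
      using uf_boundary_eq[where f = c and x = x, OF supp] that by simp
    \<comment> \<open>Injectivity of \<theta> allows the points that arrive at \<open>x\<close> to
      be counted by their images; surjectivity makes these all of the \<open>h' x\<close> points
      over \<open>x\<close>.\<close>
    have "(\<Sum>y\<in>nbhd R {x}. card {k. k < h y \<and> fst (\<theta> (y, k)) = x})
        = card (SIGMA y:nbhd R {x}. {k. k < h y \<and> fst (\<theta> (y, k)) = x})"
      using fin by (intro card_SigmaI[symmetric]) auto
    also have "\<dots> = card (\<theta> ` (SIGMA y:nbhd R {x}. {k. k < h y \<and> fst (\<theta> (y, k)) = x}))"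
      using \<theta> by (subst card_image[OF inj_on_subset[of \<theta> "E h"]]) (auto simp: bij_betw_def E_def)
    also have "\<theta> ` (SIGMA y:nbhd R {x}. {k. k < h y \<and> fst (\<theta> (y, k)) = x}) = {x} \<times> {..<h' x}"
    proof (intro equalityI subsetI)
      fix e assume "e \<in> \<theta> ` (SIGMA y:nbhd R {x}. {k. k < h y \<and> fst (\<theta> (y, k)) = x})"
      moreover have "\<theta> (y, k) \<in> E h'" if "k < h y" for y k
        using \<theta> that by (auto simp: bij_betw_def E_def)
      ultimately show "e \<in> {x} \<times> {..<h' x}" by (force simp: E_def)
    next
      fix e assume e: "e \<in> {x} \<times> {..<h' x}"
      then have "e \<in> \<theta> ` E h" using \<theta> by (auto simp: bij_betw_def E_def)
      then obtain y k where y: "k < h y" "e = \<theta> (y, k)" by (auto simp: E_def)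
      then show "e \<in> \<theta> ` (SIGMA y:nbhd R {x}. {k. k < h y \<and> fst (\<theta> (y, k)) = x})"
        using e dist[of k y] by (intro image_eqI[of _ _ "(y, k)"]) (auto simp: nbhd_def word_dist_commute)
    qed
    finally have "(\<Sum>y\<in>nbhd R {x}. card {k. k < h y \<and> fst (\<theta> (y, k)) = x}) = h' x"
      by simp
    then show "uf_boundary c x = int (h x) - int (h' x)"
      by (intro *) (simp add: c_def flip: of_nat_sum)
  qed
  ultimately show ?thesis by (metis image_eqI)
qed

end

section \<open>Homology groups\<close>

lemma carrier_bounded_functions: "f \<in> carrier bounded_functions \<longleftrightarrow> (\<exists>C. \<forall>x. \<bar>f x\<bar> \<le> C)"
  and mult_bounded_functions: "f \<otimes>\<^bsub>bounded_functions\<^esub> g = (\<lambda>x. f x + g x)"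
  and one_bounded_functions: "\<one>\<^bsub>bounded_functions\<^esub> = (\<lambda>_. 0)"
  by (simp_all add: bounded_functions_def)

lemma bounded_functions_plus:
  assumes "f \<in> carrier bounded_functions" "g \<in> carrier bounded_functions"
  shows "(\<lambda>x. f x + g x) \<in> carrier bounded_functions"
proof -
  obtain C D where "\<And>x. \<bar>f x\<bar> \<le> C" "\<And>x. \<bar>g x\<bar> \<le> D"
    using assms by (auto simp: carrier_bounded_functions)
  then show ?thesis
    by (auto simp: carrier_bounded_functions intro!: exI[of _ "C + D"] order_trans[OF abs_triangle_ineq] add_mono)
qed

lemma bounded_functions_uminus:
  assumes "f \<in> carrier bounded_functions"
  shows "(\<lambda>x. - f x) \<in> carrier bounded_functions"
  using assms by (simp add: carrier_bounded_functions)

lemma bounded_functions_minus: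
  assumes "f \<in> carrier bounded_functions" "g \<in> carrier bounded_functions"
  shows "(\<lambda>x. f x - g x) \<in> carrier bounded_functions"
  using bounded_functions_plus[OF assms(1) bounded_functions_uminus[OF assms(2)]] by simp

lemma comm_group_bounded_functions:
  "comm_group (bounded_functions :: ('i \<Rightarrow> 'a::linordered_idom) monoid)"
proof (rule comm_groupI)
  fix f :: "'i \<Rightarrow> 'a" assume f: "f \<in> carrier bounded_functions"
  show "\<exists>g\<in>carrier bounded_functions. g \<otimes>\<^bsub>bounded_functions\<^esub> f = \<one>\<^bsub>bounded_functions\<^esub>"
    by (rule bexI[OF _ bounded_functions_uminus[OF f]]) (simp add: mult_bounded_functions one_bounded_functions)
next
  show "\<one>\<^bsub>bounded_functions\<^esub> \<in> carrier (bounded_functions :: ('i \<Rightarrow> 'a) monoid)"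
    by (auto simp: carrier_bounded_functions one_bounded_functions)
qed (auto simp: mult_bounded_functions one_bounded_functions add.assoc add.commute intro: bounded_functions_plus)

interpretation bf: comm_group "bounded_functions :: ('i \<Rightarrow> 'a::linordered_idom) monoid"
  by (rule comm_group_bounded_functions)

lemma inv_bounded_functions:
  "f \<in> carrier bounded_functions \<Longrightarrow> inv\<^bsub>bounded_functions\<^esub> f = (\<lambda>x. - f x)"
  by (rule bf.inv_equality)
    (auto simp: mult_bounded_functions one_bounded_functions bounded_functions_uminus)

lemma rcos_bounded_functions_eq_iff:
  assumes "subgroup H bounded_functions" "f \<in> carrier bounded_functions" "g \<in> carrier bounded_functions"
  shows "H #>\<^bsub>bounded_functions\<^esub> f = H #>\<^bsub>bounded_functions\<^esub> g \<longleftrightarrow> (\<lambda>x. f x - g x) \<in> H"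
proof
  assume "H #>\<^bsub>bounded_functions\<^esub> f = H #>\<^bsub>bounded_functions\<^esub> g"
  then have "f \<in> H #>\<^bsub>bounded_functions\<^esub> g"
    using bf.rcos_self[OF assms(2,1)] by simp
  then obtain h where "h \<in> H" "f = (\<lambda>x. h x + g x)" by (auto simp: r_coset_def mult_bounded_functions)
  then show "(\<lambda>x. f x - g x) \<in> H" by simp
next
  assume *: "(\<lambda>x. f x - g x) \<in> H"
  have "f \<in> H #>\<^bsub>bounded_functions\<^esub> g"
    by (auto simp: r_coset_def mult_bounded_functions intro!: bexI[OF _ *])
  then show "H #>\<^bsub>bounded_functions\<^esub> f = H #>\<^bsub>bounded_functions\<^esub> g"
    using bf.repr_independence assms by metis
qed

lemma mem_rcos_bounded_functions:
  "f' \<in> H #>\<^bsub>bounded_functions\<^esub> f \<longleftrightarrow> (\<lambda>x. f' x - f x) \<in> H"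
proof
  show "(\<lambda>x. f' x - f x) \<in> H \<Longrightarrow> f' \<in> H #>\<^bsub>bounded_functions\<^esub> f"
    by (auto simp: r_coset_def mult_bounded_functions intro!: bexI[of _ "\<lambda>x. f' x - f x"])
qed (auto simp: r_coset_def mult_bounded_functions)

lemma comm_group_Mod:
  assumes "comm_group G" "subgroup H G"
  shows "comm_group (G Mod H)"
  using assms by (rule comm_group.abelian_FactGroup)

lemma FactGroup_comm_group_cases:
  assumes "X \<in> carrier (G Mod H)"
  obtains f where "f \<in> carrier G" "X = H #>\<^bsub>G\<^esub> f"
  using assms by (auto simp: FactGroup_def RCOSETS_def)

lemma rcos_carrier_FactGroup: "f \<in> carrier G \<Longrightarrow> H #>\<^bsub>G\<^esub> f \<in> carrier (G Mod H)"
  by (auto simp: FactGroup_def RCOSETS_def)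

lemma mult_FactGroup_bounded_functions:
  assumes "subgroup H bounded_functions" "f \<in> carrier bounded_functions" "g \<in> carrier bounded_functions"
  shows "(H #>\<^bsub>bounded_functions\<^esub> f) \<otimes>\<^bsub>bounded_functions Mod H\<^esub> (H #>\<^bsub>bounded_functions\<^esub> g)
    = H #>\<^bsub>bounded_functions\<^esub> (\<lambda>x. f x + g x)"
  using normal.rcos_sum[OF bf.subgroup_imp_normal[OF assms(1)] assms(2,3)]
  by (simp add: FactGroup_def mult_bounded_functions)

lemma subgroup_coinvariant_relations: "subgroup coinvariant_relations bounded_functions"
  unfolding coinvariant_relations_def
proof (rule bf.generate_is_subgroup, safe)
  fix f :: "'a \<Rightarrow> real" and t
  assume "f \<in> carrier bounded_functions"
  moreover from this have "(\<lambda>x. f (x + t)) \<in> carrier bounded_functions"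
    by (auto simp: carrier_bounded_functions)
  ultimately show "(\<lambda>x. f (x + t) - f x) \<in> carrier bounded_functions"
    by (rule bounded_functions_minus[rotated])
qed

lemma coinvariant_relations_translation:
  "f \<in> carrier bounded_functions \<Longrightarrow> (\<lambda>x. f (x + t) - f x) \<in> coinvariant_relations"
  unfolding coinvariant_relations_def by (rule generate.incl) blast

lemma coinvariant_relations_plus:
  "f \<in> coinvariant_relations \<Longrightarrow> g \<in> coinvariant_relations \<Longrightarrow> (\<lambda>x. f x + g x) \<in> coinvariant_relations"
  using subgroup.m_closed[OF subgroup_coinvariant_relations, of f g] by (simp add: mult_bounded_functions)

lemma coinvariant_relations_sum:
  assumes "finite B" "\<And>t. t \<in> B \<Longrightarrow> f t \<in> coinvariant_relations"
  shows "(\<lambda>x. \<Sum>t\<in>B. f t x) \<in> coinvariant_relations"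
  using assms
proof (induction B)
  case empty
  then show ?case
    using subgroup.one_closed[OF subgroup_coinvariant_relations] by (simp add: one_bounded_functions)
qed (simp add: coinvariant_relations_plus)

section \<open>Boundaries, coinvariants and Whyte's vanishing criterion\<close>

context finitely_generated_group begin

lemma sum_nbhd_singleton:
  fixes f :: "'g \<Rightarrow> 'a::ab_group_add"
  shows "(\<Sum>y\<in>nbhd R {x}. f y) = (\<Sum>t | word_length S t \<le> R. f (x + t))"
    and "(\<Sum>y\<in>nbhd R {x}. f y) = (\<Sum>t | word_length S t \<le> R. f (x - t))"
proof -
  show 1: "(\<Sum>y\<in>nbhd R {x}. f y) = (\<Sum>t | word_length S t \<le> R. f (x + t))"
    by (rule sum.reindex_bij_witness[of _ "\<lambda>t. x + t" "\<lambda>y. - x + y"])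
       (auto simp: nbhd_def word_dist_def add.assoc[symmetric])
  have "(\<Sum>t | word_length S t \<le> R. f (x + t)) = (\<Sum>t | word_length S t \<le> R. f (x - t))"
    by (rule sum.reindex_bij_witness[of _ uminus uminus]) (auto simp: word_length_uminus)
  with 1 show "(\<Sum>y\<in>nbhd R {x}. f y) = (\<Sum>t | word_length S t \<le> R. f (x - t))" by simp
qed

text \<open>Edges are grouped by the group element \<open>t\<close> that labels them. Balls are
  finite, so this makes the boundary a finite sum of differences between a function and its
  translate.\<close>

lemma uf_boundary_eq':
  assumes "\<And>x y. f (x, y) \<noteq> 0 \<Longrightarrow> word_dist S x y \<le> R"
  shows "uf_boundary f x = (\<Sum>t | word_length S t \<le> R. f (x - t, x) - f (x, x + t))"
  using uf_boundary_eq[OF assms, of f x]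
  by (simp add: sum_nbhd_singleton(1)[of "\<lambda>y. f (x, y)"] sum_nbhd_singleton(2)[of "\<lambda>y. f (y, x)"] sum_subtractf)

lemma uf_chains_plus:
  assumes "f \<in> uf_chains S" "g \<in> uf_chains S"
  shows "(\<lambda>p. f p + g p) \<in> uf_chains S"
    and "uf_boundary (\<lambda>p. f p + g p) = (\<lambda>x. uf_boundary f x + uf_boundary g x)"
proof -
  obtain R C where f: "\<And>x y. f (x, y) \<noteq> 0 \<Longrightarrow> word_dist S x y \<le> R" "\<And>p. \<bar>f p\<bar> \<le> C"
    using uf_chain_bounds[OF assms(1)] by blast
  obtain R' C' where g: "\<And>x y. g (x, y) \<noteq> 0 \<Longrightarrow> word_dist S x y \<le> R'" "\<And>p. \<bar>g p\<bar> \<le> C'"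
    using uf_chain_bounds[OF assms(2)] by blast
  define M where "M = max R R'"
  have M: "word_dist S x y \<le> M" if "f (x, y) \<noteq> 0 \<or> g (x, y) \<noteq> 0" for x y
    using that f(1)[of x y] g(1)[of x y] by (auto simp: M_def)
  have M': "f (x, y) = 0 \<and> g (x, y) = 0" if "word_dist S x y > M" for x y
    using that M[of x y] by auto
  have fg: "f \<in> carrier bounded_functions" "g \<in> carrier bounded_functions"
    using assms by (auto simp: uf_chains_def)
  show "(\<lambda>p. f p + g p) \<in> uf_chains S"
    unfolding uf_chains_def using bounded_functions_plus[OF fg] M' by (auto intro!: exI[of _ M])
  show "uf_boundary (\<lambda>p. f p + g p) = (\<lambda>x. uf_boundary f x + uf_boundary g x)"
  proof
    fix x
    have "uf_boundary (\<lambda>p. f p + g p) x =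
      (\<Sum>t | word_length S t \<le> M. (f (x - t, x) + g (x - t, x)) - (f (x, x + t) + g (x, x + t)))"
      by (rule uf_boundary_eq') (use M in force)
    moreover have "uf_boundary f x = (\<Sum>t | word_length S t \<le> M. f (x - t, x) - f (x, x + t))"
      by (rule uf_boundary_eq') (use M in force)
    moreover have "uf_boundary g x = (\<Sum>t | word_length S t \<le> M. g (x - t, x) - g (x, x + t))"
      by (rule uf_boundary_eq') (use M in force)
    ultimately show "uf_boundary (\<lambda>p. f p + g p) x = uf_boundary f x + uf_boundary g x"
      by (simp add: sum.distrib[symmetric] algebra_simps)
  qed
qed

lemma uf_chains_uminus:
  assumes "f \<in> uf_chains S"
  shows "(\<lambda>p. - f p) \<in> uf_chains S" and "uf_boundary (\<lambda>p. - f p) = (\<lambda>x. - uf_boundary f x)"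
  using assms by (auto simp: uf_chains_def bounded_functions_uminus uf_boundary_def sum_negf)

lemma uf_boundary_bounded:
  assumes "f \<in> uf_chains S"
  shows "uf_boundary f \<in> carrier bounded_functions"
proof -
  obtain R C where f: "\<And>x y. f (x, y) \<noteq> 0 \<Longrightarrow> word_dist S x y \<le> R" "\<And>p. \<bar>f p\<bar> \<le> C"
    using uf_chain_bounds[OF assms] by blast
  have "\<bar>uf_boundary f x\<bar> \<le> (\<Sum>t | word_length S t \<le> R. C + C)" for x
  proof -
    have "\<bar>uf_boundary f x\<bar> \<le> (\<Sum>t | word_length S t \<le> R. \<bar>f (x - t, x) - f (x, x + t)\<bar>)"
      using uf_boundary_eq'[where f = f and x = x, OF f(1)] by (simp add: sum_abs)
    also have "\<dots> \<le> (\<Sum>t | word_length S t \<le> R. C + C)"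
      by (intro sum_mono order_trans[OF abs_triangle_ineq4] add_mono f(2))
    finally show ?thesis .
  qed
  then show ?thesis by (auto simp: carrier_bounded_functions)
qed

lemma subgroup_uf_boundaries: "subgroup (uf_boundary ` uf_chains S) bounded_functions"
proof (rule bf.subgroupI)
  show "uf_boundary ` uf_chains S \<subseteq> carrier bounded_functions" using uf_boundary_bounded by blast
  have "(\<lambda>_. 0) \<in> uf_chains S" by (auto simp: uf_chains_def carrier_bounded_functions)
  then show "uf_boundary ` uf_chains S \<noteq> {}" by blast
next
  fix a assume "a \<in> uf_boundary ` uf_chains S"
  then obtain f where "f \<in> uf_chains S" "a = uf_boundary f" by blast
  then show "inv\<^bsub>bounded_functions\<^esub> a \<in> uf_boundary ` uf_chains S"
    using uf_chains_uminus[of f] uf_boundary_bounded by (auto simp: inv_bounded_functions intro: rev_image_eqI)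
next
  fix a b assume "a \<in> uf_boundary ` uf_chains S" "b \<in> uf_boundary ` uf_chains S"
  then obtain f g where "f \<in> uf_chains S" "a = uf_boundary f" "g \<in> uf_chains S" "b = uf_boundary g" by blast
  then show "a \<otimes>\<^bsub>bounded_functions\<^esub> b \<in> uf_boundary ` uf_chains S"
    using uf_chains_plus[of f g] by (auto simp: mult_bounded_functions intro: rev_image_eqI)
qed

lemma comm_group_H0_uf: "comm_group (H0_uf S)"
  unfolding H0_uf_def by (rule comm_group_Mod[OF comm_group_bounded_functions subgroup_uf_boundaries])

text \<open>The edges labelled \<open>t\<close> form a flow along right translation by
  \<open>t\<close>, whose boundary is a translate minus the function itself. The sign in
  \<open>g\<close> accounts for the orientation of the boundary map.\<close>

lemma uf_boundary_coinvariant: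
  assumes "c \<in> uf_chains S"
  shows "(\<lambda>x. real_of_int (uf_boundary c x)) \<in> coinvariant_relations"
proof -
  obtain R C where c: "\<And>x y. c (x, y) \<noteq> 0 \<Longrightarrow> word_dist S x y \<le> R" "\<And>p. \<bar>c p\<bar> \<le> C"
    using uf_chain_bounds[OF assms] by blast
  define g where "g t x = - real_of_int (c (x - t, x))" for t x
  have "g t \<in> carrier bounded_functions" for t
    unfolding g_def carrier_bounded_functions
  proof (intro exI allI)
    show "\<bar>- real_of_int (c (x - t, x))\<bar> \<le> real_of_int C" for x
      using c(2)[of "(x - t, x)"] by linarith
  qed
  then have "(\<lambda>x. \<Sum>t | word_length S t \<le> R. g t (x + t) - g t x) \<in> coinvariant_relations"
    by (intro coinvariant_relations_sum finite_word_length coinvariant_relations_translation)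
  also have "(\<lambda>x. \<Sum>t | word_length S t \<le> R. g t (x + t) - g t x) = (\<lambda>x. real_of_int (uf_boundary c x))"
    by (simp add: uf_boundary_eq'[OF c(1)] g_def add_diff_eq[symmetric])
  finally show ?thesis .
qed

text \<open>The sum over \<open>F\<close> telescopes: it leaves only the values of \<open>g\<close>
  on \<open>Ft - F\<close> and on \<open>F - Ft\<close>. These sets have the same size, and the
  former lies in the boundary layer of \<open>F\<close>; hence twice the bound of \<open>g\<close>
  as the constant.\<close>

lemma translation_Whyte:
  fixes g :: "'g \<Rightarrow> real"
  assumes "g \<in> carrier bounded_functions"
  shows "\<exists>C\<ge>0. \<exists>R. \<forall>F. finite F \<longrightarrow> \<bar>\<Sum>x\<in>F. g (x + t) - g x\<bar> \<le> C * real (card (nbhd R F - F))"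
proof -
  obtain C where C: "\<And>x. \<bar>g x\<bar> \<le> C" using assms by (auto simp: carrier_bounded_functions)
  then have C0: "0 \<le> C" using abs_ge_zero order_trans by blast
  have "\<bar>\<Sum>x\<in>F. g (x + t) - g x\<bar> \<le> (2 * C) * card (nbhd (word_length S t) F - F)"
    if F: "finite F" for F
  proof -
    define Ft where "Ft = (\<lambda>x. x + t) ` F"
    have Ft: "finite Ft" "card Ft = card F"
      using F by (auto simp: Ft_def card_image inj_on_def)
    have bd: "\<bar>sum g A\<bar> \<le> C * card A" for A
    proof -
      have "\<bar>sum g A\<bar> \<le> (\<Sum>x\<in>A. \<bar>g x\<bar>)" by (rule sum_abs)
      also have "\<dots> \<le> of_nat (card A) * C" by (rule sum_bounded_above) (rule C)
      finally show ?thesis by (simp add: mult.commute)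
    qed
    have sub: "Ft - F \<subseteq> nbhd (word_length S t) F - F"
    proof -
      have "word_dist S x (x + t) \<le> word_length S t" for x
        by (simp add: word_dist_def add.assoc[symmetric])
      then show ?thesis by (auto simp: Ft_def nbhd_def)
    qed
    have "card (Ft - F) = card (F - Ft)"
      using card_Int_Diff[of Ft F] card_Int_Diff[of F Ft] F Ft by (simp add: Int_commute)
    moreover have le: "card (Ft - F) \<le> card (nbhd (word_length S t) F - F)"
      using sub F by (intro card_mono) (auto intro: finite_nbhd)
    moreover have "(\<Sum>x\<in>F. g (x + t) - g x) = sum g (Ft - F) - sum g (F - Ft)"
    proof -
      have "(\<Sum>x\<in>F. g (x + t)) = sum g Ft"
        unfolding Ft_def by (subst sum.reindex) (auto simp: inj_on_def)
      also have "\<dots> = sum g (Ft \<inter> F) + sum g (Ft - F)"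
        using Ft(1) by (rule sum.Int_Diff)
      finally have 1: "(\<Sum>x\<in>F. g (x + t)) = sum g (Ft \<inter> F) + sum g (Ft - F)" .
      have "sum g F = sum g (F \<inter> Ft) + sum g (F - Ft)"
        using F by (rule sum.Int_Diff)
      with 1 show ?thesis by (simp add: sum_subtractf Int_commute)
    qed
    ultimately have "\<bar>\<Sum>x\<in>F. g (x + t) - g x\<bar> \<le> C * card (Ft - F) + C * card (Ft - F)"
      using bd[of "Ft - F"] bd[of "F - Ft"] by simp
    also have "\<dots> \<le> (2 * C) * card (nbhd (word_length S t) F - F)"
      using mult_left_mono[OF le[THEN of_nat_mono], of C] C0 by simp
    finally show ?thesis .
  qed
  then show ?thesis using C0 by (intro exI[of _ "2 * C"]) auto
qed

text \<open>The necessary half of Whyte's criterion. The estimate is stable under sums, since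
  constants add up and the larger radius serves for both, so it passes from generators to the
  generated subgroup.\<close>

lemma coinvariant_relations_Whyte:
  assumes "f \<in> coinvariant_relations"
  shows "\<exists>C\<ge>0. \<exists>R. \<forall>F. finite F \<longrightarrow> \<bar>sum f F\<bar> \<le> C * real (card (nbhd R F - F))"
  using assms unfolding coinvariant_relations_def
proof (induction rule: generate.induct)
  case one
  show ?case by (intro exI[of _ 0]) (simp add: one_bounded_functions)
next
  case (incl f)
  then obtain g t where g: "g \<in> carrier bounded_functions" "f = (\<lambda>x. g (x + t) - g x)" by blast
  show ?case unfolding g(2) by (rule translation_Whyte[OF g(1)])
next
  case (inv f)
  have "f \<in> coinvariant_relations" using inv unfolding coinvariant_relations_def by (rule generate.incl)
  then have f: "f \<in> carrier bounded_functions" using subgroup.mem_carrier[OF subgroup_coinvariant_relations] by blast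
  from inv obtain g t where g: "g \<in> carrier bounded_functions" "f = (\<lambda>x. g (x + t) - g x)" by blast
  have "\<bar>sum (inv\<^bsub>bounded_functions\<^esub> f) F\<bar> = \<bar>\<Sum>x\<in>F. g (x + t) - g x\<bar>" for F
    unfolding inv_bounded_functions[OF f] by (simp add: g(2) sum_subtractf abs_minus_commute)
  then show ?case using translation_Whyte[OF g(1), of t] by simp
next
  case (eng f g)
  then obtain C R C' R' where CR: "C \<ge> 0" "C' \<ge> 0"
    "\<And>F. finite F \<Longrightarrow> \<bar>sum f F\<bar> \<le> C * real (card (nbhd R F - F))"
    "\<And>F. finite F \<Longrightarrow> \<bar>sum g F\<bar> \<le> C' * real (card (nbhd R' F - F))" by blast
  have "\<bar>sum (f \<otimes>\<^bsub>bounded_functions\<^esub> g) F\<bar> \<le> (C + C') * real (card (nbhd (max R R') F - F))" if F: "finite F" for F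
  proof -
    have "card (nbhd R F - F) \<le> card (nbhd (max R R') F - F)" "card (nbhd R' F - F) \<le> card (nbhd (max R R') F - F)"
      using F nbhd_mono[of R "max R R'" F] nbhd_mono[of R' "max R R'" F]
      by (auto intro!: card_mono finite_nbhd)
    then have "C * real (card (nbhd R F - F)) \<le> C * real (card (nbhd (max R R') F - F))"
      "C' * real (card (nbhd R' F - F)) \<le> C' * real (card (nbhd (max R R') F - F))"
      using CR(1,2) by (simp_all add: mult_left_mono)
    moreover have "\<bar>sum (f \<otimes>\<^bsub>bounded_functions\<^esub> g) F\<bar> \<le> \<bar>sum f F\<bar> + \<bar>sum g F\<bar>"
      by (simp add: mult_bounded_functions sum.distrib)
    ultimately show ?thesis using CR(3)[OF F] CR(4)[OF F] unfolding distrib_right by linarith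
  qed
  then show ?case using CR by (intro exI[of _ "C + C'"]) auto
qed

text \<open>The sufficient half of Whyte's criterion, in the form that makes integral homology embed
  into real homology. Positive and negative parts of \<open>f\<close> are padded by a constant
  \<open>M\<close>, which cancels in the difference. The padding over the boundary layer of
  \<open>F\<close> pays for the defect between the two sums over \<open>F\<close>, so Hall's
  condition holds.\<close>

lemma integral_coinvariant_is_boundary:
  fixes f :: "'g \<Rightarrow> int"
  assumes f: "f \<in> carrier bounded_functions" and "(\<lambda>x. real_of_int (f x)) \<in> coinvariant_relations"
  shows "f \<in> uf_boundary ` uf_chains S"
proof -
  obtain C R where C: "C \<ge> 0"
    and CR: "\<And>F. finite F \<Longrightarrow> \<bar>\<Sum>x\<in>F. real_of_int (f x)\<bar> \<le> C * real (card (nbhd R F - F))"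
    using coinvariant_relations_Whyte[OF assms(2)] by blast
  obtain D where D: "\<And>x. \<bar>f x\<bar> \<le> D" using f by (auto simp: carrier_bounded_functions)
  \<comment> \<open>\<open>M\<close> is at least \<open>C\<close>: each point of the boundary layer
    has to contribute at least \<open>C\<close>.\<close>
  define M where "M = nat \<lceil>C\<rceil>"
  define h where "h x = nat (f x) + M" for x
  define h' where "h' x = nat (- f x) + M" for x
  have diff: "int (h x) - int (h' x) = f x" for x by (simp add: h_def h'_def)
  have key: "sum h1 F \<le> sum h2 (nbhd R F)"
    if F: "finite F" and h: "\<And>F. real (sum h1 F) - real (sum h2 F) \<le> \<bar>\<Sum>x\<in>F. real_of_int (f x)\<bar>" "\<And>x. M \<le> h2 x"
    for h1 h2 F
  proof -
    have "C * real (card (nbhd R F - F)) \<le> real M * real (card (nbhd R F - F))"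
      unfolding M_def by (intro mult_right_mono) linarith+
    also have "\<dots> \<le> real (sum h2 (nbhd R F - F))"
      using sum_bounded_below[of "nbhd R F - F" M h2] h(2)
      by (metis mult.commute of_nat_id of_nat_le_iff of_nat_mult)
    finally have "real (sum h1 F) \<le> real (sum h2 F) + real (sum h2 (nbhd R F - F))"
      using CR[OF F] h(1)[of F] by linarith
    also have "\<dots> = real (sum h2 (nbhd R F))"
      using sum.subset_diff[OF subset_nbhd finite_nbhd[OF F], of h2 R] by simp
    finally show ?thesis by (rule of_nat_le_iff[THEN iffD1])
  qed
  have fsum: "(\<Sum>x\<in>F. real_of_int (f x)) = real (sum h F) - real (sum h' F)" for F
    by (simp add: sum_subtractf[symmetric] diff[symmetric])
  have "(\<lambda>x. int (h x) - int (h' x)) \<in> uf_boundary ` uf_chains S"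
  proof (rule uf_boundaryI)
    show "h x \<le> nat D + M" "h' x \<le> nat D + M" for x
      using D[of x] by (auto simp: h_def h'_def)
    show "sum h F \<le> sum h' (nbhd R F)" if "finite F" for F
      using that by (rule key) (auto simp: fsum h'_def)
    show "sum h' F \<le> sum h (nbhd R F)" if "finite F" for F
      using that by (rule key) (auto simp: fsum h_def)
  qed
  then show ?thesis by (simp add: diff)
qed

end

section \<open>Integral and real homology\<close>

context finitely_generated_group begin

text \<open>\<open>b (t, x)\<close> is the amount flowing from \<open>x\<close> to \<open>x + t\<close>.\<close>

definition outflow :: "('g \<times> 'g \<Rightarrow> real) \<Rightarrow> 'g \<Rightarrow> real" where
  "outflow b x = (\<Sum>t | word_length S t \<le> 1. b (t, x) - b (t, x - t))"

lemma outflow_coinvariant: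
  assumes "\<And>p. \<bar>b p\<bar> \<le> C"
  shows "outflow b \<in> coinvariant_relations"
proof -
  have "(\<lambda>x. b (t, (x + t) - t) - b (t, x - t)) \<in> coinvariant_relations" for t
    by (rule coinvariant_relations_translation[of "\<lambda>x. b (t, x - t)"])
       (use assms in \<open>auto simp: carrier_bounded_functions\<close>)
  then have "(\<lambda>x. \<Sum>t | word_length S t \<le> 1. b (t, (x + t) - t) - b (t, x - t)) \<in> coinvariant_relations"
    by (intro coinvariant_relations_sum finite_word_length)
  then show ?thesis by (simp add: outflow_def[abs_def])
qed

text \<open>Among the points of \<open>F\<close> take one closest to some \<open>z\<close> outside.
  The first letter of a shortest word leading to \<open>z\<close> moves closer to \<open>z\<close>,
  hence out of \<open>F\<close>.\<close>

lemma exit_edge: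
  assumes F: "finite F" "F \<noteq> {}" and inf: "infinite (UNIV :: 'g set)"
  shows "\<exists>x\<in>F. \<exists>t. word_length S t \<le> 1 \<and> x + t \<notin> F"
proof -
  obtain z where z: "z \<notin> F" using ex_new_if_finite[OF inf F(1)] by blast
  obtain x where x: "x \<in> F" "\<And>y. y \<in> F \<Longrightarrow> word_dist S x z \<le> word_dist S y z"
    using ex_is_arg_min_if_finite[OF F, of "\<lambda>x. word_dist S x z"]
    by (auto simp: is_arg_min_linorder)
  obtain ts where ts: "is_word S ts" "sum_list ts = - x + z" "length ts = word_dist S x z"
    unfolding word_dist_def by (rule obtain_word)
  show ?thesis
  proof (cases ts)
    case Nil
    then have "x = z" using ts(2) by (metis add.right_neutral add_minus_cancel sum_list.Nil)
    then show ?thesis using x z by simp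
  next
    case (Cons t us)
    have us: "sum_list us = - (x + t) + z"
      using ts(2) Cons by (metis add.assoc minus_add minus_add_cancel sum_list.Cons)
    have "is_word S us" "is_word S [t]" using ts(1) Cons by (auto simp: is_word_def)
    from word_length_le[OF this(1)] word_length_le[OF this(2)]
    have "word_dist S (x + t) z < word_dist S x z" "word_length S t \<le> 1"
      using us Cons ts(3) by (auto simp: word_dist_def)
    then show ?thesis using x by (meson leD)
  qed
qed

text \<open>
  A vertex of \<open>F\<close> with a neighbour outside \<open>F\<close> is treated last: its fractional part then leaves \<open>F\<close>
  without disturbing the other vertices.
\<close>

lemma finite_integral_outflow:
  assumes inf: "infinite (UNIV :: 'g set)" and "finite F"
  shows "\<exists>b. (\<forall>p. b p \<in> {0..1}) \<and> (\<forall>t x. b (t, x) \<noteq> 0 \<longrightarrow> x \<in> F) \<and> (\<forall>x\<in>F. u x - outflow b x \<in> \<int>)"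
  using assms(2)
proof (induction "card F" arbitrary: F)
  case 0
  then show ?case by (intro exI[of _ "\<lambda>_. 0"]) simp
next
  case (Suc n)
  then have "F \<noteq> {}" by auto
  then obtain x0 t0 where x0: "x0 \<in> F" and t0: "word_length S t0 \<le> 1" "x0 + t0 \<notin> F"
    using exit_edge[OF Suc(3) _ inf] by blast
  have "card (F - {x0}) = n" "finite (F - {x0})" using Suc x0 by auto
  then obtain b where b: "\<And>p. b p \<in> {0..1}" "\<And>t x. b (t, x) \<noteq> 0 \<Longrightarrow> x \<in> F - {x0}"
    "\<And>x. x \<in> F - {x0} \<Longrightarrow> u x - outflow b x \<in> \<int>"
    using Suc(1)[of "F - {x0}"] by metis
  define s where "s = frac (u x0 - outflow b x0)"
  define b' where "b' = (\<lambda>(t, x). b (t, x) + (if t = t0 then if x = x0 then s else 0 else 0))"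
  \<comment> \<open>So far no flow leaves \<open>x0\<close>, so the new value on the edge
    \<open>(t0, x0)\<close> is \<open>s\<close> itself and stays in the unit interval.\<close>
  have b0: "b (t, x0) = 0" for t using b(2)[of t x0] by auto
  have out: "outflow b' x = outflow b x + (if x = x0 then s else 0) - (if x = x0 + t0 then s else 0)" for x
  proof -
    have "outflow b' x = outflow b x
        + (\<Sum>t | word_length S t \<le> 1. (if t = t0 then if x = x0 then s else 0 else 0))
        - (\<Sum>t | word_length S t \<le> 1. (if t = t0 then if x - t0 = x0 then s else 0 else 0))"
      unfolding outflow_def b'_def by (simp add: sum.distrib sum_subtractf cong: if_cong)
    moreover have "x - t0 = x0 \<longleftrightarrow> x = x0 + t0" by (auto simp: diff_eq_eq)
    ultimately show ?thesis using t0(1) finite_word_length[of 1] by (simp add: sum.delta)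
  qed
  show ?case
  proof (intro exI[of _ b'] conjI allI ballI impI)
    fix p show "b' p \<in> {0..1}"
      using b(1)[of p] b0 frac_ge_0[of "u x0 - outflow b x0"] frac_lt_1[of "u x0 - outflow b x0"]
      by (cases p) (auto simp: b'_def s_def less_imp_le)
  next
    fix t x assume "b' (t, x) \<noteq> 0"
    then show "x \<in> F" using b(2)[of t x] x0 by (auto simp: b'_def split: if_splits)
  next
    fix x assume x: "x \<in> F"
    then have ne: "x \<noteq> x0 + t0" using t0 by auto
    show "u x - outflow b' x \<in> \<int>"
    proof (cases "x = x0")
      case True
      then have "u x - outflow b' x = of_int \<lfloor>u x0 - outflow b x0\<rfloor>"
        using ne unfolding out by (simp add: s_def frac_def)
      then show ?thesis by simp
    next
      case False
      then show ?thesis using b(3)[of x] x ne by (simp add: out)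
    qed
  qed
qed

text \<open>Flows with values in the unit interval form a compact cube. The outflow at a vertex
  involves finitely many coordinates, so it is continuous and its integrality is a closed condition;
  the finite case supplies the finite intersection property.\<close>

lemma integral_outflow:
  assumes inf: "infinite (UNIV :: 'g set)"
  shows "\<exists>b. (\<forall>p. b p \<in> {0..1}) \<and> (\<forall>x. u x - outflow b x \<in> \<int>)"
proof -
  define K where "K = (PiE UNIV (\<lambda>_. {0..1}) :: ('g \<times> 'g \<Rightarrow> real) set)"
  have "compactin (product_topology (\<lambda>_::'g \<times> 'g. euclidean :: real topology) UNIV) K"
    unfolding K_def by (subst compactin_PiE) auto
  then have K: "compact K" by (simp add: euclidean_product_topology)
  define Z where "Z x = {b. u x - outflow b x \<in> \<int>}" for x
  have cont: "continuous_on UNIV (\<lambda>b. u x - outflow b x)" for x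
    unfolding outflow_def
    by (intro continuous_intros continuous_on_product_coordinates)
  have closed: "closed (Z x)" for x
    using closed_vimage[OF closed_Ints cont[of x]] by (simp add: Z_def vimage_def)
  have "K \<inter> \<Inter> (range Z) \<noteq> {}"
  proof (rule compact_imp_fip[OF K])
    show "closed T" if "T \<in> range Z" for T using that closed by auto
    fix A assume "finite A" "A \<subseteq> range Z"
    then obtain F where F: "finite F" "A = Z ` F" using finite_subset_image by metis
    obtain b where "\<forall>p. b p \<in> {0..1}" "\<forall>x\<in>F. u x - outflow b x \<in> \<int>"
      using finite_integral_outflow[OF inf F(1)] by blast
    then have "b \<in> K \<inter> \<Inter> A" by (auto simp: K_def Z_def F)
    then show "K \<inter> \<Inter> A \<noteq> {}" by blast
  qed
  then show ?thesis by (auto simp: K_def Z_def PiE_def Pi_def)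
qed

lemma real_bounded_functions:
  fixes g :: "'i \<Rightarrow> int"
  assumes "g \<in> carrier bounded_functions"
  shows "(\<lambda>x. real_of_int (g x)) \<in> carrier bounded_functions"
proof -
  obtain C where "\<And>x. \<bar>g x\<bar> \<le> C" using assms by (auto simp: carrier_bounded_functions)
  then have "\<bar>real_of_int (g x)\<bar> \<le> of_int C" for x by (metis of_int_abs of_int_le_iff)
  then show ?thesis by (auto simp: carrier_bounded_functions)
qed

lemma H0_uf_to_H0_linf_rcos:
  assumes f: "f \<in> carrier bounded_functions"
  shows "H0_uf_to_H0_linf ((uf_boundary ` uf_chains S) #>\<^bsub>bounded_functions\<^esub> f)
    = coinvariant_relations #>\<^bsub>bounded_functions\<^esub> (\<lambda>x. real_of_int (f x))"
proof -
  let ?H = "uf_boundary ` uf_chains S"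
  have "coinvariant_relations #>\<^bsub>bounded_functions\<^esub> (\<lambda>x. real_of_int (g x))
      = coinvariant_relations #>\<^bsub>bounded_functions\<^esub> (\<lambda>x. real_of_int (f x))"
    if "g \<in> ?H #>\<^bsub>bounded_functions\<^esub> f" for g
  proof -
    have g: "g \<in> carrier bounded_functions"
      using that bf.r_coset_subset_G[OF subgroup.subset[OF subgroup_uf_boundaries] f] by blast
    from that have "(\<lambda>x. g x - f x) \<in> ?H" by (simp only: mem_rcos_bounded_functions)
    then obtain c where "c \<in> uf_chains S" "uf_boundary c = (\<lambda>x. g x - f x)" by auto
    then have "(\<lambda>x. real_of_int (g x) - real_of_int (f x)) \<in> coinvariant_relations"
      using uf_boundary_coinvariant[of c] by simp
    then show ?thesis
      using rcos_bounded_functions_eq_iff[OF subgroup_coinvariant_relations real_bounded_functions[OF g] real_bounded_functions[OF f]] by blast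
  qed
  moreover have "f \<in> ?H #>\<^bsub>bounded_functions\<^esub> f"
    by (rule bf.rcos_self[OF f subgroup_uf_boundaries])
  ultimately have "(\<lambda>g. coinvariant_relations #>\<^bsub>bounded_functions\<^esub> (\<lambda>x. real_of_int (g x))) `
      (?H #>\<^bsub>bounded_functions\<^esub> f)
    = {coinvariant_relations #>\<^bsub>bounded_functions\<^esub> (\<lambda>x. real_of_int (f x))}" by blast
  then show ?thesis unfolding H0_uf_to_H0_linf_def by simp
qed

text \<open>Injectivity is the sufficient half of Whyte's criterion. For surjectivity, a real
  function becomes integral after subtracting the outflow of a bounded flow, which is a coinvariant
  relation.\<close>

theorem H0_uf_to_H0_linf_iso:
  assumes inf: "infinite (UNIV :: 'g set)"
  shows "H0_uf_to_H0_linf \<in> iso (H0_uf S) (H0_linf :: ('g \<Rightarrow> real) set monoid)"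
proof -
  let ?H = "uf_boundary ` uf_chains S" and ?B = bounded_functions
  note rcos_eq = rcos_bounded_functions_eq_iff
  have "H0_uf_to_H0_linf \<in> hom (H0_uf S) H0_linf"
  proof (rule homI)
    fix X assume "X \<in> carrier (H0_uf S)"
    then show "H0_uf_to_H0_linf X \<in> carrier H0_linf"
      unfolding H0_uf_def H0_linf_def
      by (auto simp: H0_uf_to_H0_linf_rcos elim!: FactGroup_comm_group_cases
          intro!: rcos_carrier_FactGroup real_bounded_functions)
  next
    fix X Y assume "X \<in> carrier (H0_uf S)" "Y \<in> carrier (H0_uf S)"
    then obtain f g where f: "f \<in> carrier ?B" "X = ?H #>\<^bsub>?B\<^esub> f" and g: "g \<in> carrier ?B" "Y = ?H #>\<^bsub>?B\<^esub> g"
      unfolding H0_uf_def by (metis FactGroup_comm_group_cases)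
    show "H0_uf_to_H0_linf (X \<otimes>\<^bsub>H0_uf S\<^esub> Y) = H0_uf_to_H0_linf X \<otimes>\<^bsub>H0_linf\<^esub> H0_uf_to_H0_linf Y"
      using f g by (simp del: mult_FactGroup add: H0_uf_def H0_linf_def mult_FactGroup_bounded_functions subgroup_uf_boundaries
        subgroup_coinvariant_relations real_bounded_functions bounded_functions_plus H0_uf_to_H0_linf_rcos)
  qed
  moreover have "inj_on H0_uf_to_H0_linf (carrier (H0_uf S))"
  proof (rule inj_onI)
    fix X Y assume "X \<in> carrier (H0_uf S)" "Y \<in> carrier (H0_uf S)" and eq: "H0_uf_to_H0_linf X = H0_uf_to_H0_linf Y"
    then obtain f g where f: "f \<in> carrier ?B" "X = ?H #>\<^bsub>?B\<^esub> f" and g: "g \<in> carrier ?B" "Y = ?H #>\<^bsub>?B\<^esub> g"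
      unfolding H0_uf_def by (metis FactGroup_comm_group_cases)
    have "(\<lambda>x. real_of_int (f x - g x)) \<in> coinvariant_relations"
      using eq rcos_eq[OF subgroup_coinvariant_relations real_bounded_functions[OF f(1)] real_bounded_functions[OF g(1)]]
      by (simp add: H0_uf_to_H0_linf_rcos f g)
    then have "(\<lambda>x. f x - g x) \<in> ?H"
      by (intro integral_coinvariant_is_boundary bounded_functions_minus f g)
    then show "X = Y" using rcos_eq[OF subgroup_uf_boundaries f(1) g(1)] f(2) g(2) by simp
  qed
  moreover have "H0_uf_to_H0_linf ` carrier (H0_uf S) = carrier H0_linf"
  proof (intro equalityI subsetI)
    fix Y assume "Y \<in> H0_uf_to_H0_linf ` carrier (H0_uf S)"
    then show "Y \<in> carrier H0_linf" using \<open>H0_uf_to_H0_linf \<in> hom (H0_uf S) H0_linf\<close>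
      by (auto simp: hom_def)
  next
    fix Y :: "('g \<Rightarrow> real) set" assume "Y \<in> carrier H0_linf"
    then obtain u where u: "u \<in> carrier ?B" "Y = coinvariant_relations #>\<^bsub>?B\<^esub> u"
      unfolding H0_linf_def by (rule FactGroup_comm_group_cases)
    obtain b where b: "\<And>p. b p \<in> {0..1}" "\<And>x. u x - outflow b x \<in> \<int>"
      using integral_outflow[OF inf] by blast
    define f where "f x = \<lfloor>u x - outflow b x\<rfloor>" for x
    have fx: "real_of_int (f x) = u x - outflow b x" for x
      using b(2)[of x] by (auto simp: f_def elim: Ints_cases)
    have "\<bar>b p\<bar> \<le> 1" for p using b(1)[of p] by auto
    then have out: "outflow b \<in> coinvariant_relations" by (rule outflow_coinvariant)
    then have "outflow b \<in> carrier ?B" using subgroup.mem_carrier[OF subgroup_coinvariant_relations] by blast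
    from bounded_functions_minus[OF u(1) this] obtain C where C: "\<And>x. \<bar>u x - outflow b x\<bar> \<le> C"
      by (auto simp: carrier_bounded_functions)
    have "\<bar>f x\<bar> \<le> \<lceil>C\<rceil>" for x using C[of x] fx[of x] by linarith
    then have f: "f \<in> carrier ?B" by (auto simp: carrier_bounded_functions)
    have "coinvariant_relations #>\<^bsub>?B\<^esub> u = coinvariant_relations #>\<^bsub>?B\<^esub> (\<lambda>x. real_of_int (f x))"
      using rcos_eq[OF subgroup_coinvariant_relations u(1) real_bounded_functions[OF f]] out by (simp add: fx)
    then have "Y = H0_uf_to_H0_linf (?H #>\<^bsub>?B\<^esub> f)" using u f by (simp add: H0_uf_to_H0_linf_rcos)
    moreover have "?H #>\<^bsub>?B\<^esub> f \<in> carrier (H0_uf S)"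
      unfolding H0_uf_def using f by (rule rcos_carrier_FactGroup)
    ultimately show "Y \<in> H0_uf_to_H0_linf ` carrier (H0_uf S)" by blast
  qed
  ultimately show ?thesis by (simp add: iso_def bij_betw_def)
qed

text \<open>Real functions can be divided by \<open>n\<close> pointwise. This is what the passage to
  real coefficients is for.\<close>

lemma H0_linf_divisible:
  assumes "X \<in> carrier (H0_linf :: ('g \<Rightarrow> real) set monoid)" "n > 0"
  shows "\<exists>Y\<in>carrier H0_linf. Y [^]\<^bsub>H0_linf\<^esub> (n::nat) = X"
proof -
  let ?B = bounded_functions
  obtain u where u: "u \<in> carrier ?B" "X = coinvariant_relations #>\<^bsub>?B\<^esub> u"
    using assms(1) unfolding H0_linf_def by (rule FactGroup_comm_group_cases)
  have mul: "(\<lambda>x. c * u x) \<in> carrier ?B" for c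
  proof -
    obtain C where "\<And>x. \<bar>u x\<bar> \<le> C" using u(1) by (auto simp: carrier_bounded_functions)
    then have "\<bar>c * u x\<bar> \<le> \<bar>c\<bar> * C" for x by (simp add: abs_mult mult_left_mono)
    then show ?thesis by (auto simp: carrier_bounded_functions)
  qed
  have "(coinvariant_relations #>\<^bsub>?B\<^esub> (\<lambda>x. c * u x)) [^]\<^bsub>H0_linf\<^esub> k
      = coinvariant_relations #>\<^bsub>?B\<^esub> (\<lambda>x. of_nat k * c * u x)" for c and k :: nat
  proof (induction k)
    case 0
    have "coinvariant_relations #>\<^bsub>?B\<^esub> (\<lambda>_::'g. 0) = coinvariant_relations"
      using bf.coset_mult_one[OF subgroup.subset[OF subgroup_coinvariant_relations]]
      by (simp add: one_bounded_functions)
    then show ?case by (simp add: H0_linf_def FactGroup_def nat_pow_def)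
  next
    case (Suc k)
    then show ?case
      using mult_FactGroup_bounded_functions[OF subgroup_coinvariant_relations mul[of "of_nat k * c"] mul[of c]]
      by (simp add: H0_linf_def nat_pow_def algebra_simps)
  qed
  from this[of "1 / of_nat n" n] have "(coinvariant_relations #>\<^bsub>?B\<^esub> (\<lambda>x. 1 / of_nat n * u x)) [^]\<^bsub>H0_linf\<^esub> n = X"
    using assms(2) u(2) by simp
  moreover have "coinvariant_relations #>\<^bsub>?B\<^esub> (\<lambda>x. 1 / of_nat n * u x) \<in> carrier H0_linf"
    unfolding H0_linf_def by (rule rcos_carrier_FactGroup[OF mul])
  ultimately show ?thesis by blast
qed

end

section \<open>Divisible subgroups split off\<close>

text \<open>
  A subgroup \<open>B\<close> of \<open>G\<close> that is maximal among those meeting \<open>A\<close> trivially is a complement of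
  \<open>A\<close> if \<open>A\<close> is divisible.
\<close>

lemma (in comm_group) divisible_subgroup_complement:
  assumes A: "subgroup A G"
    and div: "\<And>a n. a \<in> A \<Longrightarrow> n > 0 \<Longrightarrow> \<exists>b\<in>A. b [^] (n::nat) = a"
  shows "\<exists>B. subgroup B G \<and> A \<inter> B = {\<one>} \<and> A <#> B = carrier G"
proof -
  interpret A: subgroup A G by (rule A)
  let ?Q = "{B. subgroup B G \<and> A \<inter> B = {\<one>}}"
  have "\<exists>M\<in>?Q. \<forall>X\<in>?Q. M \<subseteq> X \<longrightarrow> X = M"
  proof (rule subset_Zorn_nonempty)
    show "?Q \<noteq> {}" using triv_subgroup A.one_closed by blast
    fix C assume C: "C \<noteq> {}" "subset.chain ?Q C"
    have sg: "subgroup B G" "A \<inter> B = {\<one>}" if "B \<in> C" for B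
      using C that by (auto simp: subset.chain_def)
    have "subgroup (\<Union>C) G"
    proof (rule subgroupI)
      show "\<Union>C \<subseteq> carrier G" using sg subgroup.subset by blast
      show "\<Union>C \<noteq> {}" using C(1) subgroup.one_closed[OF sg(1)] by blast
      show "inv a \<in> \<Union>C" if "a \<in> \<Union>C" for a using that subgroup.m_inv_closed[OF sg(1)] by blast
      fix a b assume "a \<in> \<Union>C" "b \<in> \<Union>C"
      then obtain X Y where XY: "X \<in> C" "Y \<in> C" "a \<in> X" "b \<in> Y" by blast
      then have "X \<subseteq> Y \<or> Y \<subseteq> X" using C by (auto simp: subset.chain_def subset_chain_def)
      then obtain Z where "Z \<in> C" "a \<in> Z" "b \<in> Z" using XY by blast
      then show "a \<otimes> b \<in> \<Union>C" using subgroup.m_closed[OF sg(1)] by blast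
    qed
    moreover have "A \<inter> \<Union>C = {\<one>}" using sg(2) C(1) by blast
    ultimately show "\<Union>C \<in> ?Q" by simp
  qed
  then obtain B where BQ: "B \<in> ?Q" and maxQ: "\<forall>X\<in>?Q. B \<subseteq> X \<longrightarrow> X = B" by (rule bexE)
  from BQ have B: "subgroup B G" "A \<inter> B = {\<one>}" by simp_all
  from maxQ have max: "X = B" if "subgroup X G" "A \<inter> X = {\<one>}" "B \<subseteq> X" for X
    using that by simp
  interpret B: subgroup B G by (rule B(1))
  have AB: "subgroup (A <#> B) G"
    using mult_subgroups[OF A B(1)] by simp
  interpret AB: subgroup "A <#> B" G by (rule AB)
  have sub_mult: "X \<subseteq> X <#> Y" "Y \<subseteq> X <#> Y" if "subgroup X G" "subgroup Y G" for X Y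
  proof -
    interpret X: subgroup X G by (rule that(1))
    interpret Y: subgroup Y G by (rule that(2))
    have "x = x \<otimes> \<one>" if "x \<in> X" for x using that by simp
    then show "X \<subseteq> X <#> Y" unfolding set_mult_def using Y.one_closed by blast
    have "y = \<one> \<otimes> y" if "y \<in> Y" for y using that by simp
    then show "Y \<subseteq> X <#> Y" unfolding set_mult_def using X.one_closed by blast
  qed
  note subA = sub_mult[OF A B(1)]
  have "x \<in> A <#> B" if x: "x \<in> carrier G" for x
  proof (rule ccontr)
    assume nx: "x \<notin> A <#> B"
    \<comment> \<open>By maximality, the subgroup generated by \<open>B\<close> and \<open>y\<close>
      meets \<open>A\<close> in some \<open>a \<noteq> \<one>\<close>. Writing \<open>a\<close> as
      an element of \<open>B\<close> times a power of \<open>y\<close> puts that power into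
      \<open>A <#> B\<close>; it is not in \<open>B\<close>, or else \<open>a\<close> would
      be.\<close>
    have meets: "\<exists>k::int. y [^] k \<in> A <#> B \<and> \<not> (y [^] k \<in> B)"
      if y: "y \<in> carrier G" "y \<notin> A <#> B" for y
    proof -
      have gen: "subgroup (B <#> generate G {y}) G"
        using mult_subgroups[OF B(1) generate_is_subgroup] y by simp
      have genE: "\<exists>k::int. z = y [^] k" if "z \<in> generate G {y}" for z
        using that generate_pow[OF y(1)] by auto
      have gy: "subgroup (generate G {y}) G" using y by (intro generate_is_subgroup) simp
      have y1: "y \<in> B <#> generate G {y}"
        using sub_mult(2)[OF B(1) gy] generate.incl[of y "{y}" G] by blast
      have "B \<subseteq> B <#> generate G {y}"
        by (rule sub_mult(1)[OF B(1) gy])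
      moreover have "B <#> generate G {y} \<noteq> B" using y1 y(2) subA by blast
      ultimately have "A \<inter> (B <#> generate G {y}) \<noteq> {\<one>}" using max[OF gen] by blast
      moreover have "\<one> \<in> A \<inter> (B <#> generate G {y})"
        using A.one_closed subgroup.one_closed[OF gen] by blast
      ultimately obtain a where a: "a \<in> A" "a \<in> B <#> generate G {y}" "a \<noteq> \<one>" by blast
      then obtain b k where b: "b \<in> B" "a = b \<otimes> y [^] (k::int)"
        unfolding set_mult_def using genE by blast
      have yk: "y [^] k = a \<otimes> inv b"
        using b a(1) y(1) by (simp add: m_comm[of b] m_assoc)
      have "y [^] k \<in> A <#> B" unfolding yk set_mult_def using a b by auto
      moreover have "y [^] k \<notin> B"
      proof
        assume "y [^] k \<in> B"
        then have "a \<in> B" using b by simp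
        then show False using a B(2) by blast
      qed
      ultimately show ?thesis by blast
    qed
    \<comment> \<open>The order of \<open>x\<close> modulo \<open>A <#> B\<close> is finite by
      \<open>meets\<close>: the exponent found there is nonzero because its power lies outside
      \<open>B\<close>.\<close>
    define P where "P n \<longleftrightarrow> n > 0 \<and> x [^] (n::nat) \<in> A <#> B" for n
    have "\<exists>n. P n"
    proof -
      obtain k :: int where k: "x [^] k \<in> A <#> B" "x [^] k \<notin> B" using meets[OF x nx] by blast
      then have "k \<noteq> 0" using B.one_closed by auto
      moreover have "x [^] (nat \<bar>k\<bar>) \<in> A <#> B"
      proof (cases k rule: int_cases2)
        case (nonneg m)
        then show ?thesis using k(1) by (simp add: int_pow_int)
      next
        case (nonpos m)
        then have "inv (x [^] m) \<in> A <#> B" using k(1) x by (simp add: int_pow_neg int_pow_int)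
        from AB.m_inv_closed[OF this] show ?thesis using x nonpos by simp
      qed
      ultimately show ?thesis by (intro exI[of _ "nat \<bar>k\<bar>"]) (simp add: P_def)
    qed
    define n where "n = (LEAST n. P n)"
    have n: "n > 0" "x [^] n \<in> A <#> B" using LeastI_ex[OF \<open>\<exists>n. P n\<close>] by (auto simp: n_def P_def)
    have least: "n \<le> m" if "m > 0" "x [^] m \<in> A <#> B" for m
      unfolding n_def by (rule Least_le) (simp add: P_def that)
    obtain a b where ab: "a \<in> A" "b \<in> B" "x [^] n = a \<otimes> b" using n(2) by (auto simp: set_mult_def)
    obtain c where c: "c \<in> A" "c [^] n = a" using div[OF ab(1) n(1)] by blast
    \<comment> \<open>Divisibility corrects \<open>x\<close> by an element of \<open>A\<close> so
      that the \<open>n\<close>-th power lands in \<open>B\<close>. Modulo \<open>A <#> B\<close>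
      nothing changes, so \<open>y\<close> has order \<open>n\<close> there too. Any power of
      \<open>y\<close> in \<open>A <#> B\<close> thus has exponent divisible by \<open>n\<close> and
      lies in \<open>B\<close>, contrary to \<open>meets\<close>.\<close>
    define y where "y = x \<otimes> inv c"
    have cc: "c \<in> carrier G" using c A.subset by blast
    have y: "y \<in> carrier G" using x cc by (simp add: y_def)
    have xy: "x = y \<otimes> c" using x cc by (simp add: y_def m_assoc)
    have iff: "y [^] k \<in> A <#> B \<longleftrightarrow> x [^] k \<in> A <#> B" for k :: int
    proof -
      have e: "x [^] k = y [^] k \<otimes> c [^] k"
        unfolding xy using y cc by (rule int_pow_distrib)
      have ck: "c [^] k \<in> A <#> B"
        using c(1) subA(1) subgroup_int_pow_closed[OF AB] by blast
      show ?thesis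
      proof
        assume "x [^] k \<in> A <#> B"
        then have "x [^] k \<otimes> inv (c [^] k) \<in> A <#> B" using ck by simp
        then show "y [^] k \<in> A <#> B" unfolding e using y cc by (simp add: m_assoc)
      qed (simp add: e ck)
    qed
    have yB: "y [^] n = b"
    proof -
      have "a \<otimes> b = y [^] n \<otimes> a"
        using ab(3) y cc c(2) by (simp add: xy nat_pow_distrib)
      then have "a \<otimes> b = a \<otimes> y [^] n"
        using ab(1) y by (simp add: m_comm)
      then show ?thesis using ab(1,2) y by simp
    qed
    have "y \<notin> A <#> B" using iff[of 1] nx x y by simp
    then obtain k :: int where k: "y [^] k \<in> A <#> B" "y [^] k \<notin> B" using meets[OF y] by blast
    have split: "y [^] k = b [^] (k div int n) \<otimes> y [^] (k mod int n)"
    proof -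
      have "y [^] k = y [^] (int n * (k div int n) + k mod int n)" by simp
      also have "\<dots> = (y [^] int n) [^] (k div int n) \<otimes> y [^] (k mod int n)"
        using y by (simp only: int_pow_mult int_pow_pow)
      finally show ?thesis by (simp add: yB int_pow_int)
    qed
    have bk: "b [^] (k div int n) \<in> B" using ab(2) subgroup_int_pow_closed[OF B(1)] by blast
    have mod0: "k mod int n = 0"
    proof (rule ccontr)
      assume ne: "k mod int n \<noteq> 0"
      have "inv (b [^] (k div int n)) \<otimes> y [^] k \<in> A <#> B"
        using bk subA(2) by (intro AB.m_closed AB.m_inv_closed k(1)) auto
      moreover have "inv (b [^] (k div int n)) \<otimes> y [^] k = y [^] (k mod int n)"
        using inv_solve_left[OF int_pow_closed[OF y(1)] B.mem_carrier[OF bk] int_pow_closed[OF y(1)]] split by metis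
      ultimately have "y [^] (k mod int n) \<in> A <#> B" by metis
      then have xk: "x [^] (k mod int n) \<in> A <#> B" by (rule iff[THEN iffD1])
      have "int n > 0" using n(1) by simp
      have pos: "k mod int n > 0" "k mod int n < int n"
        using pos_mod_sign[OF \<open>int n > 0\<close>, of k] pos_mod_bound[OF \<open>int n > 0\<close>, of k] ne by linarith+
      obtain m where m: "k mod int n = int m" using zero_le_imp_eq_int[of "k mod int n"] pos(1) by auto
      have "x [^] m \<in> A <#> B" using xk unfolding m int_pow_int .
      from least[OF _ this] pos m show False by linarith
    qed
    then have "y [^] k = b [^] (k div int n)" using split y B.mem_carrier[OF bk] by simp
    then show False using bk k(2) by simp
  qed
  moreover have "A <#> B \<subseteq> carrier G" by (rule AB.subset)
  ultimately have "A <#> B = carrier G" by (intro equalityI subsetI) auto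
  with B show ?thesis by (intro exI conjI)
qed

text \<open>The image of \<open>h\<close> inherits divisibility and so has a complement;
  \<open>r\<close> projects onto the image along it and inverts \<open>h\<close>.\<close>

lemma split_injective_if_divisible:
  assumes A: "comm_group A" and K: "comm_group K" and h: "h \<in> hom A K" "inj_on h (carrier A)"
    and div: "\<And>a n. a \<in> carrier A \<Longrightarrow> n > 0 \<Longrightarrow> \<exists>b\<in>carrier A. b [^]\<^bsub>A\<^esub> (n::nat) = a"
  shows "split_injective A K h"
proof -
  interpret A: comm_group A by (rule A)
  interpret K: comm_group K by (rule K)
  interpret h: group_hom A K h by unfold_locales (rule h(1))
  let ?I = "h ` carrier A"
  have I: "subgroup ?I K" by (rule h.img_is_subgroup)
  have divI: "\<exists>b\<in>?I. b [^]\<^bsub>K\<^esub> n = a" if I: "a \<in> ?I" and n: "n > 0" for a and n :: nat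
  proof -
    obtain a' where a': "a' \<in> carrier A" "a = h a'" using I by auto
    obtain b where b: "b \<in> carrier A" "b [^]\<^bsub>A\<^esub> n = a'" using div[OF a'(1) n] by auto
    have "h b [^]\<^bsub>K\<^esub> n = a" using h.hom_nat_pow[OF b(1), of n] b a' by simp
    then show ?thesis using b(1) by (intro bexI[of _ "h b"]) auto
  qed
  have "\<exists>B. subgroup B K \<and> ?I \<inter> B = {\<one>\<^bsub>K\<^esub>} \<and> ?I <#>\<^bsub>K\<^esub> B = carrier K"
    by (rule K.divisible_subgroup_complement[OF I divI])
  then obtain B where B: "subgroup B K" "?I \<inter> B = {\<one>\<^bsub>K\<^esub>}" "?I <#>\<^bsub>K\<^esub> B = carrier K"
    by (elim exE conjE) (rule that)
  interpret B: subgroup B K by (rule B(1))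
  have ex: "\<exists>a. a \<in> carrier A \<and> (\<exists>b\<in>B. x = h a \<otimes>\<^bsub>K\<^esub> b)" if "x \<in> carrier K" for x
    using that unfolding B(3)[symmetric] set_mult_def by blast
  have uniq: "a = a'" if "a \<in> carrier A" "a' \<in> carrier A" "b \<in> B" "b' \<in> B" "h a \<otimes>\<^bsub>K\<^esub> b = h a' \<otimes>\<^bsub>K\<^esub> b'" for a a' b b'
  proof -
    have c: "h a \<in> carrier K" "h a' \<in> carrier K" "b \<in> carrier K" "b' \<in> carrier K"
      using that(1-4) by auto
    define z where "z = b' \<otimes>\<^bsub>K\<^esub> inv\<^bsub>K\<^esub> b"
    have z: "z \<in> carrier K" "z \<in> B" using c that(3,4) by (auto simp: z_def)
    have "h a = (h a \<otimes>\<^bsub>K\<^esub> b) \<otimes>\<^bsub>K\<^esub> inv\<^bsub>K\<^esub> b" using c by (simp add: K.m_assoc)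
    also have "\<dots> = h a' \<otimes>\<^bsub>K\<^esub> z" unfolding that(5) z_def using c by (simp add: K.m_assoc)
    also have "\<dots> = z \<otimes>\<^bsub>K\<^esub> h a'" using c(2) z(1) by (rule K.m_comm)
    finally have ha: "h a = z \<otimes>\<^bsub>K\<^esub> h a'" .
    then have "h a \<otimes>\<^bsub>K\<^esub> inv\<^bsub>K\<^esub> (h a') = z" using c z by (simp add: K.m_assoc)
    then have "h (a \<otimes>\<^bsub>A\<^esub> inv\<^bsub>A\<^esub> a') = z" using that(1,2) by simp
    then have "z \<in> ?I \<inter> B" using z(2) that(1,2) by (intro IntI rev_image_eqI[of "a \<otimes>\<^bsub>A\<^esub> inv\<^bsub>A\<^esub> a'"]) auto
    then have "z = \<one>\<^bsub>K\<^esub>" using B(2) by simp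
    then have "h a = h a'" using ha c by simp
    then show ?thesis using h(2) that(1,2) by (auto dest: inj_onD)
  qed
  define r where "r x = (SOME a. a \<in> carrier A \<and> (\<exists>b\<in>B. x = h a \<otimes>\<^bsub>K\<^esub> b))" for x
  have r: "r x \<in> carrier A" "\<exists>b\<in>B. x = h (r x) \<otimes>\<^bsub>K\<^esub> b" if "x \<in> carrier K" for x
    using someI_ex[OF ex[OF that]] unfolding r_def by auto
  have rI: "r x = a" if "a \<in> carrier A" "b \<in> B" "x = h a \<otimes>\<^bsub>K\<^esub> b" for x a b
  proof -
    have x: "x \<in> carrier K" using that by simp
    from r[OF x] obtain b' where "b' \<in> B" "x = h (r x) \<otimes>\<^bsub>K\<^esub> b'" by blast
    then show ?thesis using uniq[OF r(1)[OF x] that(1) _ that(2)] that(3) by metis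
  qed
  have "r \<in> hom K A"
  proof (rule homI)
    show "r x \<in> carrier A" if "x \<in> carrier K" for x using r that by blast
    fix x y assume xy: "x \<in> carrier K" "y \<in> carrier K"
    obtain b where b: "b \<in> B" "x = h (r x) \<otimes>\<^bsub>K\<^esub> b" using r(2)[OF xy(1)] by blast
    obtain c where c: "c \<in> B" "y = h (r y) \<otimes>\<^bsub>K\<^esub> c" using r(2)[OF xy(2)] by blast
    have "x \<otimes>\<^bsub>K\<^esub> y = (h (r x) \<otimes>\<^bsub>K\<^esub> b) \<otimes>\<^bsub>K\<^esub> (h (r y) \<otimes>\<^bsub>K\<^esub> c)" using b c by metis
    also have "\<dots> = h (r x \<otimes>\<^bsub>A\<^esub> r y) \<otimes>\<^bsub>K\<^esub> (b \<otimes>\<^bsub>K\<^esub> c)"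
      using b(1) c(1) r(1) xy by (simp add: K.m_ac)
    finally show "r (x \<otimes>\<^bsub>K\<^esub> y) = r x \<otimes>\<^bsub>A\<^esub> r y"
      using b c r(1) xy by (intro rI) auto
  qed
  moreover have "r (h a) = a" if "a \<in> carrier A" for a
    using that by (intro rI[of _ "\<one>\<^bsub>K\<^esub>"]) auto
  ultimately show ?thesis using h unfolding split_injective_def by blast
qed

section \<open>Operators on square-summable functions\<close>

lemma bop_apply_simps [simp]:
  "bop_apply (S + T) v = bop_apply S v + bop_apply T v"
  "bop_apply (- S) v = - bop_apply S v"
  "bop_apply (S * T) v = bop_apply S (bop_apply T v)"
  "bop_apply 0 v = 0"
  "bop_apply 1 v = v"
  "bop_apply (r *\<^sub>R S) v = r *\<^sub>R bop_apply S v"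
  by (simp_all add: bop_apply.rep_eq plus_bop.rep_eq uminus_bop.rep_eq times_bop.rep_eq zero_bop.rep_eq
      one_bop.rep_eq scaleR_bop.rep_eq plus_blinfun.rep_eq uminus_blinfun.rep_eq scaleR_blinfun.rep_eq)

lemma bop_apply_minus [simp]: "bop_apply (S - T) v = bop_apply S v - bop_apply T v"
  by (simp only: minus_bop_def bop_apply_simps) simp

lemma bop_apply_sum: "bop_apply (\<Sum>i\<in>A. T i) v = (\<Sum>i\<in>A. bop_apply (T i) v)"
  by (induction A rule: infinite_finite_induct) auto

lemma ell2_apply_simps [simp]:
  "ell2_apply (v + w) i = ell2_apply v i + ell2_apply w i"
  "ell2_apply (- v) i = - ell2_apply v i"
  "ell2_apply 0 i = 0"
  "ell2_apply (r *\<^sub>R v) i = r *\<^sub>R ell2_apply v i"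
  "ell2_apply (scaleC_ell2 c v) i = c * ell2_apply v i"
  "ell2_apply (delta j) i = (if i = j then 1 else 0)"
  by (simp_all add: plus_ell2.rep_eq uminus_ell2.rep_eq zero_ell2.rep_eq scaleR_ell2.rep_eq
      scaleC_ell2.rep_eq delta.rep_eq)

lemma ell2_apply_minus [simp]: "ell2_apply (v - w) i = ell2_apply v i - ell2_apply w i"
  by (simp only: minus_ell2_def ell2_apply_simps) simp

lemma ell2_apply_sum: "ell2_apply (\<Sum>j\<in>A. v j) i = (\<Sum>j\<in>A. ell2_apply (v j) i)"
  by (induction A rule: infinite_finite_induct) auto

lemma bop_apply_linear:
  "bop_apply T 0 = 0"
  "bop_apply T (- v) = - bop_apply T v"
  "bop_apply T (v - w) = bop_apply T v - bop_apply T w"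
  "bop_apply T (r *\<^sub>R v) = r *\<^sub>R bop_apply T v"
  "bop_apply T (\<Sum>i\<in>A. f i) = (\<Sum>i\<in>A. bop_apply T (f i))"
  unfolding bop_apply.rep_eq by (simp_all add: blinfun.bilinear_simps blinfun.sum_right)

lemma norm_bop_le:
  assumes "\<And>v. norm (bop_apply T v) \<le> C * norm v" "0 \<le> C"
  shows "norm T \<le> C"
  using assms unfolding bop_apply.rep_eq norm_bop.rep_eq by (intro norm_blinfun_bound) auto

lemma norm_bop_mult: "norm (S * T) \<le> norm S * norm (T :: 'i bop)"
  by (rule norm_bop_le)
     (auto intro!: order_trans[OF norm_bop_apply] mult_left_mono norm_bop_apply simp: mult.assoc)

lemma bounded_bilinear_bop_mult: "bounded_bilinear ((*) :: 'i bop \<Rightarrow> 'i bop \<Rightarrow> 'i bop)"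
proof
  fix S T :: "'i bop" and r :: real
  show "r *\<^sub>R S * T = r *\<^sub>R (S * T)" by (rule bop_eqI) simp
  show "S * r *\<^sub>R T = r *\<^sub>R (S * T)"
    by (rule bop_eqI) (simp add: bop_apply_linear)
  show "\<exists>K. \<forall>S T :: 'i bop. norm (S * T) \<le> norm S * norm T * K"
    by (intro exI[of _ 1] allI) (simp add: norm_bop_mult)
qed (auto simp: algebra_simps)

lemma norm_ell2_apply_le: "cmod (ell2_apply v i) \<le> norm v"
proof -
  have "(\<Sum>i\<in>{i}. (cmod (ell2_apply v i))\<^sup>2) \<le> (norm v)\<^sup>2"
    using has_sum_ell2[of v] by (rule finite_sum_le_has_sum) auto
  then show ?thesis by (simp add: power2_le_iff_abs_le)
qed

lemma norm_delta [simp]: "norm (delta i) = 1"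
proof -
  have "(norm (delta i))\<^sup>2 = (\<Sum>\<^sub>\<infinity>j. (cmod (ell2_apply (delta i) j))\<^sup>2)" by (rule norm_ell2_sq)
  also have "\<dots> = (\<Sum>\<^sub>\<infinity>j\<in>{i}. (cmod (ell2_apply (delta i) j))\<^sup>2)"
    by (rule infsum_cong_neutral) auto
  finally have "(norm (delta i))\<^sup>2 = 1" by simp
  then show ?thesis by (simp add: power2_eq_1_iff) (metis norm_ge_zero not_one_le_zero neg_0_le_iff_le)
qed

text \<open>Finitely supported functions are dense, so an operator is determined by its matrix.\<close>

lemma bop_apply_eq_zero:
  assumes "\<And>x. ell2_apply v x \<noteq> 0 \<Longrightarrow> ell2_apply (bop_apply T (delta x)) y = 0"
  shows "ell2_apply (bop_apply T v) y = 0"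
proof -
  have small: "cmod (ell2_apply (bop_apply T v) y) \<le> e" if "e > 0" for e
  proof -
    \<comment> \<open>Truncating \<open>v\<close> to \<open>F\<close> drops squared mass below
      \<open>d\<close>, so the truncation error has norm at most \<open>e / (norm T + 1)\<close>.
      The added 1 keeps the denominator positive when \<open>T\<close> is zero.\<close>
    define d where "d = (e / (norm T + 1))\<^sup>2"
    have T1: "norm T + 1 > 0" by (simp add: add_nonneg_pos)
    have "d > 0" using that T1 by (simp add: d_def)
    with has_sum_ell2[of v] have "\<forall>\<^sub>F F in finite_subsets_at_top UNIV.
        dist (\<Sum>i\<in>F. (cmod (ell2_apply v i))\<^sup>2) ((norm v)\<^sup>2) < d"
      unfolding has_sum_def by (rule tendstoD)
    then obtain F where F: "finite F" "dist (\<Sum>i\<in>F. (cmod (ell2_apply v i))\<^sup>2) ((norm v)\<^sup>2) < d"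
      unfolding eventually_finite_subsets_at_top by auto
    define w where "w = (\<Sum>x\<in>F. scaleC_ell2 (ell2_apply v x) (delta x))"
    have w: "ell2_apply w i = (if i \<in> F then ell2_apply v i else 0)" for i
      using F(1) by (simp add: w_def ell2_apply_sum if_distrib cong: if_cong)
    have "((\<lambda>i. (cmod (ell2_apply v i))\<^sup>2) has_sum ((norm v)\<^sup>2 - (\<Sum>i\<in>F. (cmod (ell2_apply v i))\<^sup>2))) (UNIV - F)"
      using F(1) by (intro has_sum_Diff has_sum_ell2 has_sum_finite) auto
    moreover have "((\<lambda>i. (cmod (ell2_apply (v - w) i))\<^sup>2) has_sum s) UNIV \<longleftrightarrow>
        ((\<lambda>i. (cmod (ell2_apply v i))\<^sup>2) has_sum s) (UNIV - F)" for s
      by (rule has_sum_cong_neutral) (auto simp: w)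
    ultimately have "(norm (v - w))\<^sup>2 = (norm v)\<^sup>2 - (\<Sum>i\<in>F. (cmod (ell2_apply v i))\<^sup>2)"
      using has_sum_ell2[of "v - w"] has_sum_unique by blast
    then have "(norm (v - w))\<^sup>2 < d" using F(2) by (simp add: dist_real_def abs_less_iff)
    moreover have "0 \<le> e / (norm T + 1)" using that T1 by simp
    ultimately have vw: "norm (v - w) \<le> e / (norm T + 1)"
      unfolding d_def by (meson less_imp_le power2_le_imp_le)
    have "ell2_apply (bop_apply T w) y = 0"
      unfolding w_def bop_apply_linear bop_apply_scaleC ell2_apply_sum
      by (rule sum.neutral) (use assms in auto)
    then have "cmod (ell2_apply (bop_apply T v) y) = cmod (ell2_apply (bop_apply T (v - w)) y)"
      by (simp add: bop_apply_linear)
    also have "\<dots> \<le> norm (bop_apply T (v - w))" by (rule norm_ell2_apply_le)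
    also have "\<dots> \<le> norm T * norm (v - w)" by (rule norm_bop_apply)
    also have "\<dots> \<le> (norm T + 1) * (e / (norm T + 1))" using T1 vw by (intro mult_mono) auto
    finally show ?thesis using T1 by simp
  qed
  have "cmod (ell2_apply (bop_apply T v) y) \<le> 0"
  proof (rule field_le_epsilon)
    fix e :: real assume "0 < e"
    then show "cmod (ell2_apply (bop_apply T v) y) \<le> 0 + e" using small[of e] by simp
  qed
  then show ?thesis by simp
qed

lemma bop_eq_deltaI:
  assumes "\<And>x y. ell2_apply (bop_apply S (delta x)) y = ell2_apply (bop_apply T (delta x)) y"
  shows "S = T"
proof (intro bop_eqI ell2_eqI)
  fix v i
  have "ell2_apply (bop_apply (S - T) v) i = 0"
    by (rule bop_apply_eq_zero) (simp add: assms)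
  then show "ell2_apply (bop_apply S v) i = ell2_apply (bop_apply T v) i" by simp
qed

subsection \<open>Adjoints\<close>

lemma summable_cinner: "(\<lambda>i. ell2_apply x i * cnj (ell2_apply y i)) summable_on UNIV"
  by (rule abs_summable_summable[OF abs_summable_ell2_mult])

lemma cinner_simps:
  "cinner (x + y) z = cinner x z + cinner y z"
  "cinner z (x + y) = cinner z x + cinner z y"
  "cinner (- x) z = - cinner x z"
  "cinner z (- x) = - cinner z x"
  "cinner 0 z = 0" "cinner z 0 = 0"
  unfolding cinner_def
  by (simp_all add: infsum_add[symmetric] infsum_uminus summable_cinner distrib_left distrib_right)

lemma cinner_commute: "cinner y x = cnj (cinner x y)"
  unfolding cinner_def infsum_cnj[symmetric] by (simp add: mult.commute)

lemma cinner_delta: "cinner v (delta i) = ell2_apply v i" "cinner (delta i) v = cnj (ell2_apply v i)"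
proof -
  show *: "cinner v (delta i) = ell2_apply v i" for v
  proof -
    have "cinner v (delta i) = (\<Sum>\<^sub>\<infinity>j\<in>{i}. ell2_apply v j * cnj (ell2_apply (delta i) j))"
      unfolding cinner_def by (rule infsum_cong_neutral) auto
    then show ?thesis by simp
  qed
  show "cinner (delta i) v = cnj (ell2_apply v i)" by (simp add: cinner_commute[of "delta i"] *)
qed

lemma Re_cinner: "Re (cinner x y) = inner x y"
proof -
  have "((\<lambda>i. Re (ell2_apply x i * cnj (ell2_apply y i))) has_sum Re (cinner x y)) UNIV"
    unfolding cinner_def by (rule has_sum_Re[OF has_sum_infsum[OF summable_cinner]])
  then show ?thesis
    unfolding inner_ell2_def by (simp add: infsumI inner_complex_def)
qed

lemma is_adjoint_commute: "is_adjoint S T \<Longrightarrow> is_adjoint T S"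
  unfolding is_adjoint_def by (metis cinner_commute)

lemma is_adjoint_simps:
  "is_adjoint 0 0" "is_adjoint 1 1"
  "is_adjoint S T \<Longrightarrow> is_adjoint S' T' \<Longrightarrow> is_adjoint (S + S') (T + T')"
  "is_adjoint S T \<Longrightarrow> is_adjoint (- S) (- T)"
  "is_adjoint S T \<Longrightarrow> is_adjoint S' T' \<Longrightarrow> is_adjoint (S * S') (T' * T)"
  unfolding is_adjoint_def by (simp_all add: cinner_simps)

lemma is_adjoint_minus:
  "is_adjoint S T \<Longrightarrow> is_adjoint S' T' \<Longrightarrow> is_adjoint (S - S') (T - T')"
  unfolding minus_bop_def by (intro is_adjoint_simps)

lemma is_adjoint_sum:
  "(\<And>i. i \<in> A \<Longrightarrow> is_adjoint (S i) (T i)) \<Longrightarrow> is_adjoint (\<Sum>i\<in>A. S i) (\<Sum>i\<in>A. T i)"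
  by (induction A rule: infinite_finite_induct) (auto intro: is_adjoint_simps)

lemma is_adjoint_unique:
  assumes "is_adjoint S T" "is_adjoint S' T"
  shows "S = S'"
proof (rule bop_eq_deltaI)
  fix x y
  show "ell2_apply (bop_apply S (delta x)) y = ell2_apply (bop_apply S' (delta x)) y"
    using assms unfolding is_adjoint_def cinner_delta(1)[symmetric] by simp
qed

text \<open>For \<open>w = S v\<close>, the square of the norm of \<open>w\<close> is the inner
  product of \<open>v\<close> with \<open>T w\<close>. The estimate makes adjoints of approximants
  approximate the adjoint, so a norm closure inherits closure under adjoints.\<close>

lemma norm_adjoint_le:
  assumes "is_adjoint S T"
  shows "norm S \<le> norm T"
proof (rule norm_bop_le)
  fix v
  let ?w = "bop_apply S v"
  have "norm ?w * norm ?w = Re (cinner ?w ?w)"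
    by (simp add: Re_cinner power2_eq_square[symmetric] power2_norm_eq_inner)
  also have "\<dots> = inner v (bop_apply T ?w)"
    using assms by (simp add: is_adjoint_def Re_cinner)
  also have "\<dots> \<le> norm v * norm (bop_apply T ?w)" by (rule norm_cauchy_schwarz)
  also have "\<dots> \<le> norm v * (norm T * norm ?w)" by (intro mult_left_mono norm_bop_apply) simp
  finally have "norm ?w * norm ?w \<le> (norm T * norm v) * norm ?w" by (simp add: mult_ac)
  then show "norm ?w \<le> norm T * norm v"
    by (cases "norm ?w = 0") (auto simp: mult_le_cancel_right simp del: norm_eq_zero)
qed simp

subsection \<open>Multiplication and partial translation operators\<close>

text \<open>A weighted partial translation. The description determines an operator when
  \<open>f\<close> is bounded and \<sigma> is injective on the support of \<open>f\<close>.\<close>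

definition partial_shift :: "('i \<Rightarrow> complex) \<Rightarrow> ('i \<Rightarrow> 'i) \<Rightarrow> 'i bop" where
  "partial_shift f \<sigma> = (THE T. \<forall>v i. ell2_apply (bop_apply T v) i = f i * ell2_apply v (\<sigma> i))"

text \<open>Injectivity on the support of \<open>f\<close> means that each coordinate of
  \<open>v\<close> is read at most once with nonzero weight, so a bound for \<open>f\<close> bounds
  the operator.\<close>

lemma partial_shift_apply:
  assumes f: "bounded (range f)" and inj: "inj_on \<sigma> {i. f i \<noteq> 0}"
  shows "ell2_apply (bop_apply (partial_shift f \<sigma>) v) i = f i * ell2_apply v (\<sigma> i)"
proof -
  define F where "F = (\<lambda>v. Abs_ell2 (\<lambda>i. f i * ell2_apply v (\<sigma> i)))"
  obtain C where C: "\<And>i. cmod (f i) \<le> C" using f by (auto simp: bounded_iff)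
  have C0: "0 \<le> C" using C norm_ge_zero order_trans by blast
  let ?g = "\<lambda>v i. if f i = 0 then 0 else (cmod (ell2_apply v (\<sigma> i)))\<^sup>2"
  have sum: "\<exists>s. (?g v has_sum s) UNIV \<and> s \<le> (norm v)\<^sup>2" for v
  proof -
    have "(\<lambda>j. (cmod (ell2_apply v j))\<^sup>2) summable_on \<sigma> ` {i. f i \<noteq> 0}"
      by (rule summable_on_subset_banach[OF summable_ell2]) simp
    then obtain s where s: "((\<lambda>j. (cmod (ell2_apply v j))\<^sup>2) has_sum s) (\<sigma> ` {i. f i \<noteq> 0})"
      unfolding summable_on_def by blast
    have "s \<le> (norm v)\<^sup>2"
      by (rule has_sum_mono2[OF s has_sum_ell2]) auto
    moreover have "((\<lambda>i. (cmod (ell2_apply v (\<sigma> i)))\<^sup>2) has_sum s) {i. f i \<noteq> 0}"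
      using s by (subst (asm) has_sum_reindex[OF inj]) (simp add: o_def)
    then have "(?g v has_sum s) UNIV"
      by (subst has_sum_cong_neutral[where T = "{i. f i \<noteq> 0}" and g = "\<lambda>i. (cmod (ell2_apply v (\<sigma> i)))\<^sup>2"]) auto
    ultimately show ?thesis by blast
  qed
  have le: "(cmod (f i * ell2_apply v (\<sigma> i)))\<^sup>2 \<le> C\<^sup>2 * ?g v i" for v i
    using C[of i] by (auto simp: norm_mult power_mult_distrib intro!: mult_right_mono power_mono)
  have summ: "(\<lambda>i. C\<^sup>2 * ?g v i) summable_on UNIV" for v
    using sum[of v] by (intro summable_on_cmult_right) (auto simp: summable_on_def)
  have F: "ell2_apply (F v) i = f i * ell2_apply v (\<sigma> i)" for v i
    unfolding F_def
    by (subst Abs_ell2_inverse) (auto intro!: ell2_comparison[OF summ _ le])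
  have "\<exists>T. bop_apply T = F"
  proof (rule bop_of_function)
    show "norm (F v) \<le> norm v * C" for v
    proof -
      obtain s where s: "(?g v has_sum s) UNIV" "s \<le> (norm v)\<^sup>2" using sum by blast
      have "(norm (F v))\<^sup>2 \<le> C\<^sup>2 * s"
        by (rule has_sum_mono[OF has_sum_ell2 has_sum_cmult_right[OF s(1)]]) (simp only: F le)
      also have "\<dots> \<le> C\<^sup>2 * (norm v)\<^sup>2" using s(2) by (intro mult_left_mono) auto
      finally have "(norm (F v))\<^sup>2 \<le> (norm v * C)\<^sup>2" by (simp add: power_mult_distrib mult.commute)
      then show ?thesis by (rule power2_le_imp_le) (simp add: C0)
    qed
  qed (auto intro!: ell2_eqI simp: F algebra_simps)
  from the_bop[OF this] show ?thesis by (simp add: F partial_shift_def)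
qed

lemma mult_op_delta:
  "bounded (range f) \<Longrightarrow> ell2_apply (bop_apply (mult_op f) (delta x)) y = (if y = x then f x else 0)"
  by (auto simp: mult_op_apply)

lemma mult_op_simps:
  assumes "bounded (range f)" "bounded (range g)"
  shows "mult_op f + mult_op g = mult_op (\<lambda>x. f x + g x)"
    and "mult_op f * mult_op g = mult_op (\<lambda>x. f x * g x)"
    and "- mult_op f = mult_op (\<lambda>x. - f x)"
    and "is_adjoint (mult_op (\<lambda>x. cnj (f x))) (mult_op f)"
proof -
  obtain C D where C: "\<And>x. cmod (f x) \<le> C" and D: "\<And>x. cmod (g x) \<le> D"
    using assms by (auto simp: bounded_iff)
  have b: "bounded (range (\<lambda>x. f x + g x))" "bounded (range (\<lambda>x. f x * g x))"
    "bounded (range (\<lambda>x. - f x))" "bounded (range (\<lambda>x. cnj (f x)))"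
  proof -
    show "bounded (range (\<lambda>x. f x + g x))"
      using C D by (auto simp: bounded_iff intro!: exI[of _ "C + D"] norm_triangle_mono)
    have "cmod (f x * g x) \<le> C * D" for x
      using C[of x] D[of x] by (simp add: norm_mult) (meson mult_mono norm_ge_zero order_trans)
    then show "bounded (range (\<lambda>x. f x * g x))" by (auto simp: bounded_iff)
    show "bounded (range (\<lambda>x. - f x))" "bounded (range (\<lambda>x. cnj (f x)))"
      using C by (auto simp: bounded_iff)
  qed
  show "mult_op f + mult_op g = mult_op (\<lambda>x. f x + g x)"
    "mult_op f * mult_op g = mult_op (\<lambda>x. f x * g x)"
    "- mult_op f = mult_op (\<lambda>x. - f x)"
    by (intro bop_eqI ell2_eqI; simp add: mult_op_apply assms b algebra_simps)+
  show "is_adjoint (mult_op (\<lambda>x. cnj (f x))) (mult_op f)"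
    unfolding is_adjoint_def cinner_def by (simp add: mult_op_apply assms b mult_ac)
qed

lemma mult_op_const: "mult_op (\<lambda>_. 0) = 0" "mult_op (\<lambda>_. 1) = 1"
proof -
  have "bounded (range (\<lambda>_::'i. c))" for c :: complex by (auto simp: bounded_iff)
  then show "mult_op (\<lambda>_::'i. 0) = 0" "mult_op (\<lambda>_::'i. 1) = 1"
    by (intro bop_eqI ell2_eqI; simp add: mult_op_apply)+
qed

text \<open>The adjoint is written down: it is the inverse partial translation with conjugate
  weights.\<close>

lemma partial_shift_adjoint:
  assumes f: "bounded (range f)" and inj: "inj_on \<sigma> {i. f i \<noteq> 0}"
  shows "\<exists>S. is_adjoint S (partial_shift f \<sigma>)"
proof -
  let ?A = "{i. f i \<noteq> 0}"
  define \<sigma>' where "\<sigma>' = inv_into ?A \<sigma>"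
  define f' where "f' = (\<lambda>j. if j \<in> \<sigma> ` ?A then cnj (f (\<sigma>' j)) else 0)"
  obtain C where C: "\<And>i. cmod (f i) \<le> C" using f by (auto simp: bounded_iff)
  then have C0: "0 \<le> C" using norm_ge_zero order_trans by blast
  have "cmod (f' j) \<le> C" for j using C C0 by (simp add: f'_def)
  then have f': "bounded (range f')" unfolding bounded_iff by auto
  have "inj_on \<sigma>' (\<sigma> ` ?A)" unfolding \<sigma>'_def by (rule inj_on_inv_into) simp
  then have inj': "inj_on \<sigma>' {j. f' j \<noteq> 0}"
    by (rule inj_on_subset) (auto simp: f'_def)
  have \<sigma>'\<sigma>: "\<sigma>' (\<sigma> i) = i" if "f i \<noteq> 0" for i
    unfolding \<sigma>'_def using inj that by simp
  have "is_adjoint (partial_shift f' \<sigma>') (partial_shift f \<sigma>)"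
    unfolding is_adjoint_def
  proof (intro allI)
    fix x y
    let ?g = "\<lambda>j. f' j * ell2_apply x (\<sigma>' j) * cnj (ell2_apply y j)"
    have "cinner (bop_apply (partial_shift f' \<sigma>') x) y = infsum ?g UNIV"
      unfolding cinner_def by (simp add: partial_shift_apply[OF f' inj'])
    also have "\<dots> = infsum ?g (\<sigma> ` ?A)"
      by (rule infsum_cong_neutral) (auto simp: f'_def)
    also have "\<dots> = infsum (?g \<circ> \<sigma>) ?A"
      by (rule infsum_reindex[OF inj])
    also have "\<dots> = infsum (\<lambda>i. ell2_apply x i * cnj (f i * ell2_apply y (\<sigma> i))) UNIV"
    proof (rule infsum_cong_neutral)
      fix i assume "i \<in> ?A \<inter> UNIV"
      then show "(?g \<circ> \<sigma>) i = ell2_apply x i * cnj (f i * ell2_apply y (\<sigma> i))"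
        by (auto simp: f'_def \<sigma>'\<sigma>)
    qed auto
    also have "\<dots> = cinner x (bop_apply (partial_shift f \<sigma>) y)"
      unfolding cinner_def by (simp add: partial_shift_apply[OF f inj])
    finally show "cinner (bop_apply (partial_shift f' \<sigma>') x) y = cinner x (bop_apply (partial_shift f \<sigma>) y)" .
  qed
  then show ?thesis by blast
qed

lemma is_adjoint_delta:
  assumes "is_adjoint S T"
  shows "ell2_apply (bop_apply S (delta x)) y = cnj (ell2_apply (bop_apply T (delta y)) x)"
proof -
  have "cinner (bop_apply S (delta x)) (delta y) = cinner (delta x) (bop_apply T (delta y))"
    using assms by (simp add: is_adjoint_def)
  then show ?thesis by (simp add: cinner_delta)
qed

text \<open>The axioms are purely algebraic because the group structure of \<open>K0\<close> comes
  from explicit matrix identities. Adjoints form a relation, so closure under them is stated for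
  every adjoint pair.\<close>

locale star_algebra =
  fixes A :: "'i bop set"
  assumes zero_closed: "0 \<in> A"
    and one_closed: "1 \<in> A"
    and plus_closed: "S \<in> A \<Longrightarrow> T \<in> A \<Longrightarrow> S + T \<in> A"
    and uminus_closed: "S \<in> A \<Longrightarrow> - S \<in> A"
    and mult_closed: "S \<in> A \<Longrightarrow> T \<in> A \<Longrightarrow> S * T \<in> A"
    and adjoint_closed: "is_adjoint S T \<Longrightarrow> T \<in> A \<Longrightarrow> S \<in> A"
begin

lemma minus_closed: "S \<in> A \<Longrightarrow> T \<in> A \<Longrightarrow> S - T \<in> A"
  unfolding minus_bop_def by (intro plus_closed uminus_closed)

lemma sum_closed: "(\<And>i. i \<in> I \<Longrightarrow> T i \<in> A) \<Longrightarrow> (\<Sum>i\<in>I. T i) \<in> A"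
  by (induction I rule: infinite_finite_induct) (auto simp: zero_closed plus_closed)

end

lemma star_algebra_linf: "star_algebra (linf_algebra :: 'i bop set)"
proof
  show "0 \<in> (linf_algebra :: 'i bop set)"
    unfolding linf_algebra_def mult_op_const(1)[symmetric] by (intro imageI CollectI) (auto simp: bounded_iff)
  show "1 \<in> (linf_algebra :: 'i bop set)"
    unfolding linf_algebra_def mult_op_const(2)[symmetric] by (intro imageI CollectI) (auto simp: bounded_iff)
next
  fix S T :: "'i bop"
  assume "S \<in> linf_algebra" "T \<in> linf_algebra"
  then obtain f g where f: "bounded (range f)" "S = mult_op f" and g: "bounded (range g)" "T = mult_op g"
    unfolding linf_algebra_def by auto
  obtain C D where CD: "\<And>x. cmod (f x) \<le> C" "\<And>x. cmod (g x) \<le> D"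
    using f(1) g(1) unfolding bounded_iff by auto
  have "bounded (range (\<lambda>x. f x + g x))"
    using CD unfolding bounded_iff by (auto intro!: exI[of _ "C + D"] norm_triangle_mono)
  then show "S + T \<in> linf_algebra"
    unfolding f(2) g(2) mult_op_simps(1)[OF f(1) g(1)] linf_algebra_def by blast
  have "cmod (f x * g x) \<le> C * D" for x
    unfolding norm_mult using CD[of x] by (meson mult_mono norm_ge_zero order_trans)
  then have "bounded (range (\<lambda>x. f x * g x))" unfolding bounded_iff by auto
  then show "S * T \<in> linf_algebra"
    unfolding f(2) g(2) mult_op_simps(2)[OF f(1) g(1)] linf_algebra_def by blast
next
  fix S :: "'i bop"
  assume "S \<in> linf_algebra"
  then obtain f where f: "bounded (range f)" "S = mult_op f" unfolding linf_algebra_def by auto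
  have "bounded (range (\<lambda>x. - f x))" using f(1) unfolding bounded_iff by auto
  then show "- S \<in> linf_algebra"
    unfolding f(2) mult_op_simps(3)[OF f(1) f(1)] linf_algebra_def by blast
next
  fix S T :: "'i bop"
  assume S: "is_adjoint S T" and "T \<in> linf_algebra"
  then obtain f where f: "bounded (range f)" "T = mult_op f" unfolding linf_algebra_def by auto
  have "bounded (range (\<lambda>x. cnj (f x)))" using f(1) unfolding bounded_iff by auto
  moreover have "S = mult_op (\<lambda>x. cnj (f x))"
    using is_adjoint_unique[OF S] mult_op_simps(4)[OF f(1) f(1)] f(2) by simp
  ultimately show "S \<in> linf_algebra" unfolding linf_algebra_def by blast
qed

section \<open>Finite propagation and the uniform Roe algebra\<close>

context finitely_generated_group begin

definition propagation_le :: "nat \<Rightarrow> 'g bop \<Rightarrow> bool" where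
  "propagation_le R T \<longleftrightarrow> (\<forall>x y. ell2_apply (bop_apply T (delta x)) y \<noteq> 0 \<longrightarrow> word_dist S x y \<le> R)"

definition finite_propagation :: "'g bop set" where
  "finite_propagation = {T. \<exists>R. propagation_le R T}"

lemma propagation_le_mono: "propagation_le R T \<Longrightarrow> R \<le> R' \<Longrightarrow> propagation_le R' T"
  unfolding propagation_le_def using order_trans by blast

lemma uniform_Roe_algebra_eq: "uniform_Roe_algebra S = closure finite_propagation"
proof -
  have "bdd_above {word_dist S x y | x y. cinner (bop_apply T (delta x)) (delta y) \<noteq> 0} \<longleftrightarrow> (\<exists>R. propagation_le R T)" for T
    unfolding propagation_le_def bdd_above_def cinner_delta by auto
  then show ?thesis unfolding uniform_Roe_algebra_def finite_propagation_def by simp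
qed

lemma propagation_le_apply:
  assumes T: "propagation_le R T"
  shows "bop_apply T (delta x) = (\<Sum>y\<in>nbhd R {x}. scaleC_ell2 (ell2_apply (bop_apply T (delta x)) y) (delta y))"
proof (rule ell2_eqI)
  fix i
  have "ell2_apply (bop_apply T (delta x)) i = 0" if "i \<notin> nbhd R {x}"
    using T that unfolding propagation_le_def nbhd_def by auto
  then show "ell2_apply (bop_apply T (delta x)) i =
      ell2_apply (\<Sum>y\<in>nbhd R {x}. scaleC_ell2 (ell2_apply (bop_apply T (delta x)) y) (delta y)) i"
    by (simp add: ell2_apply_sum if_distrib finite_nbhd cong: if_cong)
qed

lemma propagation_le_mult:
  assumes U: "propagation_le R U" and T: "propagation_le R' T"
  shows "propagation_le (R' + R) (U * T)"
  unfolding propagation_le_def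
proof (intro allI impI)
  fix x y assume nz: "ell2_apply (bop_apply (U * T) (delta x)) y \<noteq> 0"
  have "ell2_apply (bop_apply (U * T) (delta x)) y = (\<Sum>z\<in>nbhd R' {x}. ell2_apply (bop_apply T (delta x)) z * ell2_apply (bop_apply U (delta z)) y)"
    unfolding bop_apply_simps by (subst propagation_le_apply[OF T])
      (simp add: bop_apply_linear bop_apply_scaleC ell2_apply_sum)
  with nz obtain z where z: "z \<in> nbhd R' {x}" "ell2_apply (bop_apply U (delta z)) y \<noteq> 0"
    by (metis (no_types, lifting) mult_zero_right sum.neutral)
  then have "word_dist S x z \<le> R'" "word_dist S z y \<le> R" using U by (auto simp: nbhd_def propagation_le_def)
  then show "word_dist S x y \<le> R' + R" using word_dist_triangle[of x y z] by linarith
qed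

lemma propagation_le_partial_shift:
  assumes f: "bounded (range f)" and inj: "inj_on \<sigma> {i. f i \<noteq> 0}"
    and R: "\<And>i. f i \<noteq> 0 \<Longrightarrow> word_dist S (\<sigma> i) i \<le> R"
  shows "propagation_le R (partial_shift f \<sigma>)"
  unfolding propagation_le_def using R by (auto simp: partial_shift_apply[OF f inj] split: if_splits)

text \<open>The matrix is split into its diagonals, the entries between \<open>y + t\<close> and
  \<open>y\<close> for fixed \<open>t\<close>; propagation \<open>R\<close> leaves the finitely many
  \<open>t\<close> of length at most \<open>R\<close>. Adjoints are then built term by term, and
  \<open>amplify\<close> sends each term to a generator of the crossed product.\<close>

lemma propagation_le_decomposition:
  assumes T: "propagation_le R T"
  shows "T = (\<Sum>t | word_length S t \<le> R. partial_shift (\<lambda>y. ell2_apply (bop_apply T (delta (y + t))) y) (\<lambda>y. y + t))"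
    (is "_ = (\<Sum>t | _. partial_shift (?f t) _)")
    and "bounded (range (\<lambda>y. ell2_apply (bop_apply T (delta (y + t))) y))"
proof -
  show b: "bounded (range (?f t))" for t
  proof -
    have "cmod (?f t y) \<le> norm T" for y
      using norm_ell2_apply_le[of "bop_apply T (delta (y + t))" y] norm_bop_apply[of T "delta (y + t)"] by simp
    then show ?thesis unfolding bounded_iff by auto
  qed
  have app: "ell2_apply (bop_apply (partial_shift (?f t) (\<lambda>y. y + t)) v) y = ?f t y * ell2_apply v (y + t)" for t v y
    by (rule partial_shift_apply[OF b]) (simp add: inj_on_def)
  show "T = (\<Sum>t | word_length S t \<le> R. partial_shift (?f t) (\<lambda>y. y + t))"
  proof (rule bop_eq_deltaI)
    fix x y
    have "ell2_apply (bop_apply (\<Sum>t | word_length S t \<le> R. partial_shift (?f t) (\<lambda>y. y + t)) (delta x)) y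
      = (\<Sum>t | word_length S t \<le> R. if t = - y + x then ell2_apply (bop_apply T (delta x)) y else 0)"
      unfolding bop_apply_sum ell2_apply_sum app
      by (intro sum.cong refl) (auto simp: add.assoc[symmetric])
    also have "\<dots> = ell2_apply (bop_apply T (delta x)) y"
      using T[unfolded propagation_le_def, rule_format, of x y] word_dist_commute[of x y]
      by (auto simp: finite_word_length word_dist_def)
    finally show "ell2_apply (bop_apply T (delta x)) y
      = ell2_apply (bop_apply (\<Sum>t | word_length S t \<le> R. partial_shift (?f t) (\<lambda>y. y + t)) (delta x)) y" by simp
  qed
qed

lemma propagation_le_adjoint:
  assumes T: "propagation_le R T"
  shows "\<exists>U. is_adjoint U T \<and> propagation_le R U"
proof -
  let ?f = "\<lambda>t y. ell2_apply (bop_apply T (delta (y + t))) y"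
  have "\<exists>U. is_adjoint U (partial_shift (?f t) (\<lambda>y. y + t))" for t
    by (rule partial_shift_adjoint[OF propagation_le_decomposition(2)[OF T]]) (simp add: inj_on_def)
  then have "\<forall>t. \<exists>U. is_adjoint U (partial_shift (?f t) (\<lambda>y. y + t))" ..
  from choice[OF this] obtain U where U: "\<And>t. is_adjoint (U t) (partial_shift (?f t) (\<lambda>y. y + t))" by auto
  have "is_adjoint (\<Sum>t | word_length S t \<le> R. U t) T"
    by (subst propagation_le_decomposition(1)[OF T]) (rule is_adjoint_sum[OF U])
  moreover have "propagation_le R V" if "is_adjoint V T" for V
    unfolding propagation_le_def
  proof (intro allI impI)
    fix x y assume "ell2_apply (bop_apply V (delta x)) y \<noteq> 0"
    then have "ell2_apply (bop_apply T (delta y)) x \<noteq> 0" by (simp add: is_adjoint_delta[OF that])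
    then show "word_dist S x y \<le> R" using T unfolding propagation_le_def word_dist_commute[of x y] by blast
  qed
  ultimately show ?thesis by metis
qed

lemma star_algebra_uniform_Roe: "star_algebra (uniform_Roe_algebra S)"
proof
  have id: "propagation_le 0 1" "propagation_le 0 0"
    unfolding propagation_le_def by (auto simp: word_dist_self split: if_splits)
  then have "0 \<in> finite_propagation" "1 \<in> finite_propagation" unfolding finite_propagation_def by auto
  then show "0 \<in> uniform_Roe_algebra S" "1 \<in> uniform_Roe_algebra S"
    unfolding uniform_Roe_algebra_eq using closure_subset[of finite_propagation] by auto
next
  fix T U assume "T \<in> uniform_Roe_algebra S" "U \<in> uniform_Roe_algebra S"
  then obtain t u where t: "\<And>n. t n \<in> finite_propagation" "t \<longlonglongrightarrow> T" and u: "\<And>n. u n \<in> finite_propagation" "u \<longlonglongrightarrow> U"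
    unfolding uniform_Roe_algebra_eq closure_sequential by blast
  have "t n + u n \<in> finite_propagation" "t n * u n \<in> finite_propagation" for n
  proof -
    obtain R R' where R: "propagation_le R (t n)" "propagation_le R' (u n)"
      using t(1)[of n] u(1)[of n] unfolding finite_propagation_def by blast
    have "word_dist S x y \<le> max R R'" if "ell2_apply (bop_apply (t n + u n) (delta x)) y \<noteq> 0" for x y
    proof -
      have "ell2_apply (bop_apply (t n) (delta x)) y \<noteq> 0 \<or> ell2_apply (bop_apply (u n) (delta x)) y \<noteq> 0"
        using that by auto
      then show ?thesis using R unfolding propagation_le_def by (meson max.coboundedI1 max.coboundedI2)
    qed
    then show "t n + u n \<in> finite_propagation" unfolding finite_propagation_def propagation_le_def by blast
    show "t n * u n \<in> finite_propagation"
      using propagation_le_mult[OF R] unfolding finite_propagation_def by blast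
  qed
  moreover have "(\<lambda>n. t n + u n) \<longlonglongrightarrow> T + U" by (intro tendsto_add t u)
  moreover have "(\<lambda>n. t n * u n) \<longlonglongrightarrow> T * U" by (rule bounded_bilinear.tendsto[OF bounded_bilinear_bop_mult t(2) u(2)])
  ultimately show "T + U \<in> uniform_Roe_algebra S" "T * U \<in> uniform_Roe_algebra S"
    unfolding uniform_Roe_algebra_eq closure_sequential by (metis (no_types, lifting))+
next
  fix T assume "T \<in> uniform_Roe_algebra S"
  then obtain t where t: "\<And>n. t n \<in> finite_propagation" "t \<longlonglongrightarrow> T"
    unfolding uniform_Roe_algebra_eq closure_sequential by blast
  have "- t n \<in> finite_propagation" for n
    using t(1)[of n] unfolding finite_propagation_def propagation_le_def by simp
  moreover have "(\<lambda>n. - t n) \<longlonglongrightarrow> - T" by (intro tendsto_minus t)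
  ultimately show "- T \<in> uniform_Roe_algebra S"
    unfolding uniform_Roe_algebra_eq closure_sequential by (metis (no_types, lifting))
next
  fix U T assume U: "is_adjoint U T" and T: "T \<in> uniform_Roe_algebra S"
  show "U \<in> uniform_Roe_algebra S"
    unfolding uniform_Roe_algebra_eq closure_approachable
  proof (intro allI impI)
    fix e :: real assume "e > 0"
    then obtain T' where T': "T' \<in> finite_propagation" "dist T' T < e"
      using T unfolding uniform_Roe_algebra_eq closure_approachable by blast
    then obtain R where "propagation_le R T'" unfolding finite_propagation_def by auto
    from propagation_le_adjoint[OF this] obtain U' where U': "is_adjoint U' T'" "propagation_le R U'" by blast
    then have "U' \<in> finite_propagation" unfolding finite_propagation_def by auto
    have "dist U' U \<le> dist T' T"
      unfolding dist_norm by (intro norm_adjoint_le is_adjoint_minus U U')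
    then show "\<exists>y\<in>finite_propagation. dist y U < e" using \<open>U' \<in> finite_propagation\<close> T'(2) by (intro bexI[of _ U']) auto
  qed
qed

lemma partial_shift_in_uniform_Roe:
  assumes "bounded (range f)" "inj_on \<sigma> {i. f i \<noteq> 0}"
    and "\<And>i. f i \<noteq> 0 \<Longrightarrow> word_dist S (\<sigma> i) i \<le> R"
  shows "partial_shift f \<sigma> \<in> uniform_Roe_algebra S"
proof -
  have "partial_shift f \<sigma> \<in> finite_propagation"
    using propagation_le_partial_shift[OF assms] unfolding finite_propagation_def by auto
  then show ?thesis unfolding uniform_Roe_algebra_eq using closure_subset[of finite_propagation] by auto
qed

lemma linf_subset_uniform_Roe: "linf_algebra \<subseteq> uniform_Roe_algebra S"
proof
  fix T :: "'g bop" assume "T \<in> linf_algebra"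
  then obtain f where f: "bounded (range f)" "T = mult_op f" unfolding linf_algebra_def by auto
  have "propagation_le 0 T"
    unfolding propagation_le_def f(2) by (auto simp: mult_op_delta[OF f(1)] word_dist_self split: if_splits)
  then have "T \<in> finite_propagation" unfolding finite_propagation_def by auto
  then show "T \<in> uniform_Roe_algebra S"
    unfolding uniform_Roe_algebra_eq using closure_subset[of finite_propagation] by auto
qed

end

section \<open>The reduced crossed product is the amplified uniform Roe algebra\<close>

lemma fibre_simps [simp]:
  "fibre x (v + w) = fibre x v + fibre x w"
  "fibre x (v - w) = fibre x v - fibre x w"
  "fibre x (- v) = - fibre x v"
  "fibre x 0 = 0"
  "fibre x (r *\<^sub>R v) = r *\<^sub>R fibre x v"
  "fibre x (scaleC_ell2 c v) = scaleC_ell2 c (fibre x v)"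
  by (intro ell2_eqI; simp add: fibre.rep_eq)+

lemma ell2_eq_fibreI:
  fixes v w :: "('g::group_add \<times> 'g) ell2"
  assumes "\<And>x. fibre x v = fibre x w"
  shows "v = w"
proof (rule ell2_eqI)
  fix p :: "'g \<times> 'g"
  obtain s x where p: "p = (s, x)" by fastforce
  have "ell2_apply (fibre x v) (x - s) = ell2_apply (fibre x w) (x - s)" using assms by simp
  moreover have "- (x - s) + x = s" by (simp add: minus_diff_eq)
  ultimately show "ell2_apply v p = ell2_apply w p" by (simp only: fibre.rep_eq p)
qed

lemma norm_fibre_le: "norm (fibre x v) \<le> norm v"
proof -
  have "(\<Sum>x\<in>{x}. (norm (fibre x v))\<^sup>2) \<le> (norm v)\<^sup>2"
    using has_sum_fibres[of v] by (rule finite_sum_le_has_sum) auto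
  then show ?thesis by (simp add: power2_le_iff_abs_le)
qed

lemma fibre_amplify [simp]: "fibre x (bop_apply (amplify T) v) = bop_apply T (fibre x v)"
proof (rule ell2_eqI)
  fix y
  have "x - (- y + x) = y" by (metis add.inverse_inverse add_diff_cancel diff_eq_eq minus_add_cancel)
  then show "ell2_apply (fibre x (bop_apply (amplify T) v)) y = ell2_apply (bop_apply T (fibre x v)) y"
    unfolding fibre.rep_eq amplify_apply by simp
qed

lemma amplify_simps:
  "amplify (T + U) = amplify T + amplify U"
  "amplify (- T) = - amplify T"
  "amplify (T * U) = amplify T * amplify U"
  "amplify 0 = 0"
  "amplify 1 = 1"
  "amplify (r *\<^sub>R T) = r *\<^sub>R amplify T"
  by (intro bop_eqI ell2_eq_fibreI; simp)+

lemma norm_amplify_le: "norm (amplify T) \<le> norm T"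
proof (rule norm_bop_le)
  fix v
  have "(norm (bop_apply (amplify T) v))\<^sup>2 \<le> (norm T)\<^sup>2 * (norm v)\<^sup>2"
  proof (rule has_sum_mono[OF has_sum_fibres has_sum_cmult_right[OF has_sum_fibres]])
    fix x
    show "(norm (fibre x (bop_apply (amplify T) v)))\<^sup>2 \<le> (norm T)\<^sup>2 * (norm (fibre x v))\<^sup>2"
      using power_mono[OF norm_bop_apply norm_ge_zero, of T "fibre x v" 2] by (simp add: power_mult_distrib)
  qed
  then have "(norm (bop_apply (amplify T) v))\<^sup>2 \<le> (norm T * norm v)\<^sup>2" by (simp add: power_mult_distrib)
  then show "norm (bop_apply (amplify T) v) \<le> norm T * norm v" by (rule power2_le_imp_le) simp
qed simp

lemma cinner_fibres: "cinner v w = (\<Sum>\<^sub>\<infinity>x. cinner (fibre x v) (fibre x w))"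
proof -
  let ?h = "\<lambda>p. ell2_apply v p * cnj (ell2_apply w p)"
  let ?b = "\<lambda>p. case p of (x, y) \<Rightarrow> (- y + x, x)"
  have "(\<lambda>p. ?h (?b p)) summable_on UNIV"
    using summable_cinner[of v w] by (subst summable_on_reindex_bij_betw[OF bij_betw_fibres])
  then have s: "(\<lambda>(x, y). ?h (- y + x, x)) summable_on (SIGMA x:UNIV. UNIV)"
    by (simp add: case_prod_unfold)
  have "cinner v w = infsum ?h UNIV" by (simp add: cinner_def)
  also have "\<dots> = infsum (\<lambda>p. ?h (?b p)) UNIV"
    by (rule infsum_reindex_bij_betw[OF bij_betw_fibres, symmetric])
  also have "\<dots> = infsum (\<lambda>(x, y). ?h (- y + x, x)) (SIGMA x:UNIV. UNIV)"
    by (simp add: case_prod_unfold)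
  also have "\<dots> = (\<Sum>\<^sub>\<infinity>x. \<Sum>\<^sub>\<infinity>y. ?h (- y + x, x))"
    by (rule infsum_Sigma'_banach[OF s, symmetric])
  finally show ?thesis by (simp add: cinner_def fibre.rep_eq)
qed

lemma amplify_adjoint: "is_adjoint S T \<Longrightarrow> is_adjoint (amplify S) (amplify T)"
  unfolding is_adjoint_def by (subst (1 2) cinner_fibres) simp

lemma embed_fibre_exists:
  "\<exists>w :: ('g::group_add \<times> 'g) ell2. fibre 0 w = v \<and> (\<forall>x. x \<noteq> 0 \<longrightarrow> fibre x w = 0)"
proof -
  let ?j = "\<lambda>y::'g. (- y, 0::'g)"
  let ?f = "\<lambda>p. case p of (s, x) \<Rightarrow> if x = (0::'g) then ell2_apply v (- s) else 0"
  have inj: "inj ?j" by (simp add: inj_on_def)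
  have "(\<lambda>p. (cmod (?f p))\<^sup>2) summable_on ?j ` UNIV"
    using summable_ell2[of v] by (subst summable_on_reindex[OF inj]) (simp add: o_def)
  moreover have "(\<lambda>p. (cmod (?f p))\<^sup>2) summable_on ?j ` UNIV \<longleftrightarrow> (\<lambda>p. (cmod (?f p))\<^sup>2) summable_on UNIV"
  proof (rule summable_on_cong_neutral)
    fix p assume "p \<in> UNIV - ?j ` UNIV"
    moreover have "p = ?j (- fst p)" if "snd p = 0" using that by (simp add: prod_eq_iff)
    ultimately have "snd p \<noteq> 0" by blast
    then show "(cmod (?f p))\<^sup>2 = 0" by (simp add: case_prod_unfold)
  qed auto
  ultimately have "ell2_apply (Abs_ell2 ?f) p = ?f p" for p
    by (subst Abs_ell2_inverse) auto
  then have "fibre 0 (Abs_ell2 ?f) = v" "x \<noteq> 0 \<Longrightarrow> fibre x (Abs_ell2 ?f) = 0" for x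
    by (auto intro!: ell2_eqI simp: fibre.rep_eq)
  then show ?thesis by blast
qed

text \<open>The isometric inclusion of the fibre over \<open>0\<close>, adjoint to
  \<open>fibre 0\<close>.\<close>

definition embed_fibre :: "'g::group_add ell2 \<Rightarrow> ('g \<times> 'g) ell2" where
  "embed_fibre v = (SOME w. fibre 0 w = v \<and> (\<forall>x. x \<noteq> 0 \<longrightarrow> fibre x w = 0))"

lemma fibre_embed_fibre: "fibre x (embed_fibre v) = (if x = 0 then v else 0)"
  using someI_ex[OF embed_fibre_exists[of v]] unfolding embed_fibre_def by auto

lemma norm_embed_fibre: "norm (embed_fibre v) = norm v"
  for v :: "'g::group_add ell2"
proof -
  have "((\<lambda>x. (norm (fibre x (embed_fibre v)))\<^sup>2) has_sum (norm (embed_fibre v))\<^sup>2) UNIV"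
    by (rule has_sum_fibres)
  moreover have "((\<lambda>x. (norm (fibre x (embed_fibre v)))\<^sup>2) has_sum s) UNIV \<longleftrightarrow>
      ((\<lambda>x. (norm v)\<^sup>2) has_sum s) {0 :: 'g}" for s
    by (rule has_sum_cong_neutral) (auto simp: fibre_embed_fibre)
  ultimately have "((\<lambda>x. (norm v)\<^sup>2) has_sum (norm (embed_fibre v))\<^sup>2) {0 :: 'g}" by blast
  then have "(norm (embed_fibre v))\<^sup>2 = (\<Sum>x\<in>{0::'g}. (norm v)\<^sup>2)"
    using has_sum_finite[of "{0::'g}" "\<lambda>_. (norm v)\<^sup>2"] has_sum_unique by blast
  then show ?thesis by simp
qed

lemma cinner_embed_fibre:
  fixes v :: "'g::group_add ell2"
  shows "cinner w (embed_fibre v) = cinner (fibre 0 w) v" "cinner (embed_fibre v) w = cinner v (fibre 0 w)"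
proof -
  have z: "cinner u (0 :: 'g ell2) = 0" for u by (rule cinner_simps)
  show *: "cinner w (embed_fibre v) = cinner (fibre 0 w) v" for w
  proof -
    have "cinner w (embed_fibre v) = (\<Sum>\<^sub>\<infinity>x\<in>{0::'g}. cinner (fibre x w) (fibre x (embed_fibre v)))"
      unfolding cinner_fibres by (rule infsum_cong_neutral) (auto simp: fibre_embed_fibre z)
    then show ?thesis by (simp add: fibre_embed_fibre)
  qed
  show "cinner (embed_fibre v) w = cinner v (fibre 0 w)"
    unfolding cinner_commute[of "embed_fibre v"] cinner_commute[of v] * ..
qed

text \<open>The compression to the fibre over \<open>0\<close>. As \<open>amplify\<close> repeats
  the same operator in every fibre, one fibre recovers it, and the condition of being amplified
  becomes a closed one.\<close>

definition restrict_fibre :: "('g::group_add \<times> 'g) bop \<Rightarrow> 'g bop" where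
  "restrict_fibre W = (SOME T. bop_apply T = (\<lambda>v. fibre 0 (bop_apply W (embed_fibre v))))"

lemma restrict_fibre_apply: "bop_apply (restrict_fibre W) v = fibre 0 (bop_apply W (embed_fibre v))"
proof -
  have "\<exists>T. bop_apply T = (\<lambda>v. fibre 0 (bop_apply W (embed_fibre v)))"
  proof (rule bop_of_function)
    fix v w :: "'a ell2" and c
    have "embed_fibre (v + w) = embed_fibre v + embed_fibre w"
      by (rule ell2_eq_fibreI) (simp add: fibre_embed_fibre)
    then show "fibre 0 (bop_apply W (embed_fibre (v + w))) =
        fibre 0 (bop_apply W (embed_fibre v)) + fibre 0 (bop_apply W (embed_fibre w))"
      by (simp add: bop_apply_add)
    have "embed_fibre (scaleC_ell2 c v) = scaleC_ell2 c (embed_fibre v)"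
      by (rule ell2_eq_fibreI) (simp add: fibre_embed_fibre scaleC_ell2_zero)
    then show "fibre 0 (bop_apply W (embed_fibre (scaleC_ell2 c v))) =
        scaleC_ell2 c (fibre 0 (bop_apply W (embed_fibre v)))"
      by (simp add: bop_apply_scaleC)
    show "norm (fibre 0 (bop_apply W (embed_fibre v))) \<le> norm v * norm W"
      using norm_fibre_le[of 0 "bop_apply W (embed_fibre v)"] norm_bop_apply[of W "embed_fibre v"]
      by (simp add: norm_embed_fibre mult.commute)
  qed
  from someI_ex[OF this] show ?thesis unfolding restrict_fibre_def by meson
qed

lemma restrict_fibre_amplify [simp]: "restrict_fibre (amplify T) = T"
  by (rule bop_eqI) (simp add: restrict_fibre_apply fibre_embed_fibre)

lemma restrict_fibre_simps:
  "restrict_fibre (V + W) = restrict_fibre V + restrict_fibre W"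
  "restrict_fibre (r *\<^sub>R V) = r *\<^sub>R restrict_fibre V"
  by (intro bop_eqI; simp add: restrict_fibre_apply)+

lemma norm_restrict_fibre_le: "norm (restrict_fibre W) \<le> norm W"
proof (rule norm_bop_le)
  fix v
  show "norm (bop_apply (restrict_fibre W) v) \<le> norm W * norm v"
    using norm_fibre_le[of 0 "bop_apply W (embed_fibre v)"] norm_bop_apply[of W "embed_fibre v"]
    by (simp add: restrict_fibre_apply norm_embed_fibre)
qed simp

lemma bounded_linear_amplify: "bounded_linear amplify"
  by (rule bounded_linear_intro[where K = 1]) (simp_all add: amplify_simps norm_amplify_le)

lemma bounded_linear_restrict_fibre: "bounded_linear restrict_fibre"
  by (rule bounded_linear_intro[where K = 1]) (simp_all add: restrict_fibre_simps norm_restrict_fibre_le)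

context finitely_generated_group begin

lemma amplify_partial_translation:
  assumes f: "bounded (range f)"
  shows "amplify (partial_shift f (\<lambda>y. y + t)) = regular_function f * regular_unitary t"
proof -
  have "bij (\<lambda>y. y + t)"
    by (rule bij_betw_byWitness[where f' = "\<lambda>y. y - t"]) auto
  then have "partial_shift f (\<lambda>y. y + t) = mult_op f * shift_op (\<lambda>y. y + t)"
    by (intro bop_eqI ell2_eqI)
      (simp add: partial_shift_apply[OF f] mult_op_apply[OF f] shift_op_apply inj_on_def)
  then show ?thesis by (simp add: amplify_simps amplify_mult_op[OF f] amplify_shift_op)
qed

lemma partial_translation_in_uniform_Roe:
  assumes f: "bounded (range f)"
  shows "partial_shift f (\<lambda>y. y + t) \<in> uniform_Roe_algebra S"
proof (rule partial_shift_in_uniform_Roe[OF f])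
  show "word_dist S (i + t) i \<le> word_length S (- t)" for i
    by (simp add: word_dist_def minus_add add.assoc)
qed (simp add: inj_on_def)

text \<open>Generators of the crossed product are amplified weighted translations. In one direction,
  \<open>?D\<close> is a closed subspace that contains them; in the other, \<open>amplify\<close> is
  continuous and maps operators of finite propagation into their span.\<close>

theorem reduced_crossed_product_eq:
  "reduced_crossed_product = amplify ` uniform_Roe_algebra S"
proof (intro equalityI subsetI)
  let ?gen = "{regular_function f * regular_unitary t | f t. bounded (range f)} :: ('g \<times> 'g) bop set"
  let ?D = "{W. amplify (restrict_fibre W) = W \<and> restrict_fibre W \<in> uniform_Roe_algebra S}"
  interpret Roe: star_algebra "uniform_Roe_algebra S" by (rule star_algebra_uniform_Roe)
  have subsp: "real_vector.subspace ?D"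
    unfolding real_vector.subspace_def
  proof (intro conjI ballI allI)
    have z: "restrict_fibre (0 :: ('g \<times> 'g) bop) = 0"
      using restrict_fibre_amplify[of "0 :: 'g bop"] by (simp add: amplify_simps)
    show "0 \<in> ?D" using Roe.zero_closed by (simp add: z amplify_simps)
    fix V assume V: "V \<in> ?D"
    show "V + W \<in> ?D" if "W \<in> ?D" for W
      using V that by (simp add: restrict_fibre_simps amplify_simps Roe.plus_closed)
    \<comment> \<open>Scalar multiples do not occur among the axioms of \<open>star_algebra\<close>;
      here they are products with the multiplication operator of a constant function.\<close>
    fix c :: real
    have "(c *\<^sub>R 1) * restrict_fibre V = c *\<^sub>R restrict_fibre V" by (rule bop_eqI) simp
    moreover have "c *\<^sub>R 1 \<in> uniform_Roe_algebra S"
    proof -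
      have b: "bounded (range (\<lambda>_::'g. complex_of_real c))" by (auto simp: bounded_iff)
      have "c *\<^sub>R 1 = mult_op (\<lambda>_::'g. complex_of_real c)"
        by (intro bop_eqI ell2_eqI) (simp add: mult_op_apply[OF b] scaleR_conv_of_real)
      then show ?thesis using linf_subset_uniform_Roe b unfolding linf_algebra_def by auto
    qed
    ultimately have "c *\<^sub>R restrict_fibre V \<in> uniform_Roe_algebra S" using Roe.mult_closed V by (metis (no_types, lifting) mem_Collect_eq)
    then show "c *\<^sub>R V \<in> ?D" using V by (simp add: restrict_fibre_simps amplify_simps)
  qed
  have "?gen \<subseteq> ?D"
  proof
    fix W assume "W \<in> ?gen"
    then obtain f t where f: "bounded (range f)" "W = regular_function f * regular_unitary t" by blast
    then have "W = amplify (partial_shift f (\<lambda>y. y + t))" by (simp add: amplify_partial_translation)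
    then show "W \<in> ?D" using partial_translation_in_uniform_Roe[OF f(1), of t] by simp
  qed
  then have "real_vector.span ?gen \<subseteq> ?D" by (rule real_vector.span_minimal[OF _ subsp])
  moreover have "closed ?D"
  proof -
    have c: "continuous_on UNIV amplify" "continuous_on UNIV restrict_fibre"
      by (auto intro: linear_continuous_on bounded_linear_amplify bounded_linear_restrict_fibre)
    have "continuous_on UNIV (\<lambda>W. amplify (restrict_fibre W))"
      using continuous_on_compose2[OF c(1) c(2)] by simp
    then have "closed {W. amplify (restrict_fibre W) = W}"
      by (intro closed_Collect_eq continuous_on_id)
    moreover have "closed (restrict_fibre -` uniform_Roe_algebra S)"
      unfolding uniform_Roe_algebra_eq by (rule closed_vimage[OF closed_closure c(2)])
    ultimately have "closed ({W. amplify (restrict_fibre W) = W} \<inter> restrict_fibre -` uniform_Roe_algebra S)"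
      by (rule closed_Int)
    then show ?thesis by (simp add: Int_def)
  qed
  ultimately have sub: "reduced_crossed_product \<subseteq> ?D"
    unfolding reduced_crossed_product_def by (rule closure_minimal)
  show "W \<in> amplify ` uniform_Roe_algebra S" if W: "W \<in> reduced_crossed_product" for W
  proof (rule image_eqI)
    show "W = amplify (restrict_fibre W)" "restrict_fibre W \<in> uniform_Roe_algebra S" using W sub by auto
  qed
  have fp: "amplify T \<in> real_vector.span ?gen" if T: "T \<in> finite_propagation" for T
  proof -
    obtain R where R: "propagation_le R T" using T unfolding finite_propagation_def by auto
    let ?f = "\<lambda>t y. ell2_apply (bop_apply T (delta (y + t))) y"
    have "linear (amplify :: 'g bop \<Rightarrow> _)" by (rule bounded_linear.linear[OF bounded_linear_amplify])
    then have "amplify T = (\<Sum>t | word_length S t \<le> R. amplify (partial_shift (?f t) (\<lambda>y. y + t)))"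
      by (subst propagation_le_decomposition(1)[OF R]) (rule linear_sum)
    also have "\<dots> \<in> real_vector.span ?gen"
    proof (rule real_vector.span_sum)
      fix t
      have "amplify (partial_shift (?f t) (\<lambda>y. y + t)) = regular_function (?f t) * regular_unitary t"
        by (rule amplify_partial_translation[OF propagation_le_decomposition(2)[OF R]])
      moreover have "regular_function (?f t) * regular_unitary t \<in> ?gen"
        using propagation_le_decomposition(2)[OF R, of t] by blast
      ultimately show "amplify (partial_shift (?f t) (\<lambda>y. y + t)) \<in> real_vector.span ?gen" by (simp only: real_vector.span_base)
    qed
    finally show ?thesis .
  qed
  show "W \<in> reduced_crossed_product" if W: "W \<in> amplify ` uniform_Roe_algebra S" for W
  proof -
    obtain T where T: "T \<in> uniform_Roe_algebra S" "W = amplify T" using W by auto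
    obtain t where t: "\<And>n. t n \<in> finite_propagation" "t \<longlonglongrightarrow> T"
      using T(1) unfolding uniform_Roe_algebra_eq closure_sequential by blast
    have "(\<lambda>n. amplify (t n)) \<longlonglongrightarrow> W"
      unfolding T(2) by (rule bounded_linear.tendsto[OF bounded_linear_amplify t(2)])
    moreover have "amplify (t n) \<in> real_vector.span ?gen" for n using fp[OF t(1)] .
    ultimately show ?thesis
      unfolding reduced_crossed_product_def closure_sequential by (intro exI[of _ "\<lambda>n. amplify (t n)"]) simp
  qed
qed

lemma star_algebra_reduced_crossed_product: "star_algebra (reduced_crossed_product :: ('g \<times> 'g) bop set)"
  unfolding reduced_crossed_product_eq
proof
  interpret Roe: star_algebra "uniform_Roe_algebra S" by (rule star_algebra_uniform_Roe)
  let ?B = "amplify ` uniform_Roe_algebra S"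
  show "0 \<in> ?B" using Roe.zero_closed amplify_simps(4) by (metis image_eqI)
  show "1 \<in> ?B" using Roe.one_closed amplify_simps(5) by (metis image_eqI)
  show "V + W \<in> ?B" "V * W \<in> ?B" if "V \<in> ?B" "W \<in> ?B" for V W
    using that by (auto simp: amplify_simps(1,3)[symmetric] intro!: imageI Roe.plus_closed Roe.mult_closed)
  show "- V \<in> ?B" if "V \<in> ?B" for V
    using that by (auto simp: amplify_simps(2)[symmetric] intro!: imageI Roe.uminus_closed)
  show "V \<in> ?B" if V: "is_adjoint V W" and W: "W \<in> ?B" for V W
  proof -
    obtain T where T: "T \<in> uniform_Roe_algebra S" "W = amplify T" using W by auto
    \<comment> \<open>An adjoint of \<open>amplify T\<close> is not known in advance to be
      amplified. Its compression is an adjoint of \<open>T\<close>, and uniqueness of adjoints then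
      gives \<open>V = amplify U\<close>.\<close>
    define U where "U = restrict_fibre V"
    have U: "is_adjoint U T"
      using V unfolding is_adjoint_def T(2) U_def restrict_fibre_apply
      by (simp add: cinner_embed_fibre[symmetric]) (simp add: cinner_embed_fibre fibre_embed_fibre)
    have "V = amplify U" using is_adjoint_unique[OF V] amplify_adjoint[OF U] T(2) by simp
    then show ?thesis using Roe.adjoint_closed[OF U T(1)] by simp
  qed
qed

end

section \<open>K-theory of unital star-algebras of operators\<close>

context comm_monoid begin

abbreviation (input) gclass where "gclass a b \<equiv> grothendieck_rel G `` {(a, b)}"

text \<open>The monoid may fail to be cancellative, so the middle term \<open>d\<close> cannot be
  cancelled and joins the stabilising element.\<close>

lemma grothendieck_rel_trans:
  assumes "a \<in> carrier G" "b \<in> carrier G" "c \<in> carrier G" "d \<in> carrier G" "x \<in> carrier G" "y \<in> carrier G"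
    "e \<in> carrier G" "e' \<in> carrier G"
    and 1: "a \<otimes> d \<otimes> e = c \<otimes> b \<otimes> e" and 2: "c \<otimes> y \<otimes> e' = x \<otimes> d \<otimes> e'"
  shows "a \<otimes> y \<otimes> (d \<otimes> e \<otimes> e') = x \<otimes> b \<otimes> (d \<otimes> e \<otimes> e')"
proof -
  have "a \<otimes> y \<otimes> (d \<otimes> e \<otimes> e') = (a \<otimes> d \<otimes> e) \<otimes> (y \<otimes> e')" using assms(1-8) by (simp add: m_ac)
  also have "\<dots> = (c \<otimes> y \<otimes> e') \<otimes> (b \<otimes> e)" unfolding 1 using assms(1-8) by (simp add: m_ac)
  also have "\<dots> = x \<otimes> b \<otimes> (d \<otimes> e \<otimes> e')" unfolding 2 using assms(1-8) by (simp add: m_ac)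
  finally show ?thesis .
qed

lemma equiv_grothendieck_rel: "equiv (carrier G \<times> carrier G) (grothendieck_rel G)"
proof (rule equivI)
  show "grothendieck_rel G \<subseteq> (carrier G \<times> carrier G) \<times> (carrier G \<times> carrier G)"
    unfolding grothendieck_rel_def by auto
  show "refl_on (carrier G \<times> carrier G) (grothendieck_rel G)"
    unfolding refl_on_def grothendieck_rel_def using one_closed by auto
  show "sym (grothendieck_rel G)"
    unfolding sym_def grothendieck_rel_def by (auto intro: sym)
  show "trans (grothendieck_rel G)"
  proof (rule transI)
    fix p q r assume "(p, q) \<in> grothendieck_rel G" "(q, r) \<in> grothendieck_rel G"
    then obtain a b c d x y e e' where *: "p = (a, b)" "q = (c, d)" "r = (x, y)"
      "a \<in> carrier G" "b \<in> carrier G" "c \<in> carrier G" "d \<in> carrier G" "x \<in> carrier G" "y \<in> carrier G"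
      "e \<in> carrier G" "e' \<in> carrier G" "a \<otimes> d \<otimes> e = c \<otimes> b \<otimes> e" "c \<otimes> y \<otimes> e' = x \<otimes> d \<otimes> e'"
      unfolding grothendieck_rel_def by auto
    have "\<exists>e\<in>carrier G. a \<otimes> y \<otimes> e = x \<otimes> b \<otimes> e"
      using grothendieck_rel_trans[OF *(4-13)] *(7,10,11) by (intro bexI[of _ "d \<otimes> e \<otimes> e'"]) auto
    then show "(p, r) \<in> grothendieck_rel G"
      using * unfolding grothendieck_rel_def by simp
  qed
qed

lemma gclass_eq_iff:
  assumes "a \<in> carrier G" "b \<in> carrier G" "c \<in> carrier G" "d \<in> carrier G"
  shows "gclass a b = gclass c d \<longleftrightarrow> (\<exists>e\<in>carrier G. a \<otimes> d \<otimes> e = c \<otimes> b \<otimes> e)"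
proof -
  have "gclass a b = gclass c d \<longleftrightarrow> ((a, b), (c, d)) \<in> grothendieck_rel G"
    using assms by (intro eq_equiv_class_iff[OF equiv_grothendieck_rel]) auto
  then show ?thesis using assms unfolding grothendieck_rel_def by simp
qed

lemma mem_gclass_iff:
  "(c, d) \<in> gclass a b \<longleftrightarrow> a \<in> carrier G \<and> b \<in> carrier G \<and> c \<in> carrier G \<and> d \<in> carrier G \<and> gclass c d = gclass a b"
proof
  assume "(c, d) \<in> gclass a b"
  then have r: "((a, b), (c, d)) \<in> grothendieck_rel G" by simp
  then show "a \<in> carrier G \<and> b \<in> carrier G \<and> c \<in> carrier G \<and> d \<in> carrier G \<and> gclass c d = gclass a b"
    using equiv_class_eq[OF equiv_grothendieck_rel r] unfolding grothendieck_rel_def by simp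
next
  assume *: "a \<in> carrier G \<and> b \<in> carrier G \<and> c \<in> carrier G \<and> d \<in> carrier G \<and> gclass c d = gclass a b"
  then have "(c, d) \<in> gclass c d" by (intro equiv_class_self[OF equiv_grothendieck_rel]) auto
  with * show "(c, d) \<in> gclass a b" by simp
qed

lemma grothendieck_group_cases:
  assumes "X \<in> carrier (grothendieck_group G)"
  obtains a b where "a \<in> carrier G" "b \<in> carrier G" "X = gclass a b"
  using assms unfolding grothendieck_group_def quotient_def by auto

lemma gclass_closed: "a \<in> carrier G \<Longrightarrow> b \<in> carrier G \<Longrightarrow> gclass a b \<in> carrier (grothendieck_group G)"
  unfolding grothendieck_group_def quotient_def by auto

lemma gclass_mult:
  assumes "a \<in> carrier G" "b \<in> carrier G" "c \<in> carrier G" "d \<in> carrier G"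
  shows "gclass a b \<otimes>\<^bsub>grothendieck_group G\<^esub> gclass c d = gclass (a \<otimes> c) (b \<otimes> d)"
proof -
  have const: "gclass (fst p \<otimes> fst q) (snd p \<otimes> snd q) = gclass (a \<otimes> c) (b \<otimes> d)"
    if pq: "p \<in> gclass a b" "q \<in> gclass c d" for p q
  proof -
    obtain a' b' c' d' where p: "p = (a', b')" "q = (c', d')" by fastforce
    have ca: "a' \<in> carrier G" "b' \<in> carrier G" "c' \<in> carrier G" "d' \<in> carrier G"
      and eq: "gclass a' b' = gclass a b" "gclass c' d' = gclass c d"
      using pq unfolding p mem_gclass_iff by auto
    obtain e where e: "e \<in> carrier G" "a' \<otimes> b \<otimes> e = a \<otimes> b' \<otimes> e"
      using eq(1) gclass_eq_iff[OF ca(1,2) assms(1,2)] by auto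
    obtain e' where e': "e' \<in> carrier G" "c' \<otimes> d \<otimes> e' = c \<otimes> d' \<otimes> e'"
      using eq(2) gclass_eq_iff[OF ca(3,4) assms(3,4)] by auto
    have "a' \<otimes> c' \<otimes> (b \<otimes> d) \<otimes> (e \<otimes> e') = (a' \<otimes> b \<otimes> e) \<otimes> (c' \<otimes> d \<otimes> e')"
      using ca assms e(1) e'(1) by (simp add: m_ac)
    also have "\<dots> = a \<otimes> c \<otimes> (b' \<otimes> d') \<otimes> (e \<otimes> e')"
      unfolding e(2) e'(2) using ca assms e(1) e'(1) by (simp add: m_ac)
    finally have "\<exists>f\<in>carrier G. a' \<otimes> c' \<otimes> (b \<otimes> d) \<otimes> f = a \<otimes> c \<otimes> (b' \<otimes> d') \<otimes> f"
      using e(1) e'(1) by (intro bexI[of _ "e \<otimes> e'"]) auto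
    then show ?thesis using gclass_eq_iff[of "a' \<otimes> c'" "b' \<otimes> d'" "a \<otimes> c" "b \<otimes> d"] ca assms p by simp
  qed
  have "(a, b) \<in> gclass a b" "(c, d) \<in> gclass c d"
    using assms unfolding mem_gclass_iff by auto
  then have ne: "gclass a b \<noteq> {}" "gclass c d \<noteq> {}" by blast+
  have "gclass a b \<otimes>\<^bsub>grothendieck_group G\<^esub> gclass c d =
      (\<Union>p\<in>gclass a b. \<Union>q\<in>gclass c d. gclass (fst p \<otimes> fst q) (snd p \<otimes> snd q))"
    unfolding grothendieck_group_def by (simp add: case_prod_unfold)
  also have "\<dots> = (\<Union>p\<in>gclass a b. \<Union>q\<in>gclass c d. gclass (a \<otimes> c) (b \<otimes> d))"
    using const by simp
  also have "\<dots> = gclass (a \<otimes> c) (b \<otimes> d)"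
    using ne by simp
  finally show ?thesis .
qed

lemma gclass_one: "\<one>\<^bsub>grothendieck_group G\<^esub> = gclass \<one> \<one>"
  by (simp add: grothendieck_group_def)

lemma gclass_diag: "a \<in> carrier G \<Longrightarrow> gclass a a = \<one>\<^bsub>grothendieck_group G\<^esub>"
  unfolding gclass_one by (subst gclass_eq_iff) auto

lemma comm_group_grothendieck_group: "comm_group (grothendieck_group G)"
proof (rule comm_groupI)
  let ?K = "grothendieck_group G"
  show "\<one>\<^bsub>?K\<^esub> \<in> carrier ?K" unfolding gclass_one by (rule gclass_closed) auto
  fix X assume "X \<in> carrier ?K"
  then obtain a b where X: "a \<in> carrier G" "b \<in> carrier G" "X = gclass a b" by (rule grothendieck_group_cases)
  show "\<one>\<^bsub>?K\<^esub> \<otimes>\<^bsub>?K\<^esub> X = X" using X by (simp add: gclass_one gclass_mult)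
  have "gclass b a \<otimes>\<^bsub>?K\<^esub> X = \<one>\<^bsub>?K\<^esub>"
    using X by (simp add: gclass_mult m_comm[of b a] gclass_diag)
  then show "\<exists>Y\<in>carrier ?K. Y \<otimes>\<^bsub>?K\<^esub> X = \<one>\<^bsub>?K\<^esub>" using X by (intro bexI[of _ "gclass b a"] gclass_closed)
  fix Y assume "Y \<in> carrier ?K"
  then obtain c d where Y: "c \<in> carrier G" "d \<in> carrier G" "Y = gclass c d" by (rule grothendieck_group_cases)
  show "X \<otimes>\<^bsub>?K\<^esub> Y \<in> carrier ?K" using X Y by (simp add: gclass_mult gclass_closed)
  show "X \<otimes>\<^bsub>?K\<^esub> Y = Y \<otimes>\<^bsub>?K\<^esub> X" using X Y by (simp add: gclass_mult m_comm)
  fix Z assume "Z \<in> carrier ?K"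
  then obtain x y where Z: "x \<in> carrier G" "y \<in> carrier G" "Z = gclass x y" by (rule grothendieck_group_cases)
  show "X \<otimes>\<^bsub>?K\<^esub> Y \<otimes>\<^bsub>?K\<^esub> Z = X \<otimes>\<^bsub>?K\<^esub> (Y \<otimes>\<^bsub>?K\<^esub> Z)"
    using X Y Z by (simp add: gclass_mult m_assoc)
qed

end

section \<open>Matrices of operators: adjoints, blocks and direct sums\<close>

lemma elements_mat_subset_iff:
  "elements_mat p \<subseteq> A \<longleftrightarrow> (\<forall>i<dim_row p. \<forall>j<dim_col p. p $$ (i, j) \<in> A)"
  by (auto simp: elements_mat_def image_subset_iff UN_subset_iff)

lemma index_mult_mat_sum:
  assumes "i < dim_row a" "j < dim_col b" "dim_col a = dim_row b"
  shows "(a * b) $$ (i, j) = (\<Sum>k<dim_row b. a $$ (i, k) * b $$ (k, j))"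
  using assms by (simp add: scalar_prod_def lessThan_atLeast0)

lemma mat_is_adjoint_sym: "mat_is_adjoint w v \<Longrightarrow> mat_is_adjoint v w"
  unfolding mat_is_adjoint_def by (auto intro: is_adjoint_commute)

lemma mat_is_adjoint_mult:
  assumes "mat_is_adjoint w v" "mat_is_adjoint w' v'" "dim_col v' = dim_row v"
  shows "mat_is_adjoint (w * w') (v' * v)"
proof -
  have d: "dim_row w = dim_col v" "dim_col w = dim_row v" "dim_row w' = dim_col v'" "dim_col w' = dim_row v'"
    using assms unfolding mat_is_adjoint_def by auto
  show ?thesis
    unfolding mat_is_adjoint_def
  proof (intro conjI allI impI)
    fix i j assume ij: "i < dim_row (v' * v)" "j < dim_col (v' * v)"
    have "(w * w') $$ (j, i) = (\<Sum>k<dim_row v. w $$ (j, k) * w' $$ (k, i))"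
      using ij d assms(3) by (subst index_mult_mat_sum) auto
    moreover have "(v' * v) $$ (i, j) = (\<Sum>k<dim_row v. v' $$ (i, k) * v $$ (k, j))"
      using ij assms(3) by (subst index_mult_mat_sum) auto
    moreover have "is_adjoint (w $$ (j, k) * w' $$ (k, i)) (v' $$ (i, k) * v $$ (k, j))" if "k < dim_row v" for k
      using assms ij that unfolding mat_is_adjoint_def by (intro is_adjoint_simps(5)) auto
    ultimately show "is_adjoint ((w * w') $$ (j, i)) ((v' * v) $$ (i, j))"
      by (simp only:) (rule is_adjoint_sum, simp)
  qed (simp_all add: d)
qed

lemma mat_is_adjoint_four_block:
  assumes "a \<in> carrier_mat n m" "b \<in> carrier_mat n m'" "c \<in> carrier_mat n' m" "d \<in> carrier_mat n' m'"
    and "mat_is_adjoint a' a" "mat_is_adjoint b' b" "mat_is_adjoint c' c" "mat_is_adjoint d' d"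
  shows "mat_is_adjoint (four_block_mat a' c' b' d') (four_block_mat a b c d)"
  using assms unfolding mat_is_adjoint_def by (auto simp: index_mat_four_block)

lemma mat_is_adjoint_zero: "mat_is_adjoint (0\<^sub>m n m) (0\<^sub>m m n)"
  unfolding mat_is_adjoint_def by (auto simp: is_adjoint_simps)

lemma elements_four_block_subset:
  assumes "a \<in> carrier_mat n m" "b \<in> carrier_mat n m'" "c \<in> carrier_mat n' m" "d \<in> carrier_mat n' m'"
    and "elements_mat a \<subseteq> A" "elements_mat b \<subseteq> A" "elements_mat c \<subseteq> A" "elements_mat d \<subseteq> A"
  shows "elements_mat (four_block_mat a b c d) \<subseteq> A"
  using assms unfolding elements_mat_subset_iff by (auto simp: index_mat_four_block)

lemma direct_sum_mat_carrier:
  "p \<in> carrier_mat n m \<Longrightarrow> q \<in> carrier_mat n' m' \<Longrightarrow> direct_sum_mat p q \<in> carrier_mat (n + n') (m + m')"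
  unfolding direct_sum_mat_def by auto

lemma direct_sum_mat_mult:
  fixes a :: "'a::semiring_0 mat"
  assumes "a \<in> carrier_mat n m" "b \<in> carrier_mat m k" "a' \<in> carrier_mat n' m'" "b' \<in> carrier_mat m' k'"
  shows "direct_sum_mat a a' * direct_sum_mat b b' = direct_sum_mat (a * b) (a' * b')"
proof -
  have "four_block_mat a (0\<^sub>m n m') (0\<^sub>m n' m) a' * four_block_mat b (0\<^sub>m m k') (0\<^sub>m m' k) b'
    = four_block_mat (a * b + 0\<^sub>m n m' * 0\<^sub>m m' k) (a * 0\<^sub>m m k' + 0\<^sub>m n m' * b')
        (0\<^sub>m n' m * b + a' * 0\<^sub>m m' k) (0\<^sub>m n' m * 0\<^sub>m m k' + a' * b')"
    by (rule mult_four_block_mat) (use assms in auto)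
  also have "\<dots> = four_block_mat (a * b) (0\<^sub>m n k') (0\<^sub>m n' k) (a' * b')"
    using assms by (intro arg_cong4[where f = four_block_mat]) auto
  finally show ?thesis using assms unfolding direct_sum_mat_def by auto
qed

lemma dim_direct_sum_mat [simp]:
  "dim_row (direct_sum_mat p q) = dim_row p + dim_row q"
  "dim_col (direct_sum_mat p q) = dim_col p + dim_col q"
  by (simp_all add: direct_sum_mat_def)

lemma index_direct_sum_mat:
  assumes "i < dim_row p + dim_row q" "j < dim_col p + dim_col q"
  shows "direct_sum_mat p q $$ (i, j) =
    (if i < dim_row p then if j < dim_col p then p $$ (i, j) else 0
     else if j < dim_col p then 0 else q $$ (i - dim_row p, j - dim_col p))"
  using assms by (simp add: direct_sum_mat_def index_mat_four_block)

lemma direct_sum_mat_assoc: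
  "direct_sum_mat (direct_sum_mat p q) r = direct_sum_mat p (direct_sum_mat q r)"
  unfolding direct_sum_mat_def by (rule assoc_four_block_mat[symmetric])

lemma direct_sum_mat_empty: "direct_sum_mat (0\<^sub>m 0 0) p = p" "direct_sum_mat p (0\<^sub>m 0 0) = p"
  by (rule eq_matI; simp add: index_direct_sum_mat)+

lemma mat_is_adjoint_direct_sum:
  assumes "mat_is_adjoint a' a" "mat_is_adjoint d' d"
  shows "mat_is_adjoint (direct_sum_mat a' d') (direct_sum_mat a d)"
proof -
  have d: "dim_row a' = dim_col a" "dim_col a' = dim_row a" "dim_row d' = dim_col d" "dim_col d' = dim_row d"
    using assms unfolding mat_is_adjoint_def by auto
  show ?thesis
    unfolding mat_is_adjoint_def
  proof (intro conjI allI impI)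
    fix i j assume "i < dim_row (direct_sum_mat a d)" "j < dim_col (direct_sum_mat a d)"
    then have ij: "i < dim_row a + dim_row d" "j < dim_col a + dim_col d" by simp_all
    show "is_adjoint (direct_sum_mat a' d' $$ (j, i)) (direct_sum_mat a d $$ (i, j))"
      using assms ij unfolding mat_is_adjoint_def
      by (cases "i < dim_row a"; cases "j < dim_col a") (simp_all add: index_direct_sum_mat d is_adjoint_simps)
  qed (simp_all add: d)
qed

lemma elements_direct_sum_subset:
  assumes "elements_mat a \<subseteq> A" "elements_mat d \<subseteq> A" "0 \<in> A"
  shows "elements_mat (direct_sum_mat a d) \<subseteq> A"
  unfolding elements_mat_subset_iff
proof (intro allI impI)
  fix i j assume "i < dim_row (direct_sum_mat a d)" "j < dim_col (direct_sum_mat a d)"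
  then have ij: "i < dim_row a + dim_row d" "j < dim_col a + dim_col d" by simp_all
  show "direct_sum_mat a d $$ (i, j) \<in> A"
    using assms ij unfolding elements_mat_subset_iff
    by (cases "i < dim_row a"; cases "j < dim_col a") (simp_all add: index_direct_sum_mat)
qed

lemma map_mat_direct_sum:
  assumes "f 0 = 0"
  shows "map_mat f (direct_sum_mat p q) = direct_sum_mat (map_mat f p) (map_mat f q)"
  by (rule eq_matI) (simp_all add: index_direct_sum_mat assms)

section \<open>Projections, Murray-von Neumann equivalence and the group \<open>K0\<close>\<close>

context star_algebra begin

lemma elements_mult_subset:
  assumes "elements_mat a \<subseteq> A" "elements_mat b \<subseteq> A" "dim_col a = dim_row b"
  shows "elements_mat (a * b) \<subseteq> A"
  unfolding elements_mat_subset_iff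
proof (intro allI impI)
  fix i j assume ij: "i < dim_row (a * b)" "j < dim_col (a * b)"
  then have "(a * b) $$ (i, j) = (\<Sum>k<dim_row b. a $$ (i, k) * b $$ (k, j))"
    using assms(3) by (intro index_mult_mat_sum) auto
  also have "\<dots> \<in> A"
    using assms ij unfolding elements_mat_subset_iff by (intro sum_closed mult_closed) auto
  finally show "(a * b) $$ (i, j) \<in> A" .
qed

lemma elements_zero_subset: "elements_mat (0\<^sub>m n m) \<subseteq> A"
  unfolding elements_mat_subset_iff by (simp add: zero_closed)

lemma elements_adjoint_subset:
  assumes "mat_is_adjoint w v" "elements_mat v \<subseteq> A"
  shows "elements_mat w \<subseteq> A"
  using assms adjoint_closed unfolding elements_mat_subset_iff mat_is_adjoint_def by metis

lemma projectionsD: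
  assumes "p \<in> projections A"
  shows "p \<in> carrier_mat (dim_row p) (dim_row p)" "elements_mat p \<subseteq> A" "p * p = p" "mat_is_adjoint p p"
  using assms unfolding projections_def by auto

lemma projectionsI:
  assumes "p \<in> carrier_mat n n" "elements_mat p \<subseteq> A" "p * p = p" "mat_is_adjoint p p"
  shows "p \<in> projections A"
  using assms unfolding projections_def by auto

lemma mvn_relI:
  assumes v: "v \<in> carrier_mat m n" and w: "w \<in> carrier_mat n m"
    and "elements_mat v \<subseteq> A" "mat_is_adjoint w v" "p \<in> projections A" "q \<in> projections A"
    and "p = w * v" "q = v * w"
  shows "(p, q) \<in> mvn_rel A"
proof -
  have "dim_row p = n" "dim_row q = m" using assms by auto
  with assms show ?thesis
    unfolding mvn_rel_def mem_Collect_eq case_prod_conv by (intro conjI bexI[of _ v] exI[of _ w]) simp_all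
qed

lemma mvn_relE:
  assumes "(p, q) \<in> mvn_rel A"
  obtains n m v w where "p \<in> carrier_mat n n" "q \<in> carrier_mat m m" "v \<in> carrier_mat m n" "w \<in> carrier_mat n m"
    "elements_mat v \<subseteq> A" "elements_mat w \<subseteq> A" "mat_is_adjoint w v" "p = w * v" "q = v * w"
    "p \<in> projections A" "q \<in> projections A"
proof -
  from assms have "p \<in> projections A \<and> q \<in> projections A \<and>
     (\<exists>v\<in>carrier_mat (dim_row q) (dim_row p). \<exists>w. elements_mat v \<subseteq> A \<and> mat_is_adjoint w v \<and> p = w * v \<and> q = v * w)"
    unfolding mvn_rel_def by (simp only: mem_Collect_eq case_prod_conv)
  then obtain v w where *: "p \<in> projections A" "q \<in> projections A"
    "v \<in> carrier_mat (dim_row q) (dim_row p)" "elements_mat v \<subseteq> A" "mat_is_adjoint w v" "p = w * v" "q = v * w"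
    by (elim conjE bexE exE) (rule that)
  have "w \<in> carrier_mat (dim_row p) (dim_row q)" using *(3,5) unfolding mat_is_adjoint_def by auto
  with * projectionsD(1)[OF *(1)] projectionsD(1)[OF *(2)] elements_adjoint_subset[OF *(5,4)] show thesis
    by (intro that[of "dim_row p" "dim_row q" v w])
qed

lemma equiv_mvn_rel: "equiv (projections A) (mvn_rel A)"
proof (rule equivI)
  show "mvn_rel A \<subseteq> projections A \<times> projections A" unfolding mvn_rel_def by auto
  show "refl_on (projections A) (mvn_rel A)"
  proof (rule refl_onI)
    fix p assume p: "p \<in> projections A"
    show "(p, p) \<in> mvn_rel A"
      by (rule mvn_relI[OF projectionsD(1)[OF p] projectionsD(1)[OF p] projectionsD(2)[OF p] projectionsD(4)[OF p] p p])
        (simp_all add: projectionsD(3)[OF p])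
  qed
  show "sym (mvn_rel A)"
  proof (rule symI)
    fix p q assume "(p, q) \<in> mvn_rel A"
    then show "(q, p) \<in> mvn_rel A"
    proof (rule mvn_relE)
      fix n m v w
      assume *: "v \<in> carrier_mat m n" "w \<in> carrier_mat n m" "elements_mat w \<subseteq> A" "mat_is_adjoint w v"
        "p = w * v" "q = v * w" "p \<in> projections A" "q \<in> projections A"
      show "(q, p) \<in> mvn_rel A"
        by (rule mvn_relI[OF *(2,1,3) mat_is_adjoint_sym[OF *(4)] *(8,7,6,5)])
    qed
  qed
  show "trans (mvn_rel A)"
  proof (rule transI)
    fix p q r assume pq: "(p, q) \<in> mvn_rel A" and qr: "(q, r) \<in> mvn_rel A"
    obtain n m v w where 1: "p \<in> carrier_mat n n" "q \<in> carrier_mat m m" "v \<in> carrier_mat m n" "w \<in> carrier_mat n m"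
      "elements_mat v \<subseteq> A" "elements_mat w \<subseteq> A" "mat_is_adjoint w v" "p = w * v" "q = v * w"
      "p \<in> projections A" "q \<in> projections A" using pq by (rule mvn_relE)
    obtain m' k v' w' where 2: "q \<in> carrier_mat m' m'" "r \<in> carrier_mat k k" "v' \<in> carrier_mat k m'" "w' \<in> carrier_mat m' k"
      "elements_mat v' \<subseteq> A" "elements_mat w' \<subseteq> A" "mat_is_adjoint w' v'" "q = w' * v'" "r = v' * w'"
      "q \<in> projections A" "r \<in> projections A" using qr by (rule mvn_relE)
    have m: "m' = m" using 1(2) 2(1) by auto
    note 2 = 2[unfolded m]
    show "(p, r) \<in> mvn_rel A"
    proof (rule mvn_relI)
      show "v' * v \<in> carrier_mat k n" "w * w' \<in> carrier_mat n k" using 1 2 by auto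
      show "elements_mat (v' * v) \<subseteq> A" using 1 2 by (intro elements_mult_subset) auto
      show "mat_is_adjoint (w * w') (v' * v)" using 1 2 by (intro mat_is_adjoint_mult) auto
      show "p \<in> projections A" "r \<in> projections A" using 1 2 by auto
      \<comment> \<open>Here
        \<open>w * w' * v' * v = w * q * v = (w * v) * (w * v) = p * p = p\<close>; the computation
        for \<open>r\<close> is its mirror image.\<close>
      have "(w * w') * (v' * v) = w * (w' * (v' * v))" by (rule assoc_mult_mat[OF 1(4) 2(4)]) (use 1 2 in auto)
      also have "w' * (v' * v) = (w' * v') * v" by (rule assoc_mult_mat[OF 2(4,3) 1(3), symmetric])
      also have "\<dots> = v * (w * v)" unfolding 2(8)[symmetric] 1(9) by (rule assoc_mult_mat[OF 1(3,4,3)])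
      also have "w * (v * (w * v)) = (w * v) * (w * v)"
        by (rule assoc_mult_mat[OF 1(4,3), symmetric]) (use 1 in auto)
      also have "\<dots> = p" using projectionsD(3)[OF 1(10)] 1(8) by simp
      finally show "p = (w * w') * (v' * v)" ..
      have "(v' * v) * (w * w') = v' * (v * (w * w'))" by (rule assoc_mult_mat[OF 2(3) 1(3)]) (use 1 2 in auto)
      also have "v * (w * w') = (v * w) * w'" by (rule assoc_mult_mat[OF 1(3,4) 2(4), symmetric])
      also have "\<dots> = w' * (v' * w')" unfolding 1(9)[symmetric] 2(8) by (rule assoc_mult_mat[OF 2(4,3,4)])
      also have "v' * (w' * (v' * w')) = (v' * w') * (v' * w')"
        by (rule assoc_mult_mat[OF 2(3,4), symmetric]) (use 2 in auto)
      also have "\<dots> = r" using projectionsD(3)[OF 2(11)] 2(9) by simp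
      finally show "r = (v' * v) * (w * w')" ..
    qed
  qed
qed

lemma direct_sum_projections:
  assumes p: "p \<in> projections A" and q: "q \<in> projections A"
  shows "direct_sum_mat p q \<in> projections A"
proof (rule projectionsI)
  note P = projectionsD[OF p] and Q = projectionsD[OF q]
  show "direct_sum_mat p q \<in> carrier_mat (dim_row p + dim_row q) (dim_row p + dim_row q)"
    by (rule direct_sum_mat_carrier[OF P(1) Q(1)])
  show "elements_mat (direct_sum_mat p q) \<subseteq> A"
    by (rule elements_direct_sum_subset[OF P(2) Q(2) zero_closed])
  show "direct_sum_mat p q * direct_sum_mat p q = direct_sum_mat p q"
    using direct_sum_mat_mult[OF P(1) P(1) Q(1) Q(1)] P(3) Q(3) by simp
  show "mat_is_adjoint (direct_sum_mat p q) (direct_sum_mat p q)"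
    by (rule mat_is_adjoint_direct_sum[OF P(4) Q(4)])
qed

lemma mvn_direct_sum:
  assumes "(p, q) \<in> mvn_rel A" "(p', q') \<in> mvn_rel A"
  shows "(direct_sum_mat p p', direct_sum_mat q q') \<in> mvn_rel A"
proof -
  obtain n m v w where 1: "p \<in> carrier_mat n n" "q \<in> carrier_mat m m" "v \<in> carrier_mat m n" "w \<in> carrier_mat n m"
    "elements_mat v \<subseteq> A" "elements_mat w \<subseteq> A" "mat_is_adjoint w v" "p = w * v" "q = v * w"
    "p \<in> projections A" "q \<in> projections A" using assms(1) by (rule mvn_relE)
  obtain n' m' v' w' where 2: "p' \<in> carrier_mat n' n'" "q' \<in> carrier_mat m' m'" "v' \<in> carrier_mat m' n'" "w' \<in> carrier_mat n' m'"
    "elements_mat v' \<subseteq> A" "elements_mat w' \<subseteq> A" "mat_is_adjoint w' v'" "p' = w' * v'" "q' = v' * w'"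
    "p' \<in> projections A" "q' \<in> projections A" using assms(2) by (rule mvn_relE)
  show ?thesis
  proof (rule mvn_relI)
    show "direct_sum_mat v v' \<in> carrier_mat (m + m') (n + n')" "direct_sum_mat w w' \<in> carrier_mat (n + n') (m + m')"
      using 1 2 by (auto intro: direct_sum_mat_carrier)
    show "elements_mat (direct_sum_mat v v') \<subseteq> A"
      by (rule elements_direct_sum_subset[OF 1(5) 2(5) zero_closed])
    show "mat_is_adjoint (direct_sum_mat w w') (direct_sum_mat v v')"
      by (rule mat_is_adjoint_direct_sum[OF 1(7) 2(7)])
    show "direct_sum_mat p p' \<in> projections A" "direct_sum_mat q q' \<in> projections A"
      using 1 2 by (auto intro: direct_sum_projections)
    show "direct_sum_mat p p' = direct_sum_mat w w' * direct_sum_mat v v'"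
      using direct_sum_mat_mult[OF 1(4,3) 2(4,3)] 1(8) 2(8) by simp
    show "direct_sum_mat q q' = direct_sum_mat v v' * direct_sum_mat w w'"
      using direct_sum_mat_mult[OF 1(3,4) 2(3,4)] 1(9) 2(9) by simp
  qed
qed

lemma mvn_direct_sum_commute:
  assumes p: "p \<in> projections A" and q: "q \<in> projections A"
  shows "(direct_sum_mat p q, direct_sum_mat q p) \<in> mvn_rel A"
proof -
  note P = projectionsD[OF p] and Q = projectionsD[OF q]
  define n m where "n = dim_row p" and "m = dim_row q"
  have pc: "p \<in> carrier_mat n n" and qc: "q \<in> carrier_mat m m" unfolding n_def m_def by (rule P(1), rule Q(1))
  \<comment> \<open>The unitary that exchanges the two summands, cut down to the ranges of
    \<open>p\<close> and \<open>q\<close>; \<open>w\<close> is its adjoint.\<close>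
  define v where "v = four_block_mat (0\<^sub>m m n) q p (0\<^sub>m n m)"
  define w where "w = four_block_mat (0\<^sub>m n m) p q (0\<^sub>m m n)"
  show ?thesis
  proof (rule mvn_relI)
    show "v \<in> carrier_mat (m + n) (n + m)" "w \<in> carrier_mat (n + m) (m + n)"
      using pc qc by (auto simp: v_def w_def)
    show "elements_mat v \<subseteq> A"
      unfolding v_def
      by (rule elements_four_block_subset[where n = m and m = n and n' = n and m' = m])
        (simp_all add: pc qc P(2) Q(2) elements_zero_subset)
    show "mat_is_adjoint w v"
      unfolding v_def w_def
      by (rule mat_is_adjoint_four_block[where n = m and m = n and n' = n and m' = m])
        (simp_all add: pc qc P(4) Q(4) mat_is_adjoint_zero)
    show "direct_sum_mat p q \<in> projections A" "direct_sum_mat q p \<in> projections A"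
      using p q by (auto intro: direct_sum_projections)
    have "w * v = four_block_mat (0\<^sub>m n m * 0\<^sub>m m n + p * p) (0\<^sub>m n m * q + p * 0\<^sub>m n m)
        (q * 0\<^sub>m m n + 0\<^sub>m m n * p) (q * q + 0\<^sub>m m n * 0\<^sub>m n m)"
      unfolding w_def v_def by (rule mult_four_block_mat) (use pc qc in auto)
    also have "\<dots> = four_block_mat p (0\<^sub>m n m) (0\<^sub>m m n) q"
      using pc qc P(3) Q(3) by (intro arg_cong4[where f = four_block_mat]) auto
    finally show "direct_sum_mat p q = w * v" using pc qc by (auto simp: direct_sum_mat_def)
    have "v * w = four_block_mat (0\<^sub>m m n * 0\<^sub>m n m + q * q) (0\<^sub>m m n * p + q * 0\<^sub>m m n)
        (p * 0\<^sub>m n m + 0\<^sub>m n m * q) (p * p + 0\<^sub>m n m * 0\<^sub>m m n)"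
      unfolding w_def v_def by (rule mult_four_block_mat) (use pc qc in auto)
    also have "\<dots> = four_block_mat q (0\<^sub>m m n) (0\<^sub>m n m) p"
      using pc qc P(3) Q(3) by (intro arg_cong4[where f = four_block_mat]) auto
    finally show "direct_sum_mat q p = v * w" using pc qc by (auto simp: direct_sum_mat_def)
  qed
qed

lemma one_mat_projection: "1\<^sub>m n \<in> projections A"
proof (rule projectionsI)
  show "elements_mat (1\<^sub>m n) \<subseteq> A"
    unfolding elements_mat_subset_iff by (simp add: zero_closed one_closed)
  show "mat_is_adjoint (1\<^sub>m n) (1\<^sub>m n :: 'i bop mat)"
    unfolding mat_is_adjoint_def by (auto simp: is_adjoint_simps)
qed auto

lemma complement_projection:
  assumes e: "e \<in> projections A" "e \<in> carrier_mat n n"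
  shows "1\<^sub>m n - e \<in> projections A" "e * (1\<^sub>m n - e) = 0\<^sub>m n n" "(1\<^sub>m n - e) * e = 0\<^sub>m n n"
proof -
  note E = projectionsD[OF e(1)]
  have a: "e * (1\<^sub>m n - e) = e * 1\<^sub>m n - e * e"
    by (rule mult_minus_distrib_mat[OF e(2)]) (use e in auto)
  then show 1: "e * (1\<^sub>m n - e) = 0\<^sub>m n n" using e E(3) by auto
  have "(1\<^sub>m n - e) * e = 1\<^sub>m n * e - e * e"
    by (rule minus_mult_distrib_mat) (use e in auto)
  then show "(1\<^sub>m n - e) * e = 0\<^sub>m n n" using e E(3) by auto
  show "1\<^sub>m n - e \<in> projections A"
  proof (rule projectionsI)
    show "1\<^sub>m n - e \<in> carrier_mat n n" using e(2) by auto
    show "elements_mat (1\<^sub>m n - e) \<subseteq> A"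
      using E(2) e(2) unfolding elements_mat_subset_iff by (auto intro!: minus_closed uminus_closed zero_closed one_closed)
    have "(1\<^sub>m n - e) * (1\<^sub>m n - e) = 1\<^sub>m n * (1\<^sub>m n - e) - e * (1\<^sub>m n - e)"
      by (rule minus_mult_distrib_mat) (use e in auto)
    then show "(1\<^sub>m n - e) * (1\<^sub>m n - e) = 1\<^sub>m n - e" unfolding 1 using e(2) by auto
    have "mat_is_adjoint (1\<^sub>m n) (1\<^sub>m n :: 'i bop mat)" by (rule projectionsD(4)[OF one_mat_projection])
    then show "mat_is_adjoint (1\<^sub>m n - e) (1\<^sub>m n - e)"
      using E(4) e(2) unfolding mat_is_adjoint_def by (auto intro!: is_adjoint_minus intro: is_adjoint_simps)
  qed
qed

text \<open>The row with entries \<open>e\<close> and \<open>f = 1 - e\<close> implements the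
  equivalence: multiplied with its adjoint it gives \<open>e + f = 1\<close> in one order and, as
  \<open>e\<close> and \<open>f\<close> annihilate each other, the direct sum of \<open>e\<close>
  and \<open>f\<close> in the other.\<close>

lemma mvn_complement:
  assumes e: "e \<in> projections A" "e \<in> carrier_mat n n"
  shows "(direct_sum_mat e (1\<^sub>m n - e), 1\<^sub>m n) \<in> mvn_rel A"
proof -
  define f where "f = 1\<^sub>m n - e"
  have f: "f \<in> projections A" "e * f = 0\<^sub>m n n" "f * e = 0\<^sub>m n n" "f \<in> carrier_mat n n"
    using complement_projection[OF e] e(2) by (auto simp: f_def)
  note E = projectionsD[OF e(1)] and F = projectionsD[OF f(1)]
  \<comment> \<open>A single block row, padded with blocks of height zero so that the product rule
    for four blocks applies; \<open>w\<close> is padded with blocks of width zero.\<close>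
  define v where "v = four_block_mat e f (0\<^sub>m 0 n) (0\<^sub>m 0 n)"
  define w where "w = four_block_mat e (0\<^sub>m n 0) f (0\<^sub>m n 0)"
  have "(direct_sum_mat e f, 1\<^sub>m n) \<in> mvn_rel A"
  proof (rule mvn_relI)
    show "v \<in> carrier_mat (n + 0) (n + n)" "w \<in> carrier_mat (n + n) (n + 0)"
      using e f by (auto simp: v_def w_def)
    show "elements_mat v \<subseteq> A"
      unfolding v_def
      by (rule elements_four_block_subset[where n = n and m = n and n' = 0 and m' = n])
        (simp_all add: e(2) f(4) E(2) F(2) elements_zero_subset)
    show "mat_is_adjoint w v"
      unfolding v_def w_def
      by (rule mat_is_adjoint_four_block[where n = n and m = n and n' = 0 and m' = n])
        (simp_all add: e(2) f(4) E(4) F(4) mat_is_adjoint_zero)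
    show "direct_sum_mat e f \<in> projections A" using e f by (auto intro: direct_sum_projections)
    show "1\<^sub>m n \<in> projections A" by (rule one_mat_projection)
    have "w * v = four_block_mat (e * e + 0\<^sub>m n 0 * 0\<^sub>m 0 n) (e * f + 0\<^sub>m n 0 * 0\<^sub>m 0 n)
        (f * e + 0\<^sub>m n 0 * 0\<^sub>m 0 n) (f * f + 0\<^sub>m n 0 * 0\<^sub>m 0 n)"
      unfolding w_def v_def by (rule mult_four_block_mat) (use e f in auto)
    also have "\<dots> = four_block_mat e (0\<^sub>m n n) (0\<^sub>m n n) f"
      using e(2) f(2,3,4) E(3) F(3) by (intro arg_cong4[where f = four_block_mat]) auto
    finally show "direct_sum_mat e f = w * v" using e(2) f(4) by (auto simp: direct_sum_mat_def)
    have "v * w = four_block_mat (e * e + f * f) (e * 0\<^sub>m n 0 + f * 0\<^sub>m n 0)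
        (0\<^sub>m 0 n * e + 0\<^sub>m 0 n * f) (0\<^sub>m 0 n * 0\<^sub>m n 0 + 0\<^sub>m 0 n * 0\<^sub>m n 0)"
      unfolding w_def v_def by (rule mult_four_block_mat) (use e f in auto)
    also have "\<dots> = 1\<^sub>m n"
      unfolding E(3) F(3) by (rule eq_matI) (use e(2) in \<open>auto simp: f_def\<close>)
    finally show "1\<^sub>m n = v * w" ..
  qed
  then show ?thesis by (simp add: f_def)
qed

abbreviation (input) mclass where "mclass p \<equiv> mvn_rel A `` {p}"

lemma mclass_eq_iff: "p \<in> projections A \<Longrightarrow> q \<in> projections A \<Longrightarrow> mclass p = mclass q \<longleftrightarrow> (p, q) \<in> mvn_rel A"
  by (rule eq_equiv_class_iff[OF equiv_mvn_rel])

lemma mem_mclass: "q \<in> mclass p \<Longrightarrow> p \<in> projections A \<and> q \<in> projections A \<and> mclass q = mclass p"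
  using equiv_class_eq[OF equiv_mvn_rel, of p q] unfolding mvn_rel_def by auto

lemma mclass_closed: "p \<in> projections A \<Longrightarrow> mclass p \<in> carrier (projection_monoid A)"
  unfolding projection_monoid_def by (simp add: quotientI)

lemma projection_monoid_cases:
  assumes "X \<in> carrier (projection_monoid A)"
  obtains p where "p \<in> projections A" "X = mclass p"
  using assms unfolding projection_monoid_def quotient_def by auto

lemma mclass_mult:
  assumes p: "p \<in> projections A" and q: "q \<in> projections A"
  shows "mclass p \<otimes>\<^bsub>projection_monoid A\<^esub> mclass q = mclass (direct_sum_mat p q)"
proof -
  have const: "mclass (direct_sum_mat p' q') = mclass (direct_sum_mat p q)"
    if "p' \<in> mclass p" "q' \<in> mclass q" for p' q'
    using that by (intro equiv_class_eq[OF equiv_mvn_rel, symmetric] mvn_direct_sum) auto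
  have "p \<in> mclass p" "q \<in> mclass q" using p q equiv_class_self[OF equiv_mvn_rel] by auto
  then have ne: "mclass p \<noteq> {}" "mclass q \<noteq> {}" by blast+
  have "mclass p \<otimes>\<^bsub>projection_monoid A\<^esub> mclass q = (\<Union>p'\<in>mclass p. \<Union>q'\<in>mclass q. mclass (direct_sum_mat p' q'))"
    unfolding projection_monoid_def by simp
  also have "\<dots> = (\<Union>p'\<in>mclass p. \<Union>q'\<in>mclass q. mclass (direct_sum_mat p q))"
    using const by simp
  also have "\<dots> = mclass (direct_sum_mat p q)" using ne by simp
  finally show ?thesis .
qed

lemma empty_projection: "0\<^sub>m 0 0 \<in> projections A"
  by (rule projectionsI[of _ 0]) (auto simp: elements_mat_subset_iff mat_is_adjoint_def)

lemma mclass_one: "\<one>\<^bsub>projection_monoid A\<^esub> = mclass (0\<^sub>m 0 0)"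
  by (simp add: projection_monoid_def)

lemma comm_monoid_projection_monoid: "comm_monoid (projection_monoid A)"
proof (rule comm_monoidI)
  let ?M = "projection_monoid A"
  show "\<one>\<^bsub>?M\<^esub> \<in> carrier ?M" unfolding mclass_one by (rule mclass_closed[OF empty_projection])
  fix X assume "X \<in> carrier ?M"
  then obtain p where X: "p \<in> projections A" "X = mclass p" by (rule projection_monoid_cases)
  show "\<one>\<^bsub>?M\<^esub> \<otimes>\<^bsub>?M\<^esub> X = X"
    unfolding X(2) mclass_one mclass_mult[OF empty_projection X(1)] direct_sum_mat_empty ..
  fix Y assume "Y \<in> carrier ?M"
  then obtain q where Y: "q \<in> projections A" "Y = mclass q" by (rule projection_monoid_cases)
  show "X \<otimes>\<^bsub>?M\<^esub> Y \<in> carrier ?M"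
    unfolding X(2) Y(2) mclass_mult[OF X(1) Y(1)] by (intro mclass_closed direct_sum_projections X Y)
  show "X \<otimes>\<^bsub>?M\<^esub> Y = Y \<otimes>\<^bsub>?M\<^esub> X"
    unfolding X(2) Y(2) mclass_mult[OF X(1) Y(1)] mclass_mult[OF Y(1) X(1)]
    by (rule equiv_class_eq[OF equiv_mvn_rel mvn_direct_sum_commute[OF X(1) Y(1)]])
  fix Z assume "Z \<in> carrier ?M"
  then obtain r where Z: "r \<in> projections A" "Z = mclass r" by (rule projection_monoid_cases)
  show "X \<otimes>\<^bsub>?M\<^esub> Y \<otimes>\<^bsub>?M\<^esub> Z = X \<otimes>\<^bsub>?M\<^esub> (Y \<otimes>\<^bsub>?M\<^esub> Z)"
    unfolding X(2) Y(2) Z(2) using X(1) Y(1) Z(1)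
    by (simp only: mclass_mult direct_sum_projections direct_sum_mat_assoc)
qed

sublocale M: comm_monoid "projection_monoid A"
  by (rule comm_monoid_projection_monoid)

lemma comm_group_K0: "comm_group (K0 A)"
  unfolding K0_def by (rule M.comm_group_grothendieck_group)

lemma K0_class_closed: "p \<in> projections A \<Longrightarrow> q \<in> projections A \<Longrightarrow> K0_class A p q \<in> carrier (K0 A)"
  unfolding K0_def K0_class_def by (intro M.gclass_closed mclass_closed)

lemma K0_cases:
  assumes "X \<in> carrier (K0 A)"
  obtains p q where "p \<in> projections A" "q \<in> projections A" "X = K0_class A p q"
proof -
  obtain a b where ab: "a \<in> carrier (projection_monoid A)" "b \<in> carrier (projection_monoid A)"
    "X = grothendieck_rel (projection_monoid A) `` {(a, b)}"
    using assms unfolding K0_def by (rule M.grothendieck_group_cases)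
  obtain p where p: "p \<in> projections A" "a = mclass p" using ab(1) by (rule projection_monoid_cases)
  obtain q where q: "q \<in> projections A" "b = mclass q" using ab(2) by (rule projection_monoid_cases)
  show thesis using that[OF p(1) q(1)] ab(3) p(2) q(2) by (simp add: K0_class_def)
qed

lemma K0_class_mult:
  assumes "p \<in> projections A" "q \<in> projections A" "p' \<in> projections A" "q' \<in> projections A"
  shows "K0_class A p q \<otimes>\<^bsub>K0 A\<^esub> K0_class A p' q' = K0_class A (direct_sum_mat p p') (direct_sum_mat q q')"
  using assms unfolding K0_def K0_class_def by (simp add: M.gclass_mult mclass_closed mclass_mult)

lemma K0_class_diag: "p \<in> projections A \<Longrightarrow> K0_class A p p = \<one>\<^bsub>K0 A\<^esub>"
  unfolding K0_def K0_class_def by (intro M.gclass_diag mclass_closed)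

lemma K0_class_eq_iff:
  assumes "p \<in> projections A" "q \<in> projections A" "p' \<in> projections A" "q' \<in> projections A"
  shows "K0_class A p q = K0_class A p' q' \<longleftrightarrow>
    (\<exists>e\<in>projections A. (direct_sum_mat (direct_sum_mat p q') e, direct_sum_mat (direct_sum_mat p' q) e) \<in> mvn_rel A)"
proof -
  have "K0_class A p q = K0_class A p' q' \<longleftrightarrow> (\<exists>c\<in>carrier (projection_monoid A).
      mclass p \<otimes>\<^bsub>projection_monoid A\<^esub> mclass q' \<otimes>\<^bsub>projection_monoid A\<^esub> c
    = mclass p' \<otimes>\<^bsub>projection_monoid A\<^esub> mclass q \<otimes>\<^bsub>projection_monoid A\<^esub> c)"
    unfolding K0_class_def by (rule M.gclass_eq_iff) (use assms in \<open>auto intro: mclass_closed\<close>)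
  also have "\<dots> \<longleftrightarrow> (\<exists>e\<in>projections A. mclass (direct_sum_mat (direct_sum_mat p q') e) = mclass (direct_sum_mat (direct_sum_mat p' q) e))"
  proof
    assume "\<exists>c\<in>carrier (projection_monoid A).
      mclass p \<otimes>\<^bsub>projection_monoid A\<^esub> mclass q' \<otimes>\<^bsub>projection_monoid A\<^esub> c
    = mclass p' \<otimes>\<^bsub>projection_monoid A\<^esub> mclass q \<otimes>\<^bsub>projection_monoid A\<^esub> c"
    then obtain c where c: "c \<in> carrier (projection_monoid A)"
      "mclass p \<otimes>\<^bsub>projection_monoid A\<^esub> mclass q' \<otimes>\<^bsub>projection_monoid A\<^esub> c
      = mclass p' \<otimes>\<^bsub>projection_monoid A\<^esub> mclass q \<otimes>\<^bsub>projection_monoid A\<^esub> c" ..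
    obtain e where e: "e \<in> projections A" "c = mclass e" using c(1) by (rule projection_monoid_cases)
    show "\<exists>e\<in>projections A. mclass (direct_sum_mat (direct_sum_mat p q') e) = mclass (direct_sum_mat (direct_sum_mat p' q) e)"
      using c(2) e assms by (intro bexI[of _ e]) (simp_all add: mclass_mult direct_sum_projections)
  next
    assume "\<exists>e\<in>projections A. mclass (direct_sum_mat (direct_sum_mat p q') e) = mclass (direct_sum_mat (direct_sum_mat p' q) e)"
    then obtain e where e: "e \<in> projections A"
      "mclass (direct_sum_mat (direct_sum_mat p q') e) = mclass (direct_sum_mat (direct_sum_mat p' q) e)" ..
    show "\<exists>c\<in>carrier (projection_monoid A).
      mclass p \<otimes>\<^bsub>projection_monoid A\<^esub> mclass q' \<otimes>\<^bsub>projection_monoid A\<^esub> c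
    = mclass p' \<otimes>\<^bsub>projection_monoid A\<^esub> mclass q \<otimes>\<^bsub>projection_monoid A\<^esub> c"
      using e assms by (intro bexI[of _ "mclass e"]) (simp_all add: mclass_mult direct_sum_projections mclass_closed)
  qed
  also have "\<dots> \<longleftrightarrow> (\<exists>e\<in>projections A. (direct_sum_mat (direct_sum_mat p q') e, direct_sum_mat (direct_sum_mat p' q) e) \<in> mvn_rel A)"
    using assms by (intro bex_cong refl mclass_eq_iff direct_sum_projections)
  finally show ?thesis .
qed

lemma K0_class_cong:
  assumes "(p, p') \<in> mvn_rel A" "(q, q') \<in> mvn_rel A"
  shows "K0_class A p q = K0_class A p' q'"
  using equiv_class_eq[OF equiv_mvn_rel assms(1)] equiv_class_eq[OF equiv_mvn_rel assms(2)]
  by (simp add: K0_class_def)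

end

section \<open>Functoriality of \<open>K0\<close>\<close>

locale star_hom = A: star_algebra A + B: star_algebra B
  for A :: "'i bop set" and B :: "'j bop set" +
  fixes \<phi> :: "'i bop \<Rightarrow> 'j bop"
  assumes hom_closed: "T \<in> A \<Longrightarrow> \<phi> T \<in> B"
    and hom_zero: "\<phi> 0 = 0"
    and hom_plus: "S \<in> A \<Longrightarrow> T \<in> A \<Longrightarrow> \<phi> (S + T) = \<phi> S + \<phi> T"
    and hom_mult: "S \<in> A \<Longrightarrow> T \<in> A \<Longrightarrow> \<phi> (S * T) = \<phi> S * \<phi> T"
    and hom_adjoint: "S \<in> A \<Longrightarrow> T \<in> A \<Longrightarrow> is_adjoint S T \<Longrightarrow> is_adjoint (\<phi> S) (\<phi> T)"
begin

lemma hom_sum: "(\<And>i. i \<in> I \<Longrightarrow> T i \<in> A) \<Longrightarrow> \<phi> (\<Sum>i\<in>I. T i) = (\<Sum>i\<in>I. \<phi> (T i))"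
  by (induction I rule: infinite_finite_induct) (simp_all add: hom_zero hom_plus A.sum_closed)

lemma map_mat_mult:
  assumes "elements_mat a \<subseteq> A" "elements_mat b \<subseteq> A" "dim_col a = dim_row b"
  shows "map_mat \<phi> (a * b) = map_mat \<phi> a * map_mat \<phi> b"
proof (rule eq_matI)
  fix i j assume "i < dim_row (map_mat \<phi> a * map_mat \<phi> b)" "j < dim_col (map_mat \<phi> a * map_mat \<phi> b)"
  then have ij: "i < dim_row a" "j < dim_col b" by simp_all
  have "map_mat \<phi> (a * b) $$ (i, j) = \<phi> (\<Sum>k<dim_row b. a $$ (i, k) * b $$ (k, j))"
    using ij index_mult_mat_sum[OF ij assms(3)] by simp
  also have "\<dots> = (\<Sum>k<dim_row b. \<phi> (a $$ (i, k) * b $$ (k, j)))"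
    using assms ij unfolding elements_mat_subset_iff by (intro hom_sum A.mult_closed) auto
  also have "\<dots> = (\<Sum>k<dim_row b. map_mat \<phi> a $$ (i, k) * map_mat \<phi> b $$ (k, j))"
    using assms ij unfolding elements_mat_subset_iff by (intro sum.cong refl) (auto simp: hom_mult)
  also have "\<dots> = (map_mat \<phi> a * map_mat \<phi> b) $$ (i, j)"
    using ij assms(3) by (subst index_mult_mat_sum) auto
  finally show "map_mat \<phi> (a * b) $$ (i, j) = (map_mat \<phi> a * map_mat \<phi> b) $$ (i, j)" .
qed simp_all

lemma map_mat_elements: "elements_mat a \<subseteq> A \<Longrightarrow> elements_mat (map_mat \<phi> a) \<subseteq> B"
  unfolding elements_mat_subset_iff by (simp add: hom_closed)

lemma map_mat_adjoint:
  assumes "mat_is_adjoint w v" "elements_mat v \<subseteq> A"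
  shows "mat_is_adjoint (map_mat \<phi> w) (map_mat \<phi> v)"
proof -
  have d: "dim_row w = dim_col v" "dim_col w = dim_row v" using assms(1) unfolding mat_is_adjoint_def by auto
  have w: "elements_mat w \<subseteq> A" by (rule A.elements_adjoint_subset[OF assms])
  show ?thesis
    unfolding mat_is_adjoint_def
  proof (intro conjI allI impI)
    fix i j assume "i < dim_row (map_mat \<phi> v)" "j < dim_col (map_mat \<phi> v)"
    then have ij: "i < dim_row v" "j < dim_col v" by simp_all
    have "is_adjoint (\<phi> (w $$ (j, i))) (\<phi> (v $$ (i, j)))"
      using assms w ij d unfolding elements_mat_subset_iff mat_is_adjoint_def by (intro hom_adjoint) auto
    then show "is_adjoint (map_mat \<phi> w $$ (j, i)) (map_mat \<phi> v $$ (i, j))" using ij d by simp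
  qed (simp_all add: d)
qed

lemma map_mat_projections:
  assumes p: "p \<in> projections A"
  shows "map_mat \<phi> p \<in> projections B"
proof (rule B.projectionsI)
  note P = A.projectionsD[OF p]
  show "map_mat \<phi> p \<in> carrier_mat (dim_row p) (dim_row p)" using P(1) by (rule map_carrier_mat[THEN iffD2])
  show "elements_mat (map_mat \<phi> p) \<subseteq> B" by (rule map_mat_elements[OF P(2)])
  have "dim_col p = dim_row p" using P(1) by (rule carrier_matD)
  then show "map_mat \<phi> p * map_mat \<phi> p = map_mat \<phi> p" using map_mat_mult[OF P(2) P(2)] P(3) by simp
  show "mat_is_adjoint (map_mat \<phi> p) (map_mat \<phi> p)" by (rule map_mat_adjoint[OF P(4,2)])
qed

lemma map_mat_mvn:
  assumes "(p, q) \<in> mvn_rel A"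
  shows "(map_mat \<phi> p, map_mat \<phi> q) \<in> mvn_rel B"
proof -
  obtain n m v w where 1: "p \<in> carrier_mat n n" "q \<in> carrier_mat m m" "v \<in> carrier_mat m n" "w \<in> carrier_mat n m"
    "elements_mat v \<subseteq> A" "elements_mat w \<subseteq> A" "mat_is_adjoint w v" "p = w * v" "q = v * w"
    "p \<in> projections A" "q \<in> projections A" using assms by (rule A.mvn_relE)
  show ?thesis
  proof (rule B.mvn_relI)
    show "map_mat \<phi> v \<in> carrier_mat m n" "map_mat \<phi> w \<in> carrier_mat n m" using 1(3,4) by simp_all
    show "elements_mat (map_mat \<phi> v) \<subseteq> B" by (rule map_mat_elements[OF 1(5)])
    show "mat_is_adjoint (map_mat \<phi> w) (map_mat \<phi> v)" by (rule map_mat_adjoint[OF 1(7,5)])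
    show "map_mat \<phi> p \<in> projections B" "map_mat \<phi> q \<in> projections B" using 1(10,11) by (auto intro: map_mat_projections)
    have d: "dim_col w = dim_row v" "dim_col v = dim_row w" using 1(3,4) by auto
    show "map_mat \<phi> p = map_mat \<phi> w * map_mat \<phi> v" unfolding 1(8) by (rule map_mat_mult[OF 1(6,5) d(1)])
    show "map_mat \<phi> q = map_mat \<phi> v * map_mat \<phi> w" unfolding 1(9) by (rule map_mat_mult[OF 1(5,6) d(2)])
  qed
qed

lemma K0_class_map_eq:
  assumes "p \<in> projections A" "q \<in> projections A" "p' \<in> projections A" "q' \<in> projections A"
    and "K0_class A p q = K0_class A p' q'"
  shows "K0_class B (map_mat \<phi> p) (map_mat \<phi> q) = K0_class B (map_mat \<phi> p') (map_mat \<phi> q')"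
proof -
  obtain e where e: "e \<in> projections A"
    "(direct_sum_mat (direct_sum_mat p q') e, direct_sum_mat (direct_sum_mat p' q) e) \<in> mvn_rel A"
    using assms(5) A.K0_class_eq_iff[OF assms(1-4)] by auto
  have "(direct_sum_mat (direct_sum_mat (map_mat \<phi> p) (map_mat \<phi> q')) (map_mat \<phi> e),
      direct_sum_mat (direct_sum_mat (map_mat \<phi> p') (map_mat \<phi> q)) (map_mat \<phi> e)) \<in> mvn_rel B"
    using map_mat_mvn[OF e(2)] by (simp only: map_mat_direct_sum[of \<phi>, OF hom_zero])
  then show ?thesis
    using B.K0_class_eq_iff[OF map_mat_projections[OF assms(1)] map_mat_projections[OF assms(2)]
      map_mat_projections[OF assms(3)] map_mat_projections[OF assms(4)]] map_mat_projections[OF e(1)] by blast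
qed

text \<open>All representatives of a class have images of the same class, so the union in the
  definition of \<open>K0_map\<close> is a singleton.\<close>

lemma K0_map_class:
  assumes p: "p \<in> projections A" and q: "q \<in> projections A"
  shows "K0_map B \<phi> (K0_class A p q) = K0_class B (map_mat \<phi> p) (map_mat \<phi> q)"
proof -
  let ?X = "K0_class A p q" and ?c = "K0_class B (map_mat \<phi> p) (map_mat \<phi> q)"
  let ?f = "\<lambda>(a, b). {K0_class B (map_mat \<phi> p) (map_mat \<phi> q) | p q. p \<in> a \<and> q \<in> b}"
  have "(\<Union>x\<in>?X. ?f x) = {?c}"
  proof (intro equalityI subsetI)
    fix Z assume "Z \<in> (\<Union>x\<in>?X. ?f x)"
    then obtain a b p' q' where ab: "(a, b) \<in> ?X" "p' \<in> a" "q' \<in> b"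
      "Z = K0_class B (map_mat \<phi> p') (map_mat \<phi> q')" by auto
    have carr: "a \<in> carrier (projection_monoid A)" "b \<in> carrier (projection_monoid A)"
      and eq: "grothendieck_rel (projection_monoid A) `` {(a, b)} = ?X"
      using ab(1) unfolding K0_class_def A.M.mem_gclass_iff by auto
    obtain p0 where p0: "a = mvn_rel A `` {p0}" using carr(1) by (rule A.projection_monoid_cases)
    obtain q0 where q0: "b = mvn_rel A `` {q0}" using carr(2) by (rule A.projection_monoid_cases)
    have p': "p' \<in> projections A" "mvn_rel A `` {p'} = a" using A.mem_mclass[of p' p0] ab(2) unfolding p0 by auto
    have q': "q' \<in> projections A" "mvn_rel A `` {q'} = b" using A.mem_mclass[of q' q0] ab(3) unfolding q0 by auto
    have "K0_class A p' q' = ?X" using eq p'(2) q'(2) unfolding K0_class_def by simp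
    from K0_class_map_eq[OF p'(1) q'(1) p q this] show "Z \<in> {?c}" unfolding ab(4) by simp
  next
    fix Z assume "Z \<in> {?c}"
    have "(mvn_rel A `` {p}, mvn_rel A `` {q}) \<in> ?X"
      unfolding K0_class_def A.M.mem_gclass_iff using p q by (simp add: A.mclass_closed)
    moreover have "p \<in> mvn_rel A `` {p}" "q \<in> mvn_rel A `` {q}"
      using p q equiv_class_self[OF A.equiv_mvn_rel] by auto
    then have "Z \<in> ?f (mvn_rel A `` {p}, mvn_rel A `` {q})"
      using \<open>Z \<in> {?c}\<close> by auto
    ultimately show "Z \<in> (\<Union>x\<in>?X. ?f x)" by (rule UN_I)
  qed
  then show ?thesis unfolding K0_map_def by simp
qed

lemma K0_map_hom: "K0_map B \<phi> \<in> hom (K0 A) (K0 B)"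
proof (rule homI)
  fix X assume "X \<in> carrier (K0 A)"
  then obtain p q where X: "p \<in> projections A" "q \<in> projections A" "X = K0_class A p q" by (rule A.K0_cases)
  show "K0_map B \<phi> X \<in> carrier (K0 B)"
    unfolding X(3) K0_map_class[OF X(1,2)] by (intro B.K0_class_closed map_mat_projections X)
  fix Y assume "Y \<in> carrier (K0 A)"
  then obtain p' q' where Y: "p' \<in> projections A" "q' \<in> projections A" "Y = K0_class A p' q'" by (rule A.K0_cases)
  show "K0_map B \<phi> (X \<otimes>\<^bsub>K0 A\<^esub> Y) = K0_map B \<phi> X \<otimes>\<^bsub>K0 B\<^esub> K0_map B \<phi> Y"
    unfolding X(3) Y(3) using X(1,2) Y(1,2)
    by (simp add: A.K0_class_mult B.K0_class_mult K0_map_class A.direct_sum_projections map_mat_projections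
        map_mat_direct_sum[of \<phi>, OF hom_zero])
qed

end

lemma star_hom_inclusion: "star_algebra A \<Longrightarrow> star_algebra B \<Longrightarrow> A \<subseteq> B \<Longrightarrow> star_hom A B (\<lambda>T. T)"
  unfolding star_hom_def star_hom_axioms_def by auto

section \<open>Diagonal projections\<close>

lemma fibrewise_bijection:
  assumes "\<And>x. finite (F x)" "\<And>x. finite (F' x)" "\<And>x. card (F x) = card (F' x)"
  shows "\<exists>\<theta>. bij_betw \<theta> (Sigma UNIV F) (Sigma UNIV F') \<and> (\<forall>p\<in>Sigma UNIV F. fst (\<theta> p) = fst p)"
proof -
  have "\<forall>x. \<exists>f. bij_betw f (F x) (F' x)"
    using assms by (auto intro: finite_same_card_bij)
  from choice[OF this] obtain f where f: "\<And>x. bij_betw (f x) (F x) (F' x)" by auto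
  have "bij_betw (\<lambda>(x, k). (x, f x k)) (Sigma UNIV F) (Sigma UNIV F')"
    unfolding bij_betw_def
  proof
    show "inj_on (\<lambda>(x, k). (x, f x k)) (Sigma UNIV F)"
      using f unfolding bij_betw_def by (auto simp: inj_on_def)
    show "(\<lambda>(x, k). (x, f x k)) ` Sigma UNIV F = Sigma UNIV F'"
    proof (intro equalityI subsetI)
      fix p assume "p \<in> (\<lambda>(x, k). (x, f x k)) ` Sigma UNIV F"
      then show "p \<in> Sigma UNIV F'" using f unfolding bij_betw_def by auto
    next
      fix p assume p: "p \<in> Sigma UNIV F'"
      obtain x l where xl: "p = (x, l)" by fastforce
      then have "l \<in> f x ` F x" using p f[of x] unfolding bij_betw_def by simp
      then obtain k where "k \<in> F x" "l = f x k" by auto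
      then show "p \<in> (\<lambda>(x, k). (x, f x k)) ` Sigma UNIV F" unfolding xl by (intro image_eqI[of _ _ "(x, k)"]) auto
    qed
  qed
  then show ?thesis by (intro exI[of _ "\<lambda>(x, k). (x, f x k)"]) auto
qed

definition ind :: "bool \<Rightarrow> complex" where "ind b = (if b then 1 else 0)"

lemma ind_mult: "ind b * z = (if b then z else 0)"
  by (simp add: ind_def)

lemma bounded_ind: "bounded (range (\<lambda>x. ind (P x)))"
  unfolding bounded_iff ind_def by (auto intro!: exI[of _ 1])

text \<open>
  \<open>E\<close> lists the basis vectors: \<open>(x, k) \<in> E\<close> if the range contains \<open>\<delta>\<^sub>x\<close> in the \<open>k\<close>-th summand.
\<close>

definition diag_projection :: "nat \<Rightarrow> ('i \<times> nat) set \<Rightarrow> 'i bop mat" where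
  "diag_projection n E = mat_diag n (\<lambda>k. mult_op (\<lambda>x. ind ((x, k) \<in> E)))"

text \<open>Block \<open>(l, k)\<close> of the partial isometry that pulls functions back along
  \<theta>: the value at \<open>(x, l)\<close> is read at \<open>\<theta> (x, l)\<close>, and the
  block is active where this point lies in summand \<open>k\<close>.\<close>

definition matrix_unit :: "('i \<times> nat) set \<Rightarrow> ('i \<times> nat \<Rightarrow> 'i \<times> nat) \<Rightarrow> nat \<Rightarrow> nat \<Rightarrow> 'i bop" where
  "matrix_unit E \<theta> l k = partial_shift (\<lambda>x. ind ((x, l) \<in> E \<and> snd (\<theta> (x, l)) = k)) (\<lambda>x. fst (\<theta> (x, l)))"

lemma inj_matrix_unit:
  assumes "inj_on \<theta> E"
  shows "inj_on (\<lambda>x. fst (\<theta> (x, l))) {x. ind ((x, l) \<in> E \<and> snd (\<theta> (x, l)) = k) \<noteq> 0}"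
proof (rule inj_onI)
  fix x y
  assume "x \<in> {x. ind ((x, l) \<in> E \<and> snd (\<theta> (x, l)) = k) \<noteq> 0}"
    "y \<in> {x. ind ((x, l) \<in> E \<and> snd (\<theta> (x, l)) = k) \<noteq> 0}" and eq: "fst (\<theta> (x, l)) = fst (\<theta> (y, l))"
  then have "(x, l) \<in> E" "(y, l) \<in> E" "\<theta> (x, l) = \<theta> (y, l)"
    by (auto simp: ind_def prod_eq_iff split: if_splits)
  then show "x = y" using inj_onD[OF assms] by blast
qed

lemma matrix_unit_apply:
  assumes "inj_on \<theta> E"
  shows "ell2_apply (bop_apply (matrix_unit E \<theta> l k) v) x =
    (if (x, l) \<in> E \<and> snd (\<theta> (x, l)) = k then ell2_apply v (fst (\<theta> (x, l))) else 0)"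
  unfolding matrix_unit_def partial_shift_apply[OF bounded_ind inj_matrix_unit[OF assms]] ind_mult ..

text \<open>Pulling back along a bijection has pulling back along its inverse as adjoint. For a
  single block this is reindexing by the points that \<theta> carries from summand \<open>k\<close>
  to summand \<open>l\<close>.\<close>

lemma matrix_unit_adjoint:
  assumes inj: "inj_on \<theta> E" "inj_on \<theta>' E'"
    and \<theta>: "\<And>p. p \<in> E \<Longrightarrow> \<theta> p \<in> E' \<and> \<theta>' (\<theta> p) = p"
    and \<theta>': "\<And>p. p \<in> E' \<Longrightarrow> \<theta>' p \<in> E \<and> \<theta> (\<theta>' p) = p"
  shows "is_adjoint (matrix_unit E \<theta> k l) (matrix_unit E' \<theta>' l k)"
  unfolding is_adjoint_def
proof (intro allI)
  fix a b
  let ?X = "{x. (x, k) \<in> E \<and> snd (\<theta> (x, k)) = l}" and ?Y = "{y. (y, l) \<in> E' \<and> snd (\<theta>' (y, l)) = k}"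
  let ?g = "\<lambda>y. ell2_apply a y * cnj (ell2_apply b (fst (\<theta>' (y, l))))"
  have fwd: "(fst (\<theta> (x, k)), l) \<in> E'" "\<theta>' (fst (\<theta> (x, k)), l) = (x, k)" if "x \<in> ?X" for x
  proof -
    have "\<theta> (x, k) = (fst (\<theta> (x, k)), l)" using that by (simp add: prod_eq_iff)
    then show "(fst (\<theta> (x, k)), l) \<in> E'" "\<theta>' (fst (\<theta> (x, k)), l) = (x, k)" using \<theta>[of "(x, k)"] that by auto
  qed
  have bwd: "(fst (\<theta>' (y, l)), k) \<in> E" "\<theta> (fst (\<theta>' (y, l)), k) = (y, l)" if "y \<in> ?Y" for y
  proof -
    have "\<theta>' (y, l) = (fst (\<theta>' (y, l)), k)" using that by (simp add: prod_eq_iff)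
    then show "(fst (\<theta>' (y, l)), k) \<in> E" "\<theta> (fst (\<theta>' (y, l)), k) = (y, l)" using \<theta>'[of "(y, l)"] that by auto
  qed
  have bij: "bij_betw (\<lambda>x. fst (\<theta> (x, k))) ?X ?Y"
  proof (rule bij_betw_byWitness[where f' = "\<lambda>y. fst (\<theta>' (y, l))"])
    show "\<forall>x\<in>?X. fst (\<theta>' (fst (\<theta> (x, k)), l)) = x" "\<forall>y\<in>?Y. fst (\<theta> (fst (\<theta>' (y, l)), k)) = y"
      using fwd bwd by simp_all
    show "(\<lambda>x. fst (\<theta> (x, k))) ` ?X \<subseteq> ?Y"
    proof (rule image_subsetI)
      fix x assume "x \<in> ?X"
      from fwd[OF this] show "fst (\<theta> (x, k)) \<in> ?Y" by simp
    qed
    show "(\<lambda>y. fst (\<theta>' (y, l))) ` ?Y \<subseteq> ?X"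
    proof (rule image_subsetI)
      fix y assume "y \<in> ?Y"
      from bwd[OF this] show "fst (\<theta>' (y, l)) \<in> ?X" by simp
    qed
  qed
  have "cinner (bop_apply (matrix_unit E \<theta> k l) a) b
      = (\<Sum>\<^sub>\<infinity>x\<in>?X. ell2_apply a (fst (\<theta> (x, k))) * cnj (ell2_apply b x))"
    unfolding cinner_def by (rule infsum_cong_neutral) (auto simp: matrix_unit_apply[OF inj(1)])
  also have "\<dots> = (\<Sum>\<^sub>\<infinity>x\<in>?X. ?g (fst (\<theta> (x, k))))"
    by (rule infsum_cong) (simp add: fwd)
  also have "\<dots> = (\<Sum>\<^sub>\<infinity>y\<in>?Y. ?g y)"
    by (rule infsum_reindex_bij_betw[OF bij])
  also have "\<dots> = cinner a (bop_apply (matrix_unit E' \<theta>' l k) b)"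
    unfolding cinner_def by (rule infsum_cong_neutral) (auto simp: matrix_unit_apply[OF inj(2)])
  finally show "cinner (bop_apply (matrix_unit E \<theta> k l) a) b = cinner a (bop_apply (matrix_unit E' \<theta>' l k) b)" .
qed

text \<open>Over a point \<open>(x, k)\<close> of \<open>E\<close> only one \<open>l\<close>
  contributes, the summand of \<open>\<theta> (x, k)\<close>; the bound \<open>m\<close> ensures
  that this \<open>l\<close> occurs in the sum.\<close>

lemma matrix_unit_mult:
  assumes inj: "inj_on \<theta> E" "inj_on \<theta>' E'"
    and \<theta>: "\<And>p. p \<in> E \<Longrightarrow> \<theta> p \<in> E' \<and> \<theta>' (\<theta> p) = p"
    and E': "E' \<subseteq> UNIV \<times> {..<m}"
  shows "(\<Sum>l<m. matrix_unit E \<theta> k l * matrix_unit E' \<theta>' l k')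
    = (if k = k' then mult_op (\<lambda>x. ind ((x, k) \<in> E)) else 0)"
proof (intro bop_eqI ell2_eqI)
  fix v x
  have "ell2_apply (bop_apply (\<Sum>l<m. matrix_unit E \<theta> k l * matrix_unit E' \<theta>' l k') v) x =
    (\<Sum>l<m. if l = snd (\<theta> (x, k)) then if (x, k) \<in> E then ell2_apply (bop_apply (matrix_unit E' \<theta>' l k') v) (fst (\<theta> (x, k))) else 0 else 0)"
    unfolding bop_apply_sum ell2_apply_sum
    by (rule sum.cong) (auto simp: matrix_unit_apply[OF inj(1)])
  also have "\<dots> = (if k = k' \<and> (x, k) \<in> E then ell2_apply v x else 0)"
  proof (cases "(x, k) \<in> E")
    case True
    then have "\<theta> (x, k) \<in> E'" "\<theta>' (\<theta> (x, k)) = (x, k)" using \<theta> by auto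
    moreover have "snd (\<theta> (x, k)) < m" using calculation(1) E' by auto
    ultimately show ?thesis using True by (auto simp: matrix_unit_apply[OF inj(2)])
  qed simp
  also have "\<dots> = ell2_apply (bop_apply (if k = k' then mult_op (\<lambda>x. ind ((x, k) \<in> E)) else 0) v) x"
    by (simp add: mult_op_apply[OF bounded_ind] ind_mult)
  finally show "ell2_apply (bop_apply (\<Sum>l<m. matrix_unit E \<theta> k l * matrix_unit E' \<theta>' l k') v) x =
    ell2_apply (bop_apply (if k = k' then mult_op (\<lambda>x. ind ((x, k) \<in> E)) else 0) v) x" .
qed

lemma diag_projection_carrier [simp]: "diag_projection n E \<in> carrier_mat n n"
  unfolding diag_projection_def by simp

lemma dim_diag_projection [simp]: "dim_row (diag_projection n E) = n" "dim_col (diag_projection n E) = n"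
  by (rule carrier_matD[OF diag_projection_carrier])+

lemma index_diag_projection:
  "i < n \<Longrightarrow> j < n \<Longrightarrow> diag_projection n E $$ (i, j) = (if i = j then mult_op (\<lambda>x. ind ((x, i) \<in> E)) else 0)"
  unfolding diag_projection_def mat_diag_def by auto

context star_algebra begin

text \<open>A bijection of basis vectors always gives a partial isometry; how far it moves base
  points decides which algebra contains its blocks. Displacement zero leads to
  \<open>linf_algebra\<close>, bounded displacement to the uniform Roe algebra. Testing the blocks
  of \<open>v\<close> is enough because \<open>A\<close> is closed under adjoints.\<close>

lemma diag_projection_mvn:
  assumes \<theta>: "bij_betw \<theta> E E'" and E: "E \<subseteq> UNIV \<times> {..<n}" and E': "E' \<subseteq> UNIV \<times> {..<m}"
    and closed: "\<And>l k. matrix_unit E' (inv_into E \<theta>) l k \<in> A"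
    and proj: "diag_projection n E \<in> projections A" "diag_projection m E' \<in> projections A"
  shows "(diag_projection n E, diag_projection m E') \<in> mvn_rel A"
proof -
  define \<theta>' where "\<theta>' = inv_into E \<theta>"
  have inj: "inj_on \<theta> E" using \<theta> unfolding bij_betw_def by simp
  have inj': "inj_on \<theta>' E'" using bij_betw_inv_into[OF \<theta>] unfolding bij_betw_def \<theta>'_def by simp
  have fwd: "\<theta> p \<in> E' \<and> \<theta>' (\<theta> p) = p" if "p \<in> E" for p
    using that \<theta> unfolding \<theta>'_def by (simp add: bij_betw_inv_into_left bij_betwE)
  have bwd: "\<theta>' p \<in> E \<and> \<theta> (\<theta>' p) = p" if "p \<in> E'" for p
    using that \<theta> bij_betw_inv_into[OF \<theta>] unfolding \<theta>'_def by (simp add: bij_betw_inv_into_right bij_betwE)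
  define v where "v = mat m n (\<lambda>(l, k). matrix_unit E' \<theta>' l k)"
  define w where "w = mat n m (\<lambda>(k, l). matrix_unit E \<theta> k l)"
  show ?thesis
  proof (rule mvn_relI)
    show "v \<in> carrier_mat m n" "w \<in> carrier_mat n m" by (simp_all add: v_def w_def)
    show "elements_mat v \<subseteq> A" unfolding elements_mat_subset_iff using closed by (simp add: v_def \<theta>'_def)
    show "mat_is_adjoint w v"
      unfolding mat_is_adjoint_def using matrix_unit_adjoint[OF inj inj' fwd bwd] by (simp add: v_def w_def)
    show "diag_projection n E = w * v"
    proof (rule eq_matI)
      fix k k' assume "k < dim_row (w * v)" "k' < dim_col (w * v)"
      then have k: "k < n" "k' < n" by (simp_all add: v_def w_def)
      then have "(w * v) $$ (k, k') = (\<Sum>l<m. matrix_unit E \<theta> k l * matrix_unit E' \<theta>' l k')"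
        by (subst index_mult_mat_sum) (simp_all add: v_def w_def)
      then show "diag_projection n E $$ (k, k') = (w * v) $$ (k, k')"
        using matrix_unit_mult[OF inj inj' fwd E'] k by (simp add: index_diag_projection)
    qed (simp_all add: v_def w_def)
    show "diag_projection m E' = v * w"
    proof (rule eq_matI)
      fix l l' assume "l < dim_row (v * w)" "l' < dim_col (v * w)"
      then have l: "l < m" "l' < m" by (simp_all add: v_def w_def)
      then have "(v * w) $$ (l, l') = (\<Sum>k<n. matrix_unit E' \<theta>' l k * matrix_unit E \<theta> k l')"
        by (subst index_mult_mat_sum) (simp_all add: v_def w_def)
      then show "diag_projection m E' $$ (l, l') = (v * w) $$ (l, l')"
        using matrix_unit_mult[OF inj' inj bwd E] l by (simp add: index_diag_projection)
    qed (simp_all add: v_def w_def)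
  qed (rule proj)+
qed

lemma diag_projection_in_projections:
  assumes "linf_algebra \<subseteq> A"
  shows "diag_projection n E \<in> projections A"
proof (rule projectionsI[OF diag_projection_carrier])
  have m: "mult_op (\<lambda>x. ind ((x, k) \<in> E)) \<in> A" for k
  proof -
    have "mult_op (\<lambda>x. ind ((x, k) \<in> E)) \<in> linf_algebra"
      unfolding linf_algebra_def by (intro imageI CollectI bounded_ind)
    with assms show ?thesis by (rule subsetD)
  qed
  show "elements_mat (diag_projection n E) \<subseteq> A"
    unfolding elements_mat_subset_iff using m by (simp add: index_diag_projection zero_closed)
  show "diag_projection n E * diag_projection n E = diag_projection n E"
  proof (rule eq_matI)
    fix i j assume "i < dim_row (diag_projection n E)" "j < dim_col (diag_projection n E)"
    then have ij: "i < n" "j < n" by simp_all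
    have sq: "mult_op (\<lambda>x. ind ((x, k) \<in> E)) * mult_op (\<lambda>x. ind ((x, k) \<in> E)) = mult_op (\<lambda>x. ind ((x, k) \<in> E))" for k
      unfolding mult_op_simps(2)[OF bounded_ind bounded_ind] by (rule arg_cong[where f = mult_op]) (auto simp: ind_def)
    have "(diag_projection n E * diag_projection n E) $$ (i, j) =
      (\<Sum>k<n. diag_projection n E $$ (i, k) * diag_projection n E $$ (k, j))"
      using index_mult_mat_sum[of i "diag_projection n E" j "diag_projection n E"] ij by simp
    also have "\<dots> = (\<Sum>k<n. if k = i then diag_projection n E $$ (i, j) else 0)"
      by (rule sum.cong) (use ij sq in \<open>auto simp: index_diag_projection\<close>)
    finally have "(diag_projection n E * diag_projection n E) $$ (i, j) =
      (\<Sum>k<n. if k = i then diag_projection n E $$ (i, j) else 0)" .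
    then show "(diag_projection n E * diag_projection n E) $$ (i, j) = diag_projection n E $$ (i, j)"
      using ij by simp
  qed simp_all
  have adj: "is_adjoint (mult_op (\<lambda>x. ind ((x, k) \<in> E))) (mult_op (\<lambda>x. ind ((x, k) \<in> E)))" for k
    using mult_op_simps(4)[OF bounded_ind bounded_ind, of "\<lambda>x. (x, k) \<in> E"] by (simp add: ind_def if_distrib cong: if_cong)
  show "mat_is_adjoint (diag_projection n E) (diag_projection n E)"
    unfolding mat_is_adjoint_def
    by (auto simp: index_diag_projection adj is_adjoint_simps)
qed

end

section \<open>Rank functions and the classes of integer-valued functions\<close>

definition fibre_rank :: "('i \<times> nat) set \<Rightarrow> 'i \<Rightarrow> nat" where
  "fibre_rank E x = card {k. (x, k) \<in> E}"

lemma finite_fibre: "E \<subseteq> UNIV \<times> {..<n} \<Longrightarrow> finite {k. (x, k) \<in> E}" for n :: nat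
  by (rule finite_subset[of _ "{..<n}"]) auto

definition fibre_plus :: "nat \<Rightarrow> ('i \<times> nat) set \<Rightarrow> ('i \<times> nat) set \<Rightarrow> ('i \<times> nat) set" where
  "fibre_plus n E E' = E \<union> {(x, n + k) | x k. (x, k) \<in> E'}"

lemma fibre_plus_subset:
  "E \<subseteq> UNIV \<times> {..<n} \<Longrightarrow> E' \<subseteq> UNIV \<times> {..<m} \<Longrightarrow> fibre_plus n E E' \<subseteq> UNIV \<times> {..<n + m}"
  unfolding fibre_plus_def by force

lemma fibre_rank_plus:
  assumes "E \<subseteq> UNIV \<times> {..<n}" "E' \<subseteq> UNIV \<times> {..<m}"
  shows "fibre_rank (fibre_plus n E E') x = fibre_rank E x + fibre_rank E' x"
proof -
  have "{k. (x, k) \<in> fibre_plus n E E'} = {k. (x, k) \<in> E} \<union> (\<lambda>k. n + k) ` {k. (x, k) \<in> E'}"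
    unfolding fibre_plus_def by auto
  moreover have "card ((\<lambda>k. n + k) ` {k. (x, k) \<in> E'}) = card {k. (x, k) \<in> E'}"
    by (rule card_image) simp
  moreover have "{k. (x, k) \<in> E} \<inter> (\<lambda>k. n + k) ` {k. (x, k) \<in> E'} = {}"
    using assms(1) by auto
  ultimately show ?thesis
    unfolding fibre_rank_def using finite_fibre[OF assms(1)] finite_fibre[OF assms(2)]
    by (simp add: card_Un_disjoint)
qed

lemma direct_sum_diag_projection:
  assumes "E \<subseteq> UNIV \<times> {..<n}"
  shows "direct_sum_mat (diag_projection n E) (diag_projection m E') = diag_projection (n + m) (fibre_plus n E E')"
proof (rule eq_matI)
  fix i j assume "i < dim_row (diag_projection (n + m) (fibre_plus n E E'))"
    "j < dim_col (diag_projection (n + m) (fibre_plus n E E'))"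
  then have ij: "i < n + m" "j < n + m" by simp_all
  have 1: "(x, i) \<in> fibre_plus n E E' \<longleftrightarrow> (x, i) \<in> E" if "i < n" for x i
    using that unfolding fibre_plus_def by auto
  have 2: "(x, i) \<in> fibre_plus n E E' \<longleftrightarrow> (x, i - n) \<in> E'" if "\<not> i < n" for x i
  proof -
    have "i = n + (i - n)" using that by simp
    moreover have "(x, i) \<notin> E" using that assms by auto
    ultimately show ?thesis unfolding fibre_plus_def by force
  qed
  show "direct_sum_mat (diag_projection n E) (diag_projection m E') $$ (i, j)
      = diag_projection (n + m) (fibre_plus n E E') $$ (i, j)"
  proof (cases "i < n")
    case True
    then show ?thesis using ij by (auto simp: index_direct_sum_mat index_diag_projection 1)
  next
    case False
    have "i - n = j - n \<longleftrightarrow> i = j" if "\<not> j < n" using that False by auto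
    then show ?thesis using ij False by (auto simp: index_direct_sum_mat index_diag_projection 2)
  qed
qed simp_all

lemma one_mat_diag_projection: "1\<^sub>m n = diag_projection n (UNIV \<times> {..<n})"
  by (rule eq_matI) (auto simp: index_diag_projection ind_def mult_op_const)

definition rank_set :: "('i \<Rightarrow> int) \<Rightarrow> ('i \<times> nat) set" where
  "rank_set f = {(x, k). int k < f x}"

definition rank_bound :: "('i \<Rightarrow> int) \<Rightarrow> nat" where
  "rank_bound f = (LEAST n. \<forall>x. f x \<le> int n)"

lemma rank_projection_eq: "rank_projection f = diag_projection (rank_bound f) (rank_set f)"
  unfolding rank_projection_def diag_projection_def rank_bound_def rank_set_def ind_def by simp

lemma rank_set_subset:
  assumes "f \<in> carrier bounded_functions"
  shows "rank_set f \<subseteq> UNIV \<times> {..<rank_bound f}"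
proof -
  obtain C where C: "\<And>x. \<bar>f x\<bar> \<le> C" using assms by (auto simp: carrier_bounded_functions)
  have "\<forall>x. f x \<le> int (nat C)"
  proof
    fix x show "f x \<le> int (nat C)" using C[of x] by linarith
  qed
  then have "\<forall>x. f x \<le> int (rank_bound f)" unfolding rank_bound_def by (rule LeastI)
  then show ?thesis unfolding rank_set_def by (auto simp: less_le_trans) (metis less_le_trans of_nat_less_iff)
qed

lemma fibre_rank_rank_set: "fibre_rank (rank_set f) x = nat (f x)"
proof -
  have "{k. (x, k) \<in> rank_set f} = {..<nat (f x)}" unfolding rank_set_def by auto
  then show ?thesis unfolding fibre_rank_def by simp
qed

lemma linf_diag_projection: "diag_projection n E \<in> projections linf_algebra"
  by (rule star_algebra.diag_projection_in_projections[OF star_algebra_linf]) simp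

text \<open>Equal ranks at each point allow a bijection that keeps base points, and its blocks are
  multiplication operators.\<close>

lemma diag_projection_mvn_linf:
  assumes E: "E \<subseteq> UNIV \<times> {..<n}" and E': "E' \<subseteq> UNIV \<times> {..<m}"
    and rank: "\<And>x. fibre_rank E x = fibre_rank E' x"
  shows "(diag_projection n E, diag_projection m E') \<in> mvn_rel linf_algebra"
proof -
  have E_Sigma: "Sigma UNIV (\<lambda>x. {k. (x, k) \<in> E}) = E" for E :: "('a \<times> nat) set" by auto
  obtain \<theta> where \<theta>: "bij_betw \<theta> E E'" "\<And>p. p \<in> E \<Longrightarrow> fst (\<theta> p) = fst p"
    using fibrewise_bijection[of "\<lambda>x. {k. (x, k) \<in> E}" "\<lambda>x. {k. (x, k) \<in> E'}"]
      finite_fibre[OF E] finite_fibre[OF E'] rank unfolding E_Sigma fibre_rank_def by auto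
  let ?\<theta>' = "inv_into E \<theta>"
  have inj: "inj_on ?\<theta>' E'" using bij_betw_inv_into[OF \<theta>(1)] unfolding bij_betw_def by simp
  have fst': "fst (?\<theta>' p) = fst p" if "p \<in> E'" for p
    using \<theta>(2)[of "?\<theta>' p"] bij_betw_inv_into_right[OF \<theta>(1) that] bij_betwE[OF bij_betw_inv_into[OF \<theta>(1)]] that by simp
  interpret star_algebra linf_algebra by (rule star_algebra_linf)
  show ?thesis
  proof (rule diag_projection_mvn[OF \<theta>(1) E E'])
    fix l k
    have "matrix_unit E' ?\<theta>' l k = mult_op (\<lambda>x. ind ((x, l) \<in> E' \<and> snd (?\<theta>' (x, l)) = k))"
      by (intro bop_eqI ell2_eqI) (simp add: matrix_unit_apply[OF inj] mult_op_apply[OF bounded_ind] ind_mult fst')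
    then show "matrix_unit E' ?\<theta>' l k \<in> linf_algebra"
      unfolding linf_algebra_def by (simp only:) (intro imageI CollectI bounded_ind)
  qed (rule linf_diag_projection)+
qed

lemma mvn_rel_mono: "A \<subseteq> B \<Longrightarrow> mvn_rel A \<subseteq> mvn_rel B"
  unfolding mvn_rel_def projections_def by blast

locale star_algebra_over_linf = star_algebra +
  assumes linf_subset: "linf_algebra \<subseteq> A"
begin

lemma diag_projection_closed [simp]: "diag_projection n E \<in> projections A"
  by (rule diag_projection_in_projections[OF linf_subset])

text \<open>Only the difference of the two rank functions matters. The crosswise sums have equal
  ranks, so they are equivalent already over \<open>linf_algebra\<close>, and an equivalence
  persists in a larger algebra. The empty matrix is the stabilising projection.\<close>

lemma K0_class_diag_projection_eq:
  assumes E: "E1 \<subseteq> UNIV \<times> {..<n1}" "E2 \<subseteq> UNIV \<times> {..<n2}" "E3 \<subseteq> UNIV \<times> {..<n3}" "E4 \<subseteq> UNIV \<times> {..<n4}"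
    and rank: "\<And>x. fibre_rank E1 x + fibre_rank E4 x = fibre_rank E3 x + fibre_rank E2 x"
  shows "K0_class A (diag_projection n1 E1) (diag_projection n2 E2) = K0_class A (diag_projection n3 E3) (diag_projection n4 E4)"
proof -
  have "(diag_projection (n1 + n4) (fibre_plus n1 E1 E4), diag_projection (n3 + n2) (fibre_plus n3 E3 E2)) \<in> mvn_rel A"
    using diag_projection_mvn_linf[OF fibre_plus_subset[OF E(1,4)] fibre_plus_subset[OF E(3,2)]]
      mvn_rel_mono[OF linf_subset] rank by (auto simp: fibre_rank_plus[OF E(1,4)] fibre_rank_plus[OF E(3,2)])
  then have "(direct_sum_mat (direct_sum_mat (diag_projection n1 E1) (diag_projection n4 E4)) (0\<^sub>m 0 0),
      direct_sum_mat (direct_sum_mat (diag_projection n3 E3) (diag_projection n2 E2)) (0\<^sub>m 0 0)) \<in> mvn_rel A"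
    by (simp only: direct_sum_mat_empty direct_sum_diag_projection[OF E(1)] direct_sum_diag_projection[OF E(3)])
  then show ?thesis
    using K0_class_eq_iff[OF diag_projection_closed diag_projection_closed diag_projection_closed diag_projection_closed]
      empty_projection by blast
qed

definition K0_of_function :: "('a \<Rightarrow> int) \<Rightarrow> ('a bop mat set \<times> 'a bop mat set) set" where
  "K0_of_function f = K0_class A (rank_projection f) (rank_projection (\<lambda>x. - f x))"

lemma K0_of_function_eq_diag:
  assumes f: "f \<in> carrier bounded_functions" and E: "E \<subseteq> UNIV \<times> {..<n}" "E' \<subseteq> UNIV \<times> {..<m}"
    and rank: "\<And>x. f x = int (fibre_rank E x) - int (fibre_rank E' x)"
  shows "K0_of_function f = K0_class A (diag_projection n E) (diag_projection m E')"
  unfolding K0_of_function_def rank_projection_eq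
proof (rule K0_class_diag_projection_eq[OF rank_set_subset[OF f] rank_set_subset[OF bounded_functions_uminus[OF f]] E])
  fix x
  show "fibre_rank (rank_set f) x + fibre_rank E' x = fibre_rank E x + fibre_rank (rank_set (\<lambda>x. - f x)) x"
    using rank[of x] unfolding fibre_rank_rank_set by linarith
qed

lemma rank_projection_closed: "rank_projection f \<in> projections A"
  unfolding rank_projection_eq by simp

lemma K0_of_function_closed: "K0_of_function f \<in> carrier (K0 A)"
  unfolding K0_of_function_def by (intro K0_class_closed rank_projection_closed)

text \<open>Positive and negative parts are not additive in the function, but their difference is,
  and the class depends on this difference alone.\<close>

lemma K0_of_function_plus:
  assumes f: "f \<in> carrier bounded_functions" and g: "g \<in> carrier bounded_functions"
  shows "K0_of_function (\<lambda>x. f x + g x) = K0_of_function f \<otimes>\<^bsub>K0 A\<^esub> K0_of_function g"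
proof -
  note sub = rank_set_subset[OF f] rank_set_subset[OF g]
    rank_set_subset[OF bounded_functions_uminus[OF f]] rank_set_subset[OF bounded_functions_uminus[OF g]]
  have "K0_of_function f \<otimes>\<^bsub>K0 A\<^esub> K0_of_function g =
    K0_class A (diag_projection (rank_bound f + rank_bound g) (fibre_plus (rank_bound f) (rank_set f) (rank_set g)))
      (diag_projection (rank_bound (\<lambda>x. - f x) + rank_bound (\<lambda>x. - g x))
        (fibre_plus (rank_bound (\<lambda>x. - f x)) (rank_set (\<lambda>x. - f x)) (rank_set (\<lambda>x. - g x))))"
    unfolding K0_of_function_def K0_class_mult[OF rank_projection_closed rank_projection_closed rank_projection_closed rank_projection_closed]
    unfolding rank_projection_eq direct_sum_diag_projection[OF sub(1)] direct_sum_diag_projection[OF sub(3)] ..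
  also have "\<dots> = K0_of_function (\<lambda>x. f x + g x)"
    by (rule K0_of_function_eq_diag[OF bounded_functions_plus[OF f g] fibre_plus_subset[OF sub(1,2)] fibre_plus_subset[OF sub(3,4)], symmetric])
      (simp add: fibre_rank_plus[OF sub(1,2)] fibre_rank_plus[OF sub(3,4)] fibre_rank_rank_set)
  finally show ?thesis ..
qed

end

section \<open>Boundaries have trivial class over the uniform Roe algebra\<close>

context finitely_generated_group begin

sublocale Roe: star_algebra_over_linf "uniform_Roe_algebra S"
  by (simp add: star_algebra_over_linf_def star_algebra_over_linf_axioms_def star_algebra_uniform_Roe
      linf_subset_uniform_Roe)

lemma diag_projection_mvn_Roe:
  assumes E: "E \<subseteq> UNIV \<times> {..<n}" and E': "E' \<subseteq> UNIV \<times> {..<m}"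
    and \<theta>: "bij_betw \<theta> E E'" and R: "\<And>p. p \<in> E \<Longrightarrow> word_dist S (fst p) (fst (\<theta> p)) \<le> R"
  shows "(diag_projection n E, diag_projection m E') \<in> mvn_rel (uniform_Roe_algebra S)"
proof (rule Roe.diag_projection_mvn[OF \<theta> E E'])
  fix l k
  let ?\<theta>' = "inv_into E \<theta>"
  have inj: "inj_on ?\<theta>' E'" using bij_betw_inv_into[OF \<theta>] unfolding bij_betw_def by simp
  have dist: "word_dist S (fst (?\<theta>' p)) (fst p) \<le> R" if "p \<in> E'" for p
    using R[of "?\<theta>' p"] bij_betw_inv_into_right[OF \<theta> that] bij_betwE[OF bij_betw_inv_into[OF \<theta>]] that by simp
  show "matrix_unit E' ?\<theta>' l k \<in> uniform_Roe_algebra S"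
    unfolding matrix_unit_def
  proof (rule partial_shift_in_uniform_Roe[OF bounded_ind inj_matrix_unit[OF inj]])
    fix y assume "ind ((y, l) \<in> E' \<and> snd (?\<theta>' (y, l)) = k) \<noteq> 0"
    then have "(y, l) \<in> E'" by (auto simp: ind_def split: if_splits)
    from dist[OF this] show "word_dist S (fst (?\<theta>' (y, l))) y \<le> R" by simp
  qed
qed simp_all

text \<open>A nonnegative flow is realised by moving units: unit \<open>j\<close> on the edge from
  \<open>x\<close> to \<open>y\<close> leaves \<open>x\<close> and arrives at \<open>y\<close>. The
  maps \<alpha> and \<beta> only renumber the units at each vertex.\<close>

lemma boundary_transport:
  fixes c :: "'g \<Rightarrow> 'g \<Rightarrow> nat" and R :: nat
  defines "out \<equiv> \<lambda>x. \<Sum>y\<in>nbhd R {x}. c x y" and "inc \<equiv> \<lambda>x. \<Sum>y\<in>nbhd R {x}. c y x"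
  assumes c: "\<And>x y. c x y \<noteq> 0 \<Longrightarrow> word_dist S x y \<le> R"
  shows "\<exists>\<theta>. bij_betw \<theta> (SIGMA x:UNIV. {..<out x}) (SIGMA x:UNIV. {..<inc x}) \<and>
    (\<forall>p\<in>(SIGMA x:UNIV. {..<out x}). word_dist S (fst p) (fst (\<theta> p)) \<le> R)"
proof -
  define F where "F x = (SIGMA y:nbhd R {x}. {..<c x y})" for x
  define F' where "F' x = (SIGMA y:nbhd R {x}. {..<c y x})" for x
  have fin: "finite (nbhd R {x})" for x by (simp add: finite_nbhd)
  obtain \<alpha> where \<alpha>: "bij_betw \<alpha> (SIGMA x:UNIV. {..<out x}) (Sigma UNIV F)"
    "\<And>p. p \<in> (SIGMA x:UNIV. {..<out x}) \<Longrightarrow> fst (\<alpha> p) = fst p"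
    using fibrewise_bijection[of "\<lambda>x. {..<out x}" F] fin unfolding F_def out_def by (auto simp: card_SigmaI)
  obtain \<beta> where \<beta>: "bij_betw \<beta> (Sigma UNIV F') (SIGMA x:UNIV. {..<inc x})"
    "\<And>p. p \<in> Sigma UNIV F' \<Longrightarrow> fst (\<beta> p) = fst p"
    using fibrewise_bijection[of F' "\<lambda>x. {..<inc x}"] fin unfolding F'_def inc_def by (auto simp: card_SigmaI)
  \<comment> \<open>The same unit seen from the other end of its edge; this is the only step that
    changes the base point, and by at most \<open>R\<close>.\<close>
  define \<tau> where "\<tau> = (\<lambda>(x::'g, y::'g, j::nat). (y, x, j))"
  have \<tau>: "bij_betw \<tau> (Sigma UNIV F) (Sigma UNIV F')"
    by (rule bij_betw_byWitness[where f' = \<tau>])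
      (auto simp: \<tau>_def F_def F'_def nbhd_def word_dist_commute)
  have "bij_betw (\<beta> \<circ> (\<tau> \<circ> \<alpha>)) (SIGMA x:UNIV. {..<out x}) (SIGMA x:UNIV. {..<inc x})"
    by (rule bij_betw_trans[OF bij_betw_trans[OF \<alpha>(1) \<tau>] \<beta>(1)])
  moreover have "word_dist S (fst p) (fst ((\<beta> \<circ> (\<tau> \<circ> \<alpha>)) p)) \<le> R" if p: "p \<in> (SIGMA x:UNIV. {..<out x})" for p
  proof -
    have a: "\<alpha> p \<in> Sigma UNIV F" by (rule bij_betw_apply[OF \<alpha>(1) p])
    have t: "\<tau> (\<alpha> p) \<in> Sigma UNIV F'" by (rule bij_betw_apply[OF \<tau> a])
    obtain x y j where xyj: "\<alpha> p = (x, y, j)" by (metis prod_cases3)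
    have "fst p = x" using \<alpha>(2)[OF p] xyj by simp
    moreover have "fst (\<beta> (\<tau> (\<alpha> p))) = y" using \<beta>(2)[OF t] xyj by (simp add: \<tau>_def)
    moreover have "word_dist S x y \<le> R" using a xyj by (simp add: F_def nbhd_def)
    ultimately show ?thesis by simp
  qed
  ultimately show ?thesis by (intro exI[of _ "\<beta> \<circ> (\<tau> \<circ> \<alpha>)"] conjI ballI)
qed

text \<open>This makes the comparison map well defined. A boundary is inflow minus outflow of a
  nonnegative flow, and transporting the units identifies the projections of these two
  ranks.\<close>

lemma Roe_K0_of_boundary:
  assumes "c \<in> uf_chains S"
  shows "Roe.K0_of_function (uf_boundary c) = \<one>\<^bsub>K0 (uniform_Roe_algebra S)\<^esub>"
proof -
  obtain R C where c: "\<And>x y. c (x, y) \<noteq> 0 \<Longrightarrow> word_dist S x y \<le> R" "\<And>p. \<bar>c p\<bar> \<le> C"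
    using uf_chain_bounds[OF assms] by blast
  \<comment> \<open>Edges with negative values are reversed: a negative value on
    \<open>(y, x)\<close> counts as a flow from \<open>x\<close> to \<open>y\<close>. The boundary
    stays the same.\<close>
  define c' where "c' x y = nat (c (x, y)) + nat (- c (y, x))" for x y
  have c': "word_dist S x y \<le> R" if "c' x y \<noteq> 0" for x y
    using that c(1)[of x y] c(1)[of y x] word_dist_commute[of x y] unfolding c'_def by fastforce
  define out where "out x = (\<Sum>y\<in>nbhd R {x}. c' x y)" for x
  define inc where "inc x = (\<Sum>y\<in>nbhd R {x}. c' y x)" for x
  have boundary: "uf_boundary c x = int (inc x) - int (out x)" for x
  proof -
    have "uf_boundary c x = (\<Sum>y\<in>nbhd R {x}. c (y, x)) - (\<Sum>y\<in>nbhd R {x}. c (x, y))"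
      by (rule uf_boundary_eq) (use c(1) in blast)
    also have "\<dots> = int (inc x) - int (out x)"
      unfolding inc_def out_def c'_def of_nat_sum sum_subtractf[symmetric] by (rule sum.cong) auto
    finally show ?thesis .
  qed
  \<comment> \<open>A vertex has as many neighbours as the ball of radius \<open>R\<close> has
    elements, and each edge carries at most \<open>C\<close> from either orientation.\<close>
  define N where "N = card {t. word_length S t \<le> R} * (nat C + nat C)"
  have bd: "(\<Sum>y\<in>nbhd R {x}. f y) \<le> N" if "\<And>y. f y \<le> nat C + nat C" for f x
  proof -
    have "card (nbhd R {x}) = card {t. word_length S t \<le> R}"
      using sum_nbhd_singleton(1)[of "\<lambda>_. 1 :: int" R x] by simp
    then show ?thesis using sum_bounded_above[of "nbhd R {x}" f "nat C + nat C"] that by (simp add: N_def)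
  qed
  have le: "c' x y \<le> nat C + nat C" for x y
    using c(2)[of "(x, y)"] c(2)[of "(y, x)"] unfolding c'_def by linarith
  have bounds: "out x \<le> N" "inc x \<le> N" for x unfolding out_def inc_def by (rule bd, rule le)+
  let ?O = "SIGMA x:UNIV. {..<out x}" and ?I = "SIGMA x:UNIV. {..<inc x}"
  have sub: "?O \<subseteq> UNIV \<times> {..<N}" "?I \<subseteq> UNIV \<times> {..<N}" using bounds by (auto intro: less_le_trans)
  have ranks: "fibre_rank ?O x = out x" "fibre_rank ?I x = inc x" for x
    unfolding fibre_rank_def by simp_all
  obtain \<theta> where \<theta>: "bij_betw \<theta> ?O ?I" "\<And>p. p \<in> ?O \<Longrightarrow> word_dist S (fst p) (fst (\<theta> p)) \<le> R"
    using boundary_transport[of c' R, OF c'] unfolding out_def inc_def by auto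
  have mvn: "(diag_projection N ?O, diag_projection N ?I) \<in> mvn_rel (uniform_Roe_algebra S)"
    by (rule diag_projection_mvn_Roe[OF sub \<theta>])
  have "Roe.K0_of_function (uf_boundary c) = K0_class (uniform_Roe_algebra S) (diag_projection N ?I) (diag_projection N ?O)"
    by (rule Roe.K0_of_function_eq_diag[OF uf_boundary_bounded[OF assms] sub(2,1)]) (simp add: ranks boundary)
  also have "\<dots> = K0_class (uniform_Roe_algebra S) (diag_projection N ?I) (diag_projection N ?I)"
    using Roe.K0_class_cong[OF _ mvn] equiv_class_self[OF Roe.equiv_mvn_rel, of "diag_projection N ?I"] by simp
  also have "\<dots> = \<one>\<^bsub>K0 (uniform_Roe_algebra S)\<^esub>" by (rule Roe.K0_class_diag) simp
  finally show ?thesis .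
qed

end

section \<open>Ranks of equivalent diagonal projections\<close>

text \<open>Gaussian elimination: an equation is either void or expresses one unknown through the
  others, and eliminating that unknown removes one equation and one unknown. Arbitrary index sets
  let the lemma apply directly to pairs of a group element and a summand.\<close>

lemma underdetermined_system:
  fixes M :: "'b \<Rightarrow> 'a \<Rightarrow> 'c::field"
  assumes "finite B" "finite A" "card B < card A"
  shows "\<exists>s. (\<exists>a\<in>A. s a \<noteq> 0) \<and> (\<forall>b\<in>B. (\<Sum>a\<in>A. M b a * s a) = 0)"
  using assms
proof (induction B arbitrary: A M rule: finite_induct)
  case empty
  then obtain a where "a \<in> A" by fastforce
  then show ?case by (intro exI[of _ "\<lambda>_. 1"]) auto
next
  case (insert b B)
  show ?case
  proof (cases "\<forall>a\<in>A. M b a = 0")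
    case True
    have "card B < card A" using insert by simp
    from insert.IH[OF insert.prems(1) this, of M] obtain s where
      s: "\<exists>a\<in>A. s a \<noteq> 0" "\<forall>b\<in>B. (\<Sum>a\<in>A. M b a * s a) = 0" by auto
    moreover have "(\<Sum>a\<in>A. M b a * s a) = 0" using True by simp
    ultimately show ?thesis by (intro exI[of _ s]) simp
  next
    case False
    then obtain a0 where a0: "a0 \<in> A" "M b a0 \<noteq> 0" by auto
    define A' where "A' = A - {a0}"
    \<comment> \<open>The coefficients after \<open>a0\<close> has been eliminated by means of
      equation \<open>b\<close>; \<open>s0\<close> below is the value that this equation then forces
      on \<open>a0\<close>.\<close>
    define M' where "M' = (\<lambda>b' a. M b' a - M b' a0 * M b a / M b a0)"
    have fin: "finite A'" using insert.prems by (simp add: A'_def)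
    have "card B < card A'" using insert a0 by (simp add: A'_def)
    from insert.IH[OF fin this, of M'] obtain s where
      s: "\<exists>a\<in>A'. s a \<noteq> 0" "\<forall>b'\<in>B. (\<Sum>a\<in>A'. M' b' a * s a) = 0" by auto
    define s0 where "s0 = - (\<Sum>a\<in>A'. M b a * s a) / M b a0"
    define s' where "s' = s(a0 := s0)"
    have sum: "(\<Sum>a\<in>A. M b' a * s' a) = M b' a0 * s0 + (\<Sum>a\<in>A'. M b' a * s a)" for b'
    proof -
      have "(\<Sum>a\<in>A. M b' a * s' a) = M b' a0 * s' a0 + (\<Sum>a\<in>A'. M b' a * s' a)"
        unfolding A'_def by (rule sum.remove[OF insert.prems(1) a0(1)])
      also have "(\<Sum>a\<in>A'. M b' a * s' a) = (\<Sum>a\<in>A'. M b' a * s a)"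
        by (rule sum.cong) (auto simp: A'_def s'_def)
      finally show ?thesis by (simp add: s'_def)
    qed
    have "(\<Sum>a\<in>A. M b' a * s' a) = 0" if "b' \<in> insert b B" for b'
    proof (cases "b' = b")
      case True
      then show ?thesis unfolding sum using a0 by (simp add: s0_def)
    next
      case False
      then have "(\<Sum>a\<in>A'. M' b' a * s a) = 0" using s(2) that by blast
      moreover have "(\<Sum>a\<in>A'. M' b' a * s a) = (\<Sum>a\<in>A'. M b' a * s a) + M b' a0 * s0"
        unfolding M'_def s0_def
        by (simp add: left_diff_distrib sum_subtractf sum_distrib_left sum_divide_distrib mult.assoc)
      ultimately show ?thesis unfolding sum by (simp add: add.commute)
    qed
    moreover have "\<exists>a\<in>A. s' a \<noteq> 0" using s(1) by (auto simp: A'_def s'_def)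
    ultimately show ?thesis by blast
  qed
qed

context finitely_generated_group begin

lemma uniform_Roe_approximation:
  assumes "T \<in> uniform_Roe_algebra S" "e > 0"
  shows "\<exists>U R. propagation_le R U \<and> norm (T - U) < e"
proof -
  obtain U where "U \<in> finite_propagation" "dist U T < e"
    using assms unfolding uniform_Roe_algebra_eq closure_approachable by auto
  then show ?thesis unfolding finite_propagation_def by (auto simp: dist_norm norm_minus_commute)
qed

text \<open>If the inequality failed for \<open>F\<close>, a dimension count would give a nonzero
  \<xi> in the range of \<open>p\<close> over \<open>F\<close> with \<open>q u \<xi> = 0\<close>.
  Then \<open>\<xi> = p \<xi> = w q v \<xi> = w q (v - u) \<xi>\<close>, which is strictly smaller
  than \<xi>. Norms are measured by summing over the summands.\<close>

lemma mvn_diag_projection_rank_le: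
  assumes mvn: "(diag_projection n E, diag_projection m E') \<in> mvn_rel (uniform_Roe_algebra S)"
    and E: "E \<subseteq> UNIV \<times> {..<n}" and E': "E' \<subseteq> UNIV \<times> {..<m}"
  shows "\<exists>R. \<forall>F. finite F \<longrightarrow> sum (fibre_rank E) F \<le> sum (fibre_rank E') (nbhd R F)"
proof -
  let ?p = "diag_projection n E" and ?q = "diag_projection m E'"
  obtain n' m' v w where 1: "?p \<in> carrier_mat n' n'" "?q \<in> carrier_mat m' m'" "v \<in> carrier_mat m' n'" "w \<in> carrier_mat n' m'"
    "elements_mat v \<subseteq> uniform_Roe_algebra S" "?p = w * v" "?q = v * w"
    using mvn by (rule Roe.mvn_relE)
  have "n' = n" "m' = m" using 1(1,2) by auto
  note vw = 1(3,4)[unfolded this] and v_Roe = 1(5) and p_eq = 1(6) and q_eq = 1(7)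
  \<comment> \<open>The factor \<open>q\<close> is inserted between \<open>w\<close> and
    \<open>v\<close>, so that the approximation \<open>u\<close> may be cut down to the range of
    \<open>q\<close>; otherwise its values would not be counted by the rank of
    \<open>q\<close>.\<close>
  have "?p = ?p * ?p" using Roe.projectionsD(3)[OF Roe.diag_projection_closed[of n E]] by simp
  also have "\<dots> = w * (v * ?p)" unfolding p_eq by (rule assoc_mult_mat[OF vw(2,1)]) (use vw in auto)
  also have "v * ?p = ?q * v" unfolding p_eq q_eq by (rule assoc_mult_mat[OF vw(1,2,1), symmetric])
  finally have pwqv: "?p = w * (?q * v)" .
  \<comment> \<open>The entries of \<open>w q\<close>.\<close>
  define T where "T k j = w $$ (k, j) * mult_op (\<lambda>x. ind ((x, j) \<in> E'))" for k j
  have qv: "(?q * v) $$ (j, k) = mult_op (\<lambda>x. ind ((x, j) \<in> E')) * v $$ (j, k)" if jk: "j < m" "k < n" for j k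
  proof -
    have "(?q * v) $$ (j, k) = (\<Sum>i<m. ?q $$ (j, i) * v $$ (i, k))"
      using jk vw index_mult_mat_sum[of j ?q k v] by simp
    also have "\<dots> = (\<Sum>i<m. if i = j then mult_op (\<lambda>x. ind ((x, j) \<in> E')) * v $$ (j, k) else 0)"
      by (rule sum.cong) (use jk in \<open>auto simp: index_diag_projection\<close>)
    finally show ?thesis using jk by simp
  qed
  have p_kk': "?p $$ (k, k') = (\<Sum>j<m. T k j * v $$ (j, k'))" if k: "k < n" "k' < n" for k k'
  proof -
    have "?p $$ (k, k') = (\<Sum>j<m. w $$ (k, j) * (?q * v) $$ (j, k'))"
      unfolding pwqv using k vw index_mult_mat_sum[of k w k' "?q * v"] by simp
    also have "\<dots> = (\<Sum>j<m. T k j * v $$ (j, k'))"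
      by (rule sum.cong) (use k in \<open>simp_all add: qv T_def mult.assoc\<close>)
    finally show ?thesis .
  qed
  \<comment> \<open>\<open>C\<close> bounds \<open>w q\<close> for the summed norm. An entrywise
    error below \<open>1 / (C + 1)\<close> makes \<open>w q (v - u)\<close> a strict contraction,
    whatever \<open>F\<close> is.\<close>
  define C where "C = (\<Sum>k<n. \<Sum>j<m. norm (T k j))"
  have C0: "C \<ge> 0" unfolding C_def by (intro sum_nonneg) auto
  define e where "e = 1 / (C + 1)"
  have e: "e > 0" "e * C < 1" using C0 unfolding e_def by (auto simp: field_simps)
  have "\<exists>U R. propagation_le R U \<and> norm (v $$ (j, k) - U) < e" if "j < m" "k < n" for j k
    using v_Roe vw that unfolding elements_mat_subset_iff by (intro uniform_Roe_approximation e(1)) auto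
  then have "\<forall>j k. \<exists>U R. j < m \<and> k < n \<longrightarrow> propagation_le R U \<and> norm (v $$ (j, k) - U) < e" by blast
  then obtain U R' where U: "\<And>j k. j < m \<Longrightarrow> k < n \<Longrightarrow> propagation_le (R' j k) (U j k)"
    "\<And>j k. j < m \<Longrightarrow> k < n \<Longrightarrow> norm (v $$ (j, k) - U j k) < e"
    by metis
  \<comment> \<open>A common radius for all entries; the sum also makes sense when there are no
    entries.\<close>
  define R where "R = (\<Sum>j<m. \<Sum>k<n. R' j k)"
  have propU: "propagation_le R (U j k)" if jk: "j < m" "k < n" for j k
  proof (rule propagation_le_mono[OF U(1)[OF jk]])
    have "R' j k \<le> (\<Sum>k<n. R' j k)" using jk by (intro member_le_sum) auto
    also have "\<dots> \<le> R" unfolding R_def using jk by (intro member_le_sum[of j _ "\<lambda>j. \<Sum>k<n. R' j k"]) auto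
    finally show "R' j k \<le> R" .
  qed
  have "sum (fibre_rank E) F \<le> sum (fibre_rank E') (nbhd R F)" if F: "finite F" for F
  proof (rule ccontr)
    assume less: "\<not> sum (fibre_rank E) F \<le> sum (fibre_rank E') (nbhd R F)"
    define A where "A = (SIGMA x:F. {k. (x, k) \<in> E})"
    define B where "B = (SIGMA y:nbhd R F. {j. (y, j) \<in> E'})"
    have fin: "finite A" "finite B"
      unfolding A_def B_def using F finite_nbhd[OF F] finite_fibre[OF E] finite_fibre[OF E'] by auto
    have "card A = sum (fibre_rank E) F" "card B = sum (fibre_rank E') (nbhd R F)"
      unfolding A_def B_def fibre_rank_def using F finite_nbhd[OF F] finite_fibre[OF E] finite_fibre[OF E']
      by (simp_all add: card_SigmaI)
    then have "card B < card A" using less by simp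
    from underdetermined_system[OF fin(2,1) this, of "\<lambda>(y, j) (x, k). ell2_apply (bop_apply (U j k) (delta x)) y"]
    obtain s where s: "\<exists>a\<in>A. s a \<noteq> 0"
      "\<forall>b\<in>B. (\<Sum>a\<in>A. (case b of (y, j) \<Rightarrow> \<lambda>(x, k). ell2_apply (bop_apply (U j k) (delta x)) y) a * s a) = 0"
      by auto
    define \<xi> where "\<xi> k = (\<Sum>x\<in>F. scaleC_ell2 (if (x, k) \<in> E then s (x, k) else 0) (delta x))" for k
    have \<xi>: "ell2_apply (\<xi> k) x = (if x \<in> F \<and> (x, k) \<in> E then s (x, k) else 0)" for k x
    proof -
      have "ell2_apply (\<xi> k) x = (\<Sum>x'\<in>F. (if (x', k) \<in> E then s (x', k) else 0) * (if x = x' then 1 else 0))"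
        by (simp only: \<xi>_def ell2_apply_sum ell2_apply_simps)
      also have "\<dots> = (\<Sum>x'\<in>F. if x' = x then (if (x, k) \<in> E then s (x, k) else 0) else 0)"
        by (rule sum.cong) auto
      finally show ?thesis using F by simp
    qed
    have zero: "(\<Sum>k<n. bop_apply (mult_op (\<lambda>x. ind ((x, j) \<in> E'))) (bop_apply (U j k) (\<xi> k))) = 0" if j: "j < m" for j
    proof (rule ell2_eqI)
      fix y
      have "ell2_apply (\<Sum>k<n. bop_apply (mult_op (\<lambda>x. ind ((x, j) \<in> E'))) (bop_apply (U j k) (\<xi> k))) y
        = ind ((y, j) \<in> E') * (\<Sum>k<n. ell2_apply (bop_apply (U j k) (\<xi> k)) y)"
        by (simp add: ell2_apply_sum mult_op_apply[OF bounded_ind] sum_distrib_left)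
      moreover have "(\<Sum>k<n. ell2_apply (bop_apply (U j k) (\<xi> k)) y) = 0" if yj: "(y, j) \<in> E'"
      proof -
        have "(\<Sum>k<n. ell2_apply (bop_apply (U j k) (\<xi> k)) y)
          = (\<Sum>k<n. \<Sum>x\<in>F. (if (x, k) \<in> E then s (x, k) else 0) * ell2_apply (bop_apply (U j k) (delta x)) y)"
          unfolding \<xi>_def bop_apply_linear bop_apply_scaleC ell2_apply_sum by simp
        also have "\<dots> = (\<Sum>x\<in>F. \<Sum>k<n. if (x, k) \<in> E then ell2_apply (bop_apply (U j k) (delta x)) y * s (x, k) else 0)"
          by (subst sum.swap) (intro sum.cong refl, simp)
        also have "\<dots> = (\<Sum>x\<in>F. \<Sum>k | (x, k) \<in> E. ell2_apply (bop_apply (U j k) (delta x)) y * s (x, k))"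
          using E by (intro sum.cong refl sum.mono_neutral_cong_right) auto
        also have "\<dots> = (\<Sum>(x, k)\<in>A. ell2_apply (bop_apply (U j k) (delta x)) y * s (x, k))"
          unfolding A_def using F finite_fibre[OF E] by (subst sum.Sigma) auto
        also have "\<dots> = 0"
        proof (cases "y \<in> nbhd R F")
          case True
          then have "(y, j) \<in> B" using yj by (simp add: B_def)
          with s(2) show ?thesis by (force simp: case_prod_unfold)
        next
          \<comment> \<open>The system has no equation for such \<open>y\<close>. The sum vanishes
            there because \<open>U j k\<close> moves points of \<open>F\<close> by at most
            \<open>R\<close>.\<close>
          case False
          have "ell2_apply (bop_apply (U j k) (delta x)) y = 0" if "(x, k) \<in> A" for x k
          proof -
            have "k < n" "x \<in> F" using that E by (auto simp: A_def)
            then show ?thesis using propU[OF j] False unfolding propagation_le_def nbhd_def by blast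
          qed
          then show ?thesis by (intro sum.neutral) auto
        qed
        finally show ?thesis .
      qed
      ultimately show "ell2_apply (\<Sum>k<n. bop_apply (mult_op (\<lambda>x. ind ((x, j) \<in> E'))) (bop_apply (U j k) (\<xi> k))) y = ell2_apply 0 y"
        by (auto simp: ind_mult)
    qed
    define N where "N = (\<Sum>k<n. norm (\<xi> k))"
    have bound: "norm (\<xi> k) \<le> (\<Sum>j<m. norm (T k j)) * (e * N)" if k: "k < n" for k
    proof -
      have "\<xi> k = bop_apply (?p $$ (k, k)) (\<xi> k)"
        by (rule ell2_eqI) (simp add: index_diag_projection k mult_op_apply[OF bounded_ind] ind_mult \<xi>)
      also have "\<dots> = (\<Sum>k'<n. if k' = k then bop_apply (?p $$ (k, k)) (\<xi> k) else 0)" using k by simp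
      also have "\<dots> = (\<Sum>k'<n. bop_apply (?p $$ (k, k')) (\<xi> k'))"
        by (rule sum.cong) (use k in \<open>auto simp: index_diag_projection\<close>)
      also have "\<dots> = (\<Sum>k'<n. \<Sum>j<m. bop_apply (T k j) (bop_apply (v $$ (j, k')) (\<xi> k')))"
        by (rule sum.cong) (use k in \<open>simp_all add: p_kk' bop_apply_sum\<close>)
      also have "\<dots> = (\<Sum>k'<n. \<Sum>j<m. bop_apply (T k j) (bop_apply (v $$ (j, k') - U j k') (\<xi> k')))
          + (\<Sum>k'<n. \<Sum>j<m. bop_apply (T k j) (bop_apply (U j k') (\<xi> k')))"
        by (simp add: bop_apply_linear sum_subtractf)
      also have "(\<Sum>k'<n. \<Sum>j<m. bop_apply (T k j) (bop_apply (U j k') (\<xi> k'))) =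
        (\<Sum>j<m. bop_apply (w $$ (k, j)) (\<Sum>k'<n. bop_apply (mult_op (\<lambda>x. ind ((x, j) \<in> E'))) (bop_apply (U j k') (\<xi> k'))))"
        by (subst sum.swap) (simp add: T_def bop_apply_linear)
      also have "\<dots> = 0" by (rule sum.neutral) (simp add: zero bop_apply_linear)
      finally have "norm (\<xi> k) = norm (\<Sum>k'<n. \<Sum>j<m. bop_apply (T k j) (bop_apply (v $$ (j, k') - U j k') (\<xi> k')))" by simp
      also have "\<dots> \<le> (\<Sum>k'<n. \<Sum>j<m. norm (T k j) * (e * norm (\<xi> k')))"
      proof (rule sum_norm_le, rule sum_norm_le)
        fix k' j assume "k' \<in> {..<n}" "j \<in> {..<m}"
        then have "norm (bop_apply (v $$ (j, k') - U j k') (\<xi> k')) \<le> e * norm (\<xi> k')"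
          using U(2)[of j k'] norm_bop_apply[of "v $$ (j, k') - U j k'" "\<xi> k'"]
          by (meson lessThan_iff less_imp_le mult_right_mono norm_ge_zero order_trans)
        then show "norm (bop_apply (T k j) (bop_apply (v $$ (j, k') - U j k') (\<xi> k'))) \<le> norm (T k j) * (e * norm (\<xi> k'))"
          using norm_bop_apply[of "T k j" "bop_apply (v $$ (j, k') - U j k') (\<xi> k')"]
          by (meson mult_left_mono norm_ge_zero order_trans)
      qed
      also have "\<dots> = (\<Sum>j<m. norm (T k j)) * (e * N)"
      proof -
        have "(\<Sum>k'<n. \<Sum>j<m. norm (T k j) * (e * norm (\<xi> k'))) = (\<Sum>k'<n. (\<Sum>j<m. norm (T k j)) * (e * norm (\<xi> k')))"
          by (simp only: sum_distrib_right)
        then show ?thesis by (simp only: N_def sum_distrib_left[symmetric])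
      qed
      finally show ?thesis .
    qed
    \<comment> \<open>Summing over \<open>k\<close> gives \<open>N \<le> (e * C) * N\<close> with
      \<open>e * C < 1\<close>, so \<open>N = 0\<close> and every component of \<xi>
      vanishes.\<close>
    have "N \<le> (\<Sum>k<n. (\<Sum>j<m. norm (T k j)) * (e * N))" unfolding N_def by (intro sum_mono) (use bound N_def in auto)
    also have "\<dots> = (e * C) * N" unfolding C_def sum_distrib_right[symmetric] by simp
    finally have "(1 - e * C) * N \<le> 0" by (simp add: algebra_simps)
    then have "N \<le> 0" using e(2) by (simp add: mult_le_0_iff)
    moreover have "N \<ge> 0" unfolding N_def by (intro sum_nonneg) auto
    ultimately have "N = 0" by simp
    then have \<xi>0: "\<xi> k = 0" if "k < n" for k
      unfolding N_def using that by (subst (asm) sum_nonneg_eq_0_iff) auto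
    obtain x k where xk: "(x, k) \<in> A" "s (x, k) \<noteq> 0" using s(1) by auto
    then have "x \<in> F" "(x, k) \<in> E" "k < n" using E by (auto simp: A_def)
    then have "s (x, k) = ell2_apply (\<xi> k) x" by (simp add: \<xi>)
    also have "\<dots> = 0" using \<xi>0[OF \<open>k < n\<close>] by simp
    finally show False using xk(2) by simp
  qed
  then show ?thesis by blast
qed

lemma mvn_diag_projection_boundary:
  assumes mvn: "(diag_projection n E, diag_projection m E') \<in> mvn_rel (uniform_Roe_algebra S)"
    and E: "E \<subseteq> UNIV \<times> {..<n}" and E': "E' \<subseteq> UNIV \<times> {..<m}"
  shows "(\<lambda>x. int (fibre_rank E x) - int (fibre_rank E' x)) \<in> uf_boundary ` uf_chains S"
proof -
  have mvn': "(diag_projection m E', diag_projection n E) \<in> mvn_rel (uniform_Roe_algebra S)"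
    using mvn Roe.equiv_mvn_rel unfolding equiv_def sym_def by blast
  obtain R1 where R1: "\<And>F. finite F \<Longrightarrow> sum (fibre_rank E) F \<le> sum (fibre_rank E') (nbhd R1 F)"
    using mvn_diag_projection_rank_le[OF mvn E E'] by blast
  obtain R2 where R2: "\<And>F. finite F \<Longrightarrow> sum (fibre_rank E') F \<le> sum (fibre_rank E) (nbhd R2 F)"
    using mvn_diag_projection_rank_le[OF mvn' E' E] by blast
  have rank_le: "fibre_rank E x \<le> n" if "E \<subseteq> UNIV \<times> {..<n}" for E :: "('g \<times> nat) set" and n x
  proof -
    have "card {k. (x, k) \<in> E} \<le> card {..<n}" using that by (intro card_mono) auto
    then show ?thesis by (simp add: fibre_rank_def)
  qed
  have mono: "sum h (nbhd R F) \<le> sum h (nbhd (max R1 R2) F)" if "finite F" "R \<le> max R1 R2" for h :: "'g \<Rightarrow> nat" and R F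
    by (rule sum_mono2[OF finite_nbhd[OF that(1)] nbhd_mono[OF that(2)]]) simp
  show ?thesis
  proof (rule uf_boundaryI)
    show "fibre_rank E x \<le> max n m" for x using rank_le[OF E, of x] by simp
    show "fibre_rank E' x \<le> max n m" for x using rank_le[OF E', of x] by simp
    show "sum (fibre_rank E) F \<le> sum (fibre_rank E') (nbhd (max R1 R2) F)" if "finite F" for F
      using R1[OF that] mono[OF that, of R1 "fibre_rank E'"] by simp
    show "sum (fibre_rank E') F \<le> sum (fibre_rank E) (nbhd (max R1 R2) F)" if "finite F" for F
      using R2[OF that] mono[OF that, of R2 "fibre_rank E"] by simp
  qed
qed

lemma Roe_K0_of_function_eq_one:
  assumes f: "f \<in> carrier bounded_functions" and one: "Roe.K0_of_function f = \<one>\<^bsub>K0 (uniform_Roe_algebra S)\<^esub>"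
  shows "f \<in> uf_boundary ` uf_chains S"
proof -
  let ?p = "rank_projection f" and ?q = "rank_projection (\<lambda>x. - f x)" and ?A = "uniform_Roe_algebra S"
  have "K0_class ?A ?p ?q = K0_class ?A (0\<^sub>m 0 0) (0\<^sub>m 0 0)"
    using one Roe.K0_class_diag[OF Roe.empty_projection] unfolding Roe.K0_of_function_def by simp
  then obtain e where e: "e \<in> projections ?A" and mvn: "(direct_sum_mat ?p e, direct_sum_mat ?q e) \<in> mvn_rel ?A"
    using Roe.K0_class_eq_iff[OF Roe.rank_projection_closed Roe.rank_projection_closed Roe.empty_projection Roe.empty_projection]
    by (auto simp: direct_sum_mat_empty)
  define k where "k = dim_row e"
  have ec: "e \<in> carrier_mat k k" unfolding k_def by (rule Roe.projectionsD(1)[OF e])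
  have c: "1\<^sub>m k - e \<in> projections ?A" by (rule Roe.complement_projection(1)[OF e ec])
  note refl = equiv_class_self[OF Roe.equiv_mvn_rel]
  have s: "(direct_sum_mat r (direct_sum_mat e (1\<^sub>m k - e)), direct_sum_mat r (1\<^sub>m k)) \<in> mvn_rel ?A"
    if "r \<in> projections ?A" for r
    using refl[OF that] Roe.mvn_complement[OF e ec] by (intro Roe.mvn_direct_sum) auto
  have "(direct_sum_mat ?p (direct_sum_mat e (1\<^sub>m k - e)), direct_sum_mat ?q (direct_sum_mat e (1\<^sub>m k - e))) \<in> mvn_rel ?A"
    using Roe.mvn_direct_sum[OF mvn, of "1\<^sub>m k - e" "1\<^sub>m k - e"] refl[OF c] by (simp add: direct_sum_mat_assoc)
  then have "(direct_sum_mat ?p (1\<^sub>m k), direct_sum_mat ?q (1\<^sub>m k)) \<in> mvn_rel ?A"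
    using s[OF Roe.rank_projection_closed[of f]] s[OF Roe.rank_projection_closed[of "\<lambda>x. - f x"]] Roe.equiv_mvn_rel
    unfolding equiv_def sym_def trans_def by meson
  note mvn1 = this[unfolded rank_projection_eq one_mat_diag_projection]
  note sub = rank_set_subset[OF f] rank_set_subset[OF bounded_functions_uminus[OF f]]
  have sub1: "UNIV \<times> {..<k} \<subseteq> UNIV \<times> {..<k}" by simp
  note mvn2 = mvn1[unfolded direct_sum_diag_projection[OF sub(1)] direct_sum_diag_projection[OF sub(2)]]
  \<comment> \<open>The added unit matrix contributes rank \<open>k\<close> everywhere on both sides
    and cancels.\<close>
  have "int (fibre_rank (fibre_plus (rank_bound f) (rank_set f) (UNIV \<times> {..<k})) x)
      - int (fibre_rank (fibre_plus (rank_bound (\<lambda>x. - f x)) (rank_set (\<lambda>x. - f x)) (UNIV \<times> {..<k})) x) = f x" for x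
    by (simp add: fibre_rank_plus[OF sub(1) sub1] fibre_rank_plus[OF sub(2) sub1] fibre_rank_rank_set)
  then show ?thesis
    using mvn_diag_projection_boundary[OF mvn2 fibre_plus_subset[OF sub(1) sub1] fibre_plus_subset[OF sub(2) sub1]]
    by (simp only:)
qed

end

section \<open>The comparison map, its injectivity, and its splitting for infinite groups\<close>

context finitely_generated_group begin

sublocale crossed: star_algebra "reduced_crossed_product :: ('g \<times> 'g) bop set"
  by (rule star_algebra_reduced_crossed_product)

sublocale inclusion: star_hom "linf_algebra :: 'g bop set" "uniform_Roe_algebra S" "\<lambda>T. T"
  by (rule star_hom_inclusion[OF star_algebra_linf star_algebra_uniform_Roe linf_subset_uniform_Roe])

sublocale amplify: star_hom "uniform_Roe_algebra S" "reduced_crossed_product :: ('g \<times> 'g) bop set" amplify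
proof
  show "amplify T \<in> reduced_crossed_product" if "T \<in> uniform_Roe_algebra S" for T
    using that unfolding reduced_crossed_product_eq by (rule imageI)
qed (auto simp: amplify_simps amplify_adjoint)

text \<open>A compression is not multiplicative in general. On the crossed product it is, because
  every element there is amplified and the compression inverts \<open>amplify\<close>.\<close>

sublocale restrict: star_hom "reduced_crossed_product :: ('g \<times> 'g) bop set" "uniform_Roe_algebra S" restrict_fibre
proof
  fix V W :: "('g \<times> 'g) bop" assume V: "V \<in> reduced_crossed_product"
  then obtain T where T: "T \<in> uniform_Roe_algebra S" "V = amplify T" unfolding reduced_crossed_product_eq by auto
  show "restrict_fibre V \<in> uniform_Roe_algebra S" using T by simp
  assume "W \<in> reduced_crossed_product"
  then obtain U where U: "W = amplify U" unfolding reduced_crossed_product_eq by auto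
  show "restrict_fibre (V + W) = restrict_fibre V + restrict_fibre W"
    "restrict_fibre (V * W) = restrict_fibre V * restrict_fibre W"
    unfolding T(2) U amplify_simps(1,3)[symmetric] restrict_fibre_amplify by (rule refl)+
  assume "is_adjoint V W"
  then show "is_adjoint (restrict_fibre V) (restrict_fibre W)"
    unfolding is_adjoint_def T(2) U restrict_fibre_amplify
    using cinner_embed_fibre(1)[of "bop_apply (amplify T) (embed_fibre _)"] cinner_embed_fibre(2)[of _ "bop_apply (amplify U) (embed_fibre _)"]
    by (metis fibre_amplify fibre_embed_fibre)
next
  show "restrict_fibre 0 = (0 :: 'g bop)" using restrict_fibre_amplify[of "0 :: 'g bop"] by (simp add: amplify_simps)
qed

lemma K0_map_linf_class: "K0_map (uniform_Roe_algebra S) (\<lambda>T. T) (K0_linf_class f) = Roe.K0_of_function f"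
proof -
  have id: "map_mat (\<lambda>T. T) p = p" for p :: "'g bop mat" by (rule eq_matI) auto
  have "rank_projection f \<in> projections linf_algebra" for f :: "'g \<Rightarrow> int"
    unfolding rank_projection_eq by (rule linf_diag_projection)
  then show ?thesis
    unfolding K0_linf_class_def Roe.K0_of_function_def by (simp add: inclusion.K0_map_class id)
qed

abbreviation (input) uf_class :: "('g \<Rightarrow> int) \<Rightarrow> ('g \<Rightarrow> int) set" where
  "uf_class f \<equiv> uf_boundary ` uf_chains S #>\<^bsub>bounded_functions\<^esub> f"

text \<open>Representatives of one class differ by a boundary, whose class in \<open>K0\<close> is
  trivial, so \<open>the_elem\<close> is applied to a singleton.\<close>

lemma comparison_map_class:
  assumes f: "f \<in> carrier bounded_functions"
  shows "comparison_map S (uf_class f) = Roe.K0_of_function f"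
proof -
  interpret K: comm_group "K0 (uniform_Roe_algebra S)" by (rule Roe.comm_group_K0)
  have "K0_map (uniform_Roe_algebra S) (\<lambda>T. T) (K0_linf_class g) = Roe.K0_of_function f" if "g \<in> uf_class f" for g
  proof -
    have "(\<lambda>x. g x - f x) \<in> uf_boundary ` uf_chains S" using that by (simp only: mem_rcos_bounded_functions)
    then obtain c where c: "c \<in> uf_chains S" "uf_boundary c = (\<lambda>x. g x - f x)" by auto
    have "g = (\<lambda>x. uf_boundary c x + f x)" unfolding c(2) by simp
    then have "Roe.K0_of_function g = Roe.K0_of_function (uf_boundary c) \<otimes>\<^bsub>K0 (uniform_Roe_algebra S)\<^esub> Roe.K0_of_function f"
      using Roe.K0_of_function_plus[OF uf_boundary_bounded[OF c(1)] f] by simp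
    also have "\<dots> = Roe.K0_of_function f"
      unfolding Roe_K0_of_boundary[OF c(1)] by (rule K.l_one[OF Roe.K0_of_function_closed])
    finally show ?thesis unfolding K0_map_linf_class .
  qed
  moreover have "f \<in> uf_class f" by (rule bf.rcos_self[OF f subgroup_uf_boundaries])
  ultimately have "(\<lambda>g. K0_map (uniform_Roe_algebra S) (\<lambda>T. T) (K0_linf_class g)) ` uf_class f = {Roe.K0_of_function f}"
    by blast
  then show ?thesis unfolding comparison_map_def by simp
qed

lemma H0_uf_cases:
  assumes "X \<in> carrier (H0_uf S)"
  obtains f where "f \<in> carrier bounded_functions" "X = uf_class f"
  using assms unfolding H0_uf_def by (rule FactGroup_comm_group_cases)

lemma uf_class_mult:
  assumes "f \<in> carrier bounded_functions" "g \<in> carrier bounded_functions"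
  shows "uf_class f \<otimes>\<^bsub>H0_uf S\<^esub> uf_class g = uf_class (\<lambda>x. f x + g x)"
  unfolding H0_uf_def by (rule mult_FactGroup_bounded_functions[OF subgroup_uf_boundaries assms])

lemma comparison_map_hom: "comparison_map S \<in> hom (H0_uf S) (K0 (uniform_Roe_algebra S))"
proof (rule homI)
  fix X assume "X \<in> carrier (H0_uf S)"
  then obtain f where f: "f \<in> carrier bounded_functions" "X = uf_class f" by (rule H0_uf_cases)
  show "comparison_map S X \<in> carrier (K0 (uniform_Roe_algebra S))"
    unfolding f(2) comparison_map_class[OF f(1)] by (rule Roe.K0_of_function_closed)
  fix Y assume "Y \<in> carrier (H0_uf S)"
  then obtain g where g: "g \<in> carrier bounded_functions" "Y = uf_class g" by (rule H0_uf_cases)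
  show "comparison_map S (X \<otimes>\<^bsub>H0_uf S\<^esub> Y) = comparison_map S X \<otimes>\<^bsub>K0 (uniform_Roe_algebra S)\<^esub> comparison_map S Y"
    unfolding f(2) g(2) uf_class_mult[OF f(1) g(1)] comparison_map_class[OF f(1)] comparison_map_class[OF g(1)]
      comparison_map_class[OF bounded_functions_plus[OF f(1) g(1)]]
    by (rule Roe.K0_of_function_plus[OF f(1) g(1)])
qed

lemma comparison_map_crossed_hom:
  "comparison_map_crossed S \<in> hom (H0_uf S) (K0 (reduced_crossed_product :: ('g \<times> 'g) bop set))"
proof -
  have "K0_map reduced_crossed_product amplify \<circ> comparison_map S
      \<in> hom (H0_uf S) (K0 (reduced_crossed_product :: ('g \<times> 'g) bop set))"
    by (rule hom_compose[OF comparison_map_hom amplify.K0_map_hom])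
  then show ?thesis unfolding comparison_map_crossed_def[abs_def] o_def .
qed

lemma K0_map_restrict_amplify:
  assumes "X \<in> carrier (K0 (uniform_Roe_algebra S))"
  shows "K0_map (uniform_Roe_algebra S) restrict_fibre (K0_map reduced_crossed_product amplify X) = X"
proof -
  obtain p q where X: "p \<in> projections (uniform_Roe_algebra S)" "q \<in> projections (uniform_Roe_algebra S)"
    "X = K0_class (uniform_Roe_algebra S) p q" using assms by (rule Roe.K0_cases)
  have "map_mat restrict_fibre (map_mat amplify p) = p" for p :: "'g bop mat" by (rule eq_matI) auto
  then show ?thesis
    unfolding X(3) amplify.K0_map_class[OF X(1,2)]
    using restrict.K0_map_class[OF amplify.map_mat_projections[OF X(1)] amplify.map_mat_projections[OF X(2)]] by simp
qed

lemma comparison_map_crossed_inj: "inj_on (comparison_map_crossed S) (carrier (H0_uf S))"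
proof (rule inj_onI)
  fix X Y assume XY: "X \<in> carrier (H0_uf S)" "Y \<in> carrier (H0_uf S)"
    and eq: "comparison_map_crossed S X = comparison_map_crossed S Y"
  interpret K: comm_group "K0 (uniform_Roe_algebra S)" by (rule Roe.comm_group_K0)
  have retract: "K0_map (uniform_Roe_algebra S) restrict_fibre (comparison_map_crossed S Z) = comparison_map S Z"
    if "Z \<in> carrier (H0_uf S)" for Z
    unfolding comparison_map_crossed_def by (rule K0_map_restrict_amplify[OF hom_in_carrier[OF comparison_map_hom that]])
  have cXY: "comparison_map S X = comparison_map S Y"
    unfolding retract[OF XY(1), symmetric] retract[OF XY(2), symmetric] eq by (rule refl)
  obtain f where f: "f \<in> carrier bounded_functions" "X = uf_class f" using XY(1) by (rule H0_uf_cases)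
  obtain g where g: "g \<in> carrier bounded_functions" "Y = uf_class g" using XY(2) by (rule H0_uf_cases)
  have fg: "Roe.K0_of_function f = Roe.K0_of_function g"
    using cXY unfolding f(2) g(2) comparison_map_class[OF f(1)] comparison_map_class[OF g(1)] .
  have d: "(\<lambda>x. f x - g x) \<in> carrier bounded_functions" by (rule bounded_functions_minus[OF f(1) g(1)])
  have "Roe.K0_of_function (\<lambda>x. f x - g x) \<otimes>\<^bsub>K0 (uniform_Roe_algebra S)\<^esub> Roe.K0_of_function g = Roe.K0_of_function g"
  proof -
    have "(\<lambda>x. (f x - g x) + g x) = f" by simp
    then show ?thesis unfolding Roe.K0_of_function_plus[OF d g(1), symmetric] using fg by (simp only:)
  qed
  then have "Roe.K0_of_function (\<lambda>x. f x - g x) = \<one>\<^bsub>K0 (uniform_Roe_algebra S)\<^esub>"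
    by (rule K.r_cancel_one[OF Roe.K0_of_function_closed Roe.K0_of_function_closed, THEN iffD1])
  then have "(\<lambda>x. f x - g x) \<in> uf_boundary ` uf_chains S" by (rule Roe_K0_of_function_eq_one[OF d])
  then show "X = Y"
    unfolding f(2) g(2) using rcos_bounded_functions_eq_iff[OF subgroup_uf_boundaries f(1) g(1)] by simp
qed

text \<open>Divisibility is carried over from \<open>H0_linf\<close> along the isomorphism with real
  homology; injectivity of the comparison map then suffices.\<close>

lemma split_injective_infinite:
  assumes inf: "infinite (UNIV :: 'g set)"
  shows "split_injective (H0_uf S) (K0 (reduced_crossed_product :: ('g \<times> 'g) bop set)) (comparison_map_crossed S)"
proof (rule split_injective_if_divisible[OF comm_group_H0_uf crossed.comm_group_K0 comparison_map_crossed_hom comparison_map_crossed_inj])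
  fix X and n :: nat assume X: "X \<in> carrier (H0_uf S)" and n: "n > 0"
  let ?\<iota> = "H0_uf_to_H0_linf :: ('g \<Rightarrow> int) set \<Rightarrow> ('g \<Rightarrow> real) set"
  have iso: "?\<iota> \<in> iso (H0_uf S) H0_linf" by (rule H0_uf_to_H0_linf_iso[OF inf])
  interpret A: comm_group "H0_uf S" by (rule comm_group_H0_uf)
  interpret L: comm_group "H0_linf :: ('g \<Rightarrow> real) set monoid"
    unfolding H0_linf_def by (rule comm_group_Mod[OF comm_group_bounded_functions subgroup_coinvariant_relations])
  interpret \<iota>: group_hom "H0_uf S" H0_linf ?\<iota>
    by unfold_locales (use iso in \<open>simp add: iso_def\<close>)
  have bij: "bij_betw ?\<iota> (carrier (H0_uf S)) (carrier H0_linf)" using iso by (simp add: iso_def)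
  have "?\<iota> X \<in> carrier H0_linf" using X by simp
  from H0_linf_divisible[OF this n] obtain Z where Z: "Z \<in> carrier H0_linf" "Z [^]\<^bsub>H0_linf\<^esub> n = ?\<iota> X" by auto
  obtain Y where Y: "Y \<in> carrier (H0_uf S)" "Z = ?\<iota> Y" using Z(1) bij unfolding bij_betw_def by auto
  have "?\<iota> (Y [^]\<^bsub>H0_uf S\<^esub> n) = ?\<iota> X" using Z(2) Y by (simp add: \<iota>.hom_nat_pow)
  then have "Y [^]\<^bsub>H0_uf S\<^esub> n = X"
    using bij X Y(1) unfolding bij_betw_def by (auto dest: inj_onD)
  then show "\<exists>Y\<in>carrier (H0_uf S). Y [^]\<^bsub>H0_uf S\<^esub> n = X" using Y(1) by blast
qed

lemma split_injective_canonical_map: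
  assumes inf: "infinite (UNIV :: 'g set)"
  shows "split_injective (H0_linf :: ('g \<Rightarrow> real) set monoid)
    (K0 (reduced_crossed_product :: ('g \<times> 'g) bop set)) (canonical_map S)"
proof -
  let ?\<iota> = "H0_uf_to_H0_linf :: ('g \<Rightarrow> int) set \<Rightarrow> ('g \<Rightarrow> real) set"
  let ?j = "inv_into (carrier (H0_uf S)) ?\<iota>"
  have iso: "?\<iota> \<in> iso (H0_uf S) H0_linf" by (rule H0_uf_to_H0_linf_iso[OF inf])
  interpret A: comm_group "H0_uf S" by (rule comm_group_H0_uf)
  have j: "?j \<in> iso H0_linf (H0_uf S)" by (rule A.iso_set_sym[OF iso])
  obtain r where r: "r \<in> hom (K0 (reduced_crossed_product :: ('g \<times> 'g) bop set)) (H0_uf S)"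
    "\<And>X. X \<in> carrier (H0_uf S) \<Longrightarrow> r (comparison_map_crossed S X) = X"
    using split_injective_infinite[OF inf] unfolding split_injective_def by auto
  have canon: "canonical_map S = comparison_map_crossed S \<circ> ?j" by (simp add: canonical_map_def[abs_def] o_def)
  have "canonical_map S \<in> hom H0_linf (K0 reduced_crossed_product)"
    unfolding canon using j by (intro hom_compose[OF _ comparison_map_crossed_hom]) (simp add: iso_def)
  moreover have "?\<iota> \<circ> r \<in> hom (K0 (reduced_crossed_product :: ('g \<times> 'g) bop set)) H0_linf"
    using iso by (intro hom_compose[OF r(1)]) (simp add: iso_def)
  moreover have "(?\<iota> \<circ> r) (canonical_map S Y) = Y" if "Y \<in> carrier H0_linf" for Y
  proof -
    have "?j Y \<in> carrier (H0_uf S)" using j that by (auto simp: iso_def hom_def)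
    moreover have "?\<iota> (?j Y) = Y"
      using iso that by (intro f_inv_into_f) (auto simp: iso_def bij_betw_def)
    ultimately show ?thesis by (simp add: canon r(2))
  qed
  ultimately show ?thesis unfolding split_injective_def by blast
qed

end

section \<open>Finite groups\<close>

lemma trace_mult_commute:
  fixes A B :: "'a::comm_semiring_0 mat"
  assumes "A \<in> carrier_mat n m" "B \<in> carrier_mat m n"
  shows "(\<Sum>i<n. (A * B) $$ (i, i)) = (\<Sum>j<m. (B * A) $$ (j, j))"
proof -
  have "(\<Sum>i<n. (A * B) $$ (i, i)) = (\<Sum>i<n. \<Sum>j<m. A $$ (i, j) * B $$ (j, i))"
    by (rule sum.cong) (use assms in \<open>simp_all add: scalar_prod_def lessThan_atLeast0\<close>)
  also have "\<dots> = (\<Sum>j<m. \<Sum>i<n. B $$ (j, i) * A $$ (i, j))"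
    by (subst sum.swap) (simp add: mult.commute)
  also have "\<dots> = (\<Sum>j<m. (B * A) $$ (j, j))"
    by (rule sum.cong) (use assms in \<open>simp_all add: scalar_prod_def lessThan_atLeast0\<close>)
  finally show ?thesis .
qed

text \<open>For a triangular matrix the products of entries \<open>(i, k)\<close> and
  \<open>(k, i)\<close> vanish unless \<open>k = i\<close>, so each diagonal entry equals its own
  square.\<close>

lemma idempotent_upper_triangular_diag:
  fixes B :: "complex mat"
  assumes B: "B \<in> carrier_mat n n" "upper_triangular B" "B * B = B" and i: "i < n"
  shows "B $$ (i, i) \<in> {0, 1}"
proof -
  have "B $$ (i, i) = (\<Sum>k<n. B $$ (i, k) * B $$ (k, i))"
    using arg_cong[OF B(3), of "\<lambda>M. M $$ (i, i)"] B(1) i by (simp add: scalar_prod_def lessThan_atLeast0)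
  also have "\<dots> = (\<Sum>k<n. if k = i then B $$ (i, i) * B $$ (i, i) else 0)"
  proof (rule sum.cong)
    fix k assume k: "k \<in> {..<n}"
    show "B $$ (i, k) * B $$ (k, i) = (if k = i then B $$ (i, i) * B $$ (i, i) else 0)"
    proof (cases k i rule: linorder_cases)
      case less then show ?thesis using upper_triangularD[OF B(2), of k i] B(1) i by simp
    next
      case greater then show ?thesis using upper_triangularD[OF B(2), of i k] B(1) k by simp
    qed simp
  qed simp
  also have "\<dots> = B $$ (i, i) * B $$ (i, i)" using i by simp
  finally show ?thesis by auto
qed

text \<open>Schur triangularisation makes the idempotent similar to a triangular one, with diagonal
  entries 0 and 1; the trace does not change under similarity.\<close>

lemma idempotent_trace_Nats:
  fixes M :: "complex mat"
  assumes M: "M \<in> carrier_mat n n" "M * M = M"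
  shows "(\<Sum>i<n. M $$ (i, i)) \<in> \<nat>"
proof -
  obtain as where as: "char_poly M = (\<Prod>a\<leftarrow>as. [:- a, 1:])" using char_poly_factorized[OF M(1)] by auto
  obtain B P Q where BPQ: "schur_decomposition M as = (B, P, Q)" by (metis prod_cases3)
  from schur_decomposition[OF M(1) as BPQ] have sim: "similar_mat_wit M B P Q" and ut: "upper_triangular B" by auto
  note w = similar_mat_witD2[OF M(1) sim]
  have B: "B \<in> carrier_mat n n" and P: "P \<in> carrier_mat n n" and Q: "Q \<in> carrier_mat n n"
    and PQ: "P * Q = 1\<^sub>m n" and QP: "Q * P = 1\<^sub>m n" and MB: "M = P * B * Q" using w by auto
  have QM: "Q * (P * X) = X" if "X \<in> carrier_mat n n" for X
    using assoc_mult_mat[OF Q P that] QP that by simp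
  have PB: "P * B \<in> carrier_mat n n" using P B by auto
  have "Q * M * P = Q * (M * P)" by (rule assoc_mult_mat[OF Q M(1) P])
  also have "M * P = P * B * (Q * P)" unfolding MB by (rule assoc_mult_mat[OF PB Q P])
  also have "\<dots> = P * B" unfolding QP by (rule right_mult_one_mat[OF PB])
  also have "Q * (P * B) = B" by (rule QM[OF B])
  finally have QMP: "Q * M * P = B" .
  have MP: "M * P \<in> carrier_mat n n" and QMc: "Q * M \<in> carrier_mat n n" using M P Q by auto
  have "B * B = Q * M * P * (Q * M * P)" unfolding QMP ..
  also have "\<dots> = Q * M * (P * (Q * M * P))" by (rule assoc_mult_mat[OF QMc P, of _ n]) (use QMc P in auto)
  also have "P * (Q * M * P) = M * P"
  proof -
    have "P * (Q * M * P) = P * (Q * (M * P))" by (simp add: assoc_mult_mat[OF Q M(1) P])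
    also have "\<dots> = (P * Q) * (M * P)" by (rule assoc_mult_mat[OF P Q MP, symmetric])
    finally show ?thesis unfolding PQ left_mult_one_mat[OF MP] .
  qed
  also have "Q * M * (M * P) = Q * (M * (M * P))" by (rule assoc_mult_mat[OF Q M(1) MP])
  also have "M * (M * P) = M * P" using assoc_mult_mat[OF M(1) M(1) P] M(2) by simp
  also have "Q * (M * P) = B" unfolding QMP[symmetric] by (rule assoc_mult_mat[OF Q M(1) P, symmetric])
  finally have BB: "B * B = B" .
  have "(\<Sum>i<n. M $$ (i, i)) = (\<Sum>i<n. (Q * (P * B)) $$ (i, i))"
    unfolding MB by (rule trace_mult_commute[OF PB Q])
  also have "\<dots> = (\<Sum>i<n. B $$ (i, i))" unfolding QM[OF B] ..
  also have "\<dots> = (\<Sum>i<n. of_nat (if B $$ (i, i) = 1 then 1 else 0))"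
    by (rule sum.cong) (use idempotent_upper_triangular_diag[OF B ut BB] in auto)
  also have "\<dots> \<in> \<nat>" unfolding of_nat_sum[symmetric] by (rule of_nat_in_Nats)
  finally show ?thesis .
qed

text \<open>The same for an arbitrary finite index set, to be applied to pairs of a summand and a
  group element.\<close>

lemma idempotent_kernel_trace_Nats:
  fixes P :: "'a \<Rightarrow> 'a \<Rightarrow> complex"
  assumes I: "finite I" and P: "\<And>a c. a \<in> I \<Longrightarrow> c \<in> I \<Longrightarrow> (\<Sum>b\<in>I. P a b * P b c) = P a c"
  shows "(\<Sum>a\<in>I. P a a) \<in> \<nat>"
proof -
  obtain h where h: "bij_betw h {0..<card I} I" using ex_bij_betw_nat_finite[OF I] by auto
  define n where "n = card I"
  have h: "bij_betw h {..<n} I" using h by (simp add: n_def lessThan_atLeast0)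
  define M where "M = mat n n (\<lambda>(i, j). P (h i) (h j))"
  have hI: "h i \<in> I" if "i < n" for i using bij_betw_apply[OF h] that by simp
  have "M * M = M"
  proof (rule eq_matI)
    fix i j assume "i < dim_row M" "j < dim_col M"
    then have ij: "i < n" "j < n" by (simp_all add: M_def)
    have "(M * M) $$ (i, j) = (\<Sum>k<n. P (h i) (h k) * P (h k) (h j))"
      using ij by (simp add: M_def scalar_prod_def lessThan_atLeast0)
    also have "\<dots> = (\<Sum>b\<in>I. P (h i) b * P b (h j))" by (rule sum.reindex_bij_betw[OF h])
    also have "\<dots> = M $$ (i, j)" using ij hI by (simp add: P M_def)
    finally show "(M * M) $$ (i, j) = M $$ (i, j)" .
  qed (simp_all add: M_def)
  then have "(\<Sum>i<n. M $$ (i, i)) \<in> \<nat>" by (rule idempotent_trace_Nats[rotated]) (simp add: M_def)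
  moreover have "(\<Sum>i<n. M $$ (i, i)) = (\<Sum>i<n. P (h i) (h i))" by (rule sum.cong) (simp_all add: M_def)
  moreover have "\<dots> = (\<Sum>a\<in>I. P a a)" by (rule sum.reindex_bij_betw[OF h])
  ultimately show ?thesis by simp
qed

text \<open>The unnormalised trace, so that over a finite index type projections have natural
  numbers as traces.\<close>

definition trace_op :: "'i bop \<Rightarrow> complex" where
  "trace_op T = (\<Sum>x\<in>UNIV. ell2_apply (bop_apply T (delta x)) x)"

definition trace_mat :: "'i bop mat \<Rightarrow> complex" where
  "trace_mat p = (\<Sum>k<dim_row p. trace_op (p $$ (k, k)))"

lemma bop_mult_entries:
  assumes fin: "finite (UNIV :: 'i set)"
  shows "ell2_apply (bop_apply (U * T) (delta z)) x =
    (\<Sum>y\<in>UNIV. ell2_apply (bop_apply U (delta y)) x * ell2_apply (bop_apply T (delta (z :: 'i))) y)"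
proof -
  have v: "v = (\<Sum>y\<in>UNIV. scaleC_ell2 (ell2_apply v y) (delta y))" for v :: "'i ell2"
  proof (rule ell2_eqI)
    fix i
    have "(\<Sum>y\<in>UNIV. ell2_apply v y * (if i = y then 1 else 0)) = (\<Sum>y\<in>UNIV. if y = i then ell2_apply v i else 0)"
      by (rule sum.cong) auto
    then show "ell2_apply v i = ell2_apply (\<Sum>y\<in>UNIV. scaleC_ell2 (ell2_apply v y) (delta y)) i"
      using fin by (simp add: ell2_apply_sum)
  qed
  have expand: "ell2_apply (bop_apply U v) x = (\<Sum>y\<in>UNIV. ell2_apply v y * ell2_apply (bop_apply U (delta y)) x)" for v
  proof -
    have "ell2_apply (bop_apply U v) x = ell2_apply (bop_apply U (\<Sum>y\<in>UNIV. scaleC_ell2 (ell2_apply v y) (delta y))) x"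
      by (rule arg_cong[OF v[of v], of "\<lambda>u. ell2_apply (bop_apply U u) x"])
    then show ?thesis by (simp only: bop_apply_linear bop_apply_scaleC ell2_apply_sum ell2_apply_simps)
  qed
  have "ell2_apply (bop_apply (U * T) (delta z)) x = ell2_apply (bop_apply U (bop_apply T (delta z))) x" by simp
  also have "\<dots> = (\<Sum>y\<in>UNIV. ell2_apply (bop_apply T (delta z)) y * ell2_apply (bop_apply U (delta y)) x)"
    by (rule expand)
  finally show ?thesis by (simp only: mult.commute)
qed

lemma trace_op_simps:
  "trace_op 0 = 0" "trace_op (\<Sum>i\<in>A. T i) = (\<Sum>i\<in>A. trace_op (T i))"
proof -
  show "trace_op (\<Sum>i\<in>A. T i) = (\<Sum>i\<in>A. trace_op (T i))"
    unfolding trace_op_def bop_apply_sum ell2_apply_sum by (rule sum.swap)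
qed (simp add: trace_op_def)

lemma trace_op_commute:
  assumes fin: "finite (UNIV :: 'i set)"
  shows "trace_op (U * T) = trace_op (T * (U :: 'i bop))"
  unfolding trace_op_def bop_mult_entries[OF fin] by (subst sum.swap) (simp add: mult.commute)

lemma trace_mat_commute:
  assumes fin: "finite (UNIV :: 'i set)" and v: "v \<in> carrier_mat m n" "w \<in> carrier_mat n m"
  shows "trace_mat (w * v) = trace_mat (v * (w :: 'i bop mat))"
proof -
  have "trace_mat (w * v) = (\<Sum>k<n. \<Sum>l<m. trace_op (w $$ (k, l) * v $$ (l, k)))"
    unfolding trace_mat_def using v
    by (intro sum.cong) (auto simp: index_mult_mat_sum trace_op_simps simp del: index_mult_mat(1))
  also have "\<dots> = (\<Sum>l<m. \<Sum>k<n. trace_op (v $$ (l, k) * w $$ (k, l)))"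
    by (subst sum.swap) (simp add: trace_op_commute[OF fin, of "w $$ _"])
  also have "\<dots> = trace_mat (v * w)"
    unfolding trace_mat_def using v
    by (intro sum.cong) (auto simp: index_mult_mat_sum trace_op_simps simp del: index_mult_mat(1))
  finally show ?thesis .
qed

lemma trace_mat_direct_sum:
  assumes "dim_row p = dim_col p" "dim_row q = dim_col q"
  shows "trace_mat (direct_sum_mat p q) = trace_mat p + trace_mat q"
proof -
  have split: "(\<Sum>k<a + b. f k) = (\<Sum>k<a. f k) + (\<Sum>k<b. f (a + k))" for f :: "nat \<Rightarrow> complex" and a b
    by (induction b) (simp_all add: add.assoc)
  have "trace_mat (direct_sum_mat p q) =
      (\<Sum>k<dim_row p. trace_op (direct_sum_mat p q $$ (k, k))) +
      (\<Sum>k<dim_row q. trace_op (direct_sum_mat p q $$ (dim_row p + k, dim_row p + k)))"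
    unfolding trace_mat_def dim_direct_sum_mat by (rule split)
  also have "\<dots> = trace_mat p + trace_mat q"
    unfolding trace_mat_def
    by (intro arg_cong2[where f = "(+)"] sum.cong) (use assms in \<open>simp_all add: index_direct_sum_mat\<close>)
  finally show ?thesis .
qed

text \<open>A matrix of operators is flattened to a scalar matrix indexed by summand and basis
  vector, which is idempotent again and has the same trace.\<close>

lemma trace_mat_projection_Nats:
  assumes fin: "finite (UNIV :: 'i set)" and p: "p * p = p" "p \<in> carrier_mat n n"
  shows "trace_mat (p :: 'i bop mat) \<in> \<nat>"
proof -
  define P where "P = (\<lambda>(k, x) (l, y). ell2_apply (bop_apply (p $$ (k, l)) (delta y)) x)"
  have "(\<Sum>a\<in>{..<n} \<times> UNIV. P a a) \<in> \<nat>"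
  proof (rule idempotent_kernel_trace_Nats[where P = P and I = "{..<n} \<times> UNIV"])
    fix a c :: "nat \<times> 'i" assume "a \<in> {..<n} \<times> UNIV" "c \<in> {..<n} \<times> UNIV"
    then obtain k x l z where a: "a = (k, x)" "c = (l, z)" "k < n" "l < n" by auto
    have pkl: "p $$ (k, l) = (\<Sum>i<n. p $$ (k, i) * p $$ (i, l))"
      using index_mult_mat_sum[of k p l p] a(3,4) carrier_matD[OF p(2)] unfolding p(1) by simp
    have "P a c = ell2_apply (bop_apply (p $$ (k, l)) (delta z)) x" by (simp add: P_def a)
    also have "\<dots> = (\<Sum>i<n. ell2_apply (bop_apply (p $$ (k, i) * p $$ (i, l)) (delta z)) x)"
      unfolding bop_apply_sum[symmetric] ell2_apply_sum[symmetric] pkl[symmetric] ..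
    also have "\<dots> = (\<Sum>i<n. \<Sum>y\<in>UNIV. P a (i, y) * P (i, y) c)"
      unfolding bop_mult_entries[OF fin] by (simp add: P_def a)
    also have "\<dots> = (\<Sum>b\<in>{..<n} \<times> UNIV. P a b * P b c)" by (simp add: sum.cartesian_product case_prod_unfold)
    finally show "(\<Sum>b\<in>{..<n} \<times> UNIV. P a b * P b c) = P a c" ..
  qed (simp add: fin)
  moreover have "(\<Sum>a\<in>{..<n} \<times> UNIV. P a a) = (\<Sum>k<n. \<Sum>x\<in>UNIV. P (k, x) (k, x))"
    by (simp add: sum.cartesian_product case_prod_unfold)
  moreover have "\<dots> = trace_mat p"
    unfolding trace_mat_def trace_op_def P_def carrier_matD(1)[OF p(2)] by simp
  ultimately show ?thesis by simp
qed

lemma trace_mat_diag_projection: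
  assumes fin: "finite (UNIV :: 'i set)" and E: "E \<subseteq> UNIV \<times> {..<n}"
  shows "trace_mat (diag_projection n E) = of_nat (\<Sum>x\<in>(UNIV :: 'i set). fibre_rank E x)"
proof -
  have "trace_mat (diag_projection n E) = (\<Sum>k<n. \<Sum>x\<in>UNIV. ind ((x, k) \<in> E))"
    unfolding trace_mat_def trace_op_def by (simp add: index_diag_projection mult_op_delta[OF bounded_ind])
  also have "\<dots> = (\<Sum>x\<in>UNIV. \<Sum>k<n. ind ((x, k) \<in> E))" by (rule sum.swap)
  also have "\<dots> = (\<Sum>x\<in>UNIV. of_nat (fibre_rank E x))"
  proof (rule sum.cong)
    fix x
    have "{..<n} \<inter> {k. (x, k) \<in> E} = {k. (x, k) \<in> E}" using E by auto
    then show "(\<Sum>k<n. ind ((x, k) \<in> E)) = of_nat (fibre_rank E x)"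
      unfolding ind_def fibre_rank_def by (simp add: sum.If_cases)
  qed simp
  finally show ?thesis by simp
qed

section \<open>The trace splitting for finite groups\<close>

context finitely_generated_group begin

text \<open>In a finite group all distances are bounded by one radius, so mass can be moved freely
  and collected at the neutral element.\<close>

lemma finite_group_uf_class:
  assumes fin: "finite (UNIV :: 'g set)"
  shows "uf_class f = uf_class (\<lambda>x. if x = 0 then sum f UNIV else 0)" (is "_ = uf_class ?s")
proof -
  have bounded: "g \<in> carrier bounded_functions" for g :: "'g \<Rightarrow> int"
  proof -
    have "\<bar>g x\<bar> \<le> (\<Sum>x\<in>UNIV. \<bar>g x\<bar>)" for x using fin by (intro member_le_sum) auto
    then show ?thesis by (auto simp: carrier_bounded_functions)
  qed
  \<comment> \<open>The negative part of \<open>?s\<close> is moved to \<open>h\<close> and its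
    positive part to \<open>h'\<close>, so both are nonnegative; their totals agree. Hall's
    condition is then trivial, as the neighbourhood of a nonempty set is everything.\<close>
  define h where "h x = nat (f x) + nat (- ?s x)" for x
  define h' where "h' x = nat (- f x) + nat (?s x)" for x
  have diff: "int (h x) - int (h' x) = f x - ?s x" for x by (simp add: h_def h'_def)
  have "sum ?s UNIV = sum f UNIV" using fin by simp
  moreover have "int (sum h UNIV) - int (sum h' UNIV) = (\<Sum>x\<in>UNIV. f x - ?s x)"
    by (simp only: of_nat_sum sum_subtractf[symmetric] diff)
  moreover have "\<dots> = sum f UNIV - sum ?s UNIV" by (rule sum_subtractf)
  ultimately have "int (sum h UNIV) - int (sum h' UNIV) = 0" by linarith
  then have total: "sum h UNIV = sum h' UNIV" by linarith
  \<comment> \<open>The sum of all distances, as a bound for the diameter.\<close>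
  define R where "R = (\<Sum>p\<in>UNIV. case p of (x, y) \<Rightarrow> word_dist S x (y :: 'g))"
  have R: "word_dist S x y \<le> R" for x y
    unfolding R_def using fin member_le_sum[of "(x, y)" UNIV "\<lambda>(x, y). word_dist S x y"] by (simp add: finite_Prod_UNIV)
  have nbhd: "nbhd R F = UNIV" if "F \<noteq> {}" for F using that R by (auto simp: nbhd_def)
  have "(\<lambda>x. int (h x) - int (h' x)) \<in> uf_boundary ` uf_chains S"
  proof (rule uf_boundaryI)
    show "h x \<le> max (sum h UNIV) (sum h' UNIV)" for x
      using fin member_le_sum[of x UNIV h] by simp
    show "h' x \<le> max (sum h UNIV) (sum h' UNIV)" for x
      using fin member_le_sum[of x UNIV h'] by simp
    show "sum h F \<le> sum h' (nbhd R F)" for F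
      using nbhd[of F] sum_mono2[of UNIV F h] fin total by (cases "F = {}") auto
    show "sum h' F \<le> sum h (nbhd R F)" for F
      using nbhd[of F] sum_mono2[of UNIV F h'] fin total by (cases "F = {}") auto
  qed
  then have "(\<lambda>x. f x - ?s x) \<in> uf_boundary ` uf_chains S" unfolding diff .
  then show ?thesis using rcos_bounded_functions_eq_iff[OF subgroup_uf_boundaries bounded bounded] by blast
qed

text \<open>The trace on \<open>K0\<close>, taken as an integer because it serves as the value of an
  integral function at the neutral element.\<close>

definition K0_trace :: "('g bop mat set \<times> 'g bop mat set) set \<Rightarrow> int" where
  "K0_trace X = (SOME z. \<exists>p\<in>projections (uniform_Roe_algebra S). \<exists>q\<in>projections (uniform_Roe_algebra S).
     X = K0_class (uniform_Roe_algebra S) p q \<and> of_int z = trace_mat p - trace_mat q)"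

lemma trace_mat_mvn:
  assumes fin: "finite (UNIV :: 'g set)" and pq: "(p, q) \<in> mvn_rel (uniform_Roe_algebra S)"
  shows "trace_mat p = trace_mat q"
proof -
  obtain n m v w where 1: "v \<in> carrier_mat m n" "w \<in> carrier_mat n m" "p = w * v" "q = v * w"
    using pq by (rule Roe.mvn_relE)
  show ?thesis unfolding 1(3,4) by (rule trace_mat_commute[OF fin 1(1,2)])
qed

text \<open>Equal classes are related by an equivalence after adding some \<open>e\<close>. The
  trace respects equivalences and direct sums, and the trace of \<open>e\<close> cancels; traces of
  projections are natural numbers, so the integer exists.\<close>

lemma K0_trace_class:
  assumes fin: "finite (UNIV :: 'g set)"
    and p: "p \<in> projections (uniform_Roe_algebra S)" and q: "q \<in> projections (uniform_Roe_algebra S)"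
  shows "of_int (K0_trace (K0_class (uniform_Roe_algebra S) p q)) = trace_mat p - trace_mat q"
proof -
  let ?A = "uniform_Roe_algebra S"
  have nat: "\<exists>n. trace_mat r = of_nat n" if "r \<in> projections ?A" for r
    using trace_mat_projection_Nats[OF fin Roe.projectionsD(3)[OF that] Roe.projectionsD(1)[OF that]]
    by (auto simp: Nats_def)
  obtain a b where "trace_mat p = of_nat a" "trace_mat q = of_nat b" using nat[OF p] nat[OF q] by auto
  then have "of_int (int a - int b) = trace_mat p - trace_mat q" by simp
  then have ex: "\<exists>z. \<exists>p'\<in>projections ?A. \<exists>q'\<in>projections ?A.
     K0_class ?A p q = K0_class ?A p' q' \<and> of_int z = trace_mat p' - trace_mat q'" using p q by blast
  obtain p' q' where p': "p' \<in> projections ?A" and q': "q' \<in> projections ?A"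
    and eq: "K0_class ?A p q = K0_class ?A p' q'"
    and tr: "of_int (K0_trace (K0_class ?A p q)) = trace_mat p' - trace_mat q'"
    using someI_ex[OF ex] unfolding K0_trace_def by auto
  obtain e where e: "e \<in> projections ?A"
    "(direct_sum_mat (direct_sum_mat p q') e, direct_sum_mat (direct_sum_mat p' q) e) \<in> mvn_rel ?A"
    using eq Roe.K0_class_eq_iff[OF p q p' q'] by auto
  have sq: "dim_row r = dim_col r" if "r \<in> projections ?A" for r
    using carrier_matD[OF Roe.projectionsD(1)[OF that]] by simp
  have "trace_mat p + trace_mat q' + trace_mat e = trace_mat p' + trace_mat q + trace_mat e"
    using trace_mat_mvn[OF fin e(2)] p q p' q' e(1) by (simp add: trace_mat_direct_sum sq)
  then show ?thesis unfolding tr by (simp add: algebra_simps)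
qed

text \<open>The left inverse sends a class to the point mass at the neutral element weighted by its
  trace. On the class of \<open>f\<close> the trace is the sum of \<open>f\<close>, which determines
  the homology class.\<close>

lemma split_injective_finite:
  assumes fin: "finite (UNIV :: 'g set)"
  shows "split_injective (H0_uf S) (K0 (reduced_crossed_product :: ('g \<times> 'g) bop set)) (comparison_map_crossed S)"
proof -
  let ?A = "uniform_Roe_algebra S" and ?s = "\<lambda>z x. if x = (0::'g) then z else (0::int)"
  have sb: "?s z \<in> carrier bounded_functions" for z by (auto simp: carrier_bounded_functions intro!: exI[of _ "\<bar>z\<bar>"])
  define r where "r X = uf_class (?s (K0_trace X))" for X
  have sq: "dim_row p = dim_col p" if "p \<in> projections ?A" for p
    using carrier_matD[OF Roe.projectionsD(1)[OF that]] by simp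
  have "r \<in> hom (K0 ?A) (H0_uf S)"
  proof (rule homI)
    show "r X \<in> carrier (H0_uf S)" for X
      unfolding r_def H0_uf_def by (rule rcos_carrier_FactGroup[OF sb])
    fix X Y assume "X \<in> carrier (K0 ?A)" "Y \<in> carrier (K0 ?A)"
    then obtain p q p' q' where p: "p \<in> projections ?A" "q \<in> projections ?A" "X = K0_class ?A p q"
      and p': "p' \<in> projections ?A" "q' \<in> projections ?A" "Y = K0_class ?A p' q'"
      by (metis Roe.K0_cases)
    have XY: "X \<otimes>\<^bsub>K0 ?A\<^esub> Y = K0_class ?A (direct_sum_mat p p') (direct_sum_mat q q')"
      unfolding p(3) p'(3) by (rule Roe.K0_class_mult[OF p(1,2) p'(1,2)])
    have "of_int (K0_trace (X \<otimes>\<^bsub>K0 ?A\<^esub> Y)) = trace_mat (direct_sum_mat p p') - trace_mat (direct_sum_mat q q')"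
      unfolding XY using p p' by (intro K0_trace_class[OF fin] Roe.direct_sum_projections)
    also have "\<dots> = complex_of_int (K0_trace X + K0_trace Y)"
      unfolding p(3) p'(3) of_int_add K0_trace_class[OF fin p(1,2)] K0_trace_class[OF fin p'(1,2)]
      by (simp add: trace_mat_direct_sum sq p p')
    finally have tr: "K0_trace (X \<otimes>\<^bsub>K0 ?A\<^esub> Y) = K0_trace X + K0_trace Y" by (simp only: of_int_eq_iff)
    have "(\<lambda>x. ?s (K0_trace X) x + ?s (K0_trace Y) x) = ?s (K0_trace X + K0_trace Y)" by auto
    then show "r (X \<otimes>\<^bsub>K0 ?A\<^esub> Y) = r X \<otimes>\<^bsub>H0_uf S\<^esub> r Y"
      unfolding r_def tr uf_class_mult[OF sb sb] by simp
  qed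
  then have "r \<circ> K0_map ?A restrict_fibre \<in> hom (K0 (reduced_crossed_product :: ('g \<times> 'g) bop set)) (H0_uf S)"
    by (rule hom_compose[OF restrict.K0_map_hom])
  moreover have "(r \<circ> K0_map ?A restrict_fibre) (comparison_map_crossed S X) = X" if X: "X \<in> carrier (H0_uf S)" for X
  proof -
    obtain f where f: "f \<in> carrier bounded_functions" "X = uf_class f" using X by (rule H0_uf_cases)
    have "K0_map ?A restrict_fibre (comparison_map_crossed S X) = comparison_map S X"
      unfolding comparison_map_crossed_def by (rule K0_map_restrict_amplify[OF hom_in_carrier[OF comparison_map_hom X]])
    also have "\<dots> = Roe.K0_of_function f" unfolding f(2) by (rule comparison_map_class[OF f(1)])
    finally have e: "K0_map ?A restrict_fibre (comparison_map_crossed S X) = Roe.K0_of_function f" .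
    have tr: "trace_mat (rank_projection g) = of_nat (\<Sum>x\<in>UNIV. nat (g x))"
      if "g \<in> carrier bounded_functions" for g :: "'g \<Rightarrow> int"
      unfolding rank_projection_eq trace_mat_diag_projection[OF fin rank_set_subset[OF that]] fibre_rank_rank_set ..
    have "of_int (K0_trace (Roe.K0_of_function f)) = trace_mat (rank_projection f) - trace_mat (rank_projection (\<lambda>x. - f x))"
      unfolding Roe.K0_of_function_def by (rule K0_trace_class[OF fin Roe.rank_projection_closed Roe.rank_projection_closed])
    also have "\<dots> = complex_of_int (int (\<Sum>x\<in>UNIV. nat (f x)) - int (\<Sum>x\<in>UNIV. nat (- f x)))"
      unfolding tr[OF f(1)] tr[OF bounded_functions_uminus[OF f(1)]] by (simp only: of_int_diff of_int_of_nat_eq)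
    also have "int (\<Sum>x\<in>UNIV. nat (f x)) - int (\<Sum>x\<in>UNIV. nat (- f x)) = (\<Sum>x\<in>UNIV. int (nat (f x)) - int (nat (- f x)))"
      by (simp only: of_nat_sum sum_subtractf)
    also have "\<dots> = sum f UNIV" by (rule sum.cong) auto
    finally have trf: "K0_trace (Roe.K0_of_function f) = sum f UNIV" by (simp only: of_int_eq_iff)
    show ?thesis unfolding o_def e r_def trf
      unfolding f(2) by (rule finite_group_uf_class[OF fin, symmetric])
  qed
  ultimately show ?thesis unfolding split_injective_def using comparison_map_crossed_hom by blast
qed

end

text \<open>The first part covers every group through \<open>H0_uf\<close>. The identification of
  sources is itself asserted where it exists, for infinite groups, together with the splitting of
  the map that results from it.\<close>

theorem corollaryC:
  fixes S :: "'g::group_add set"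
  assumes "finite S"
    and "generates_group S"
  shows "split_injective (H0_uf S) (K0 (reduced_crossed_product :: ('g \<times> 'g) bop set))
           (comparison_map_crossed S)
       \<and> (infinite (UNIV :: 'g set) \<longrightarrow>
            H0_uf_to_H0_linf \<in> iso (H0_uf S) (H0_linf :: ('g \<Rightarrow> real) set monoid)
          \<and> split_injective (H0_linf :: ('g \<Rightarrow> real) set monoid)
              (K0 (reduced_crossed_product :: ('g \<times> 'g) bop set)) (canonical_map S))"
proof -
  interpret finitely_generated_group S by (rule finitely_generated_group.intro[OF assms])
  show ?thesis
    using split_injective_finite split_injective_infinite H0_uf_to_H0_linf_iso split_injective_canonical_map by blast
qed

end
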